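(* Let $s\ge1$, let $D_1,\dots,D_s,E$ be effective divisors of degree $\delta$ on $C$, and let $n_1,\dots,n_s\in\mathbb Z$. Suppose that effective divisors $\Delta_2,\dots,\Delta_s$ and $D^{(1)},\dots,D^{(s)}$ of degree $\delta$ and scalars $\lambda_1,\mu_2,\dots,\mu_s,\mu'_2,\dots,\mu'_s\in K^\times$ satisfy: (a) $[D_1,E]^{\overset{1}{\otimes}(-1)^{s-1}n_1}=\lambda_1\cdot[D^{(1)},E]$; (b) for $2\le i\le s$, with $n'_i=(-1)^{s+1-i}n_i$, $[D_i,E]^{\overset{1}{\otimes}n'_i}=\mu_i\cdot[\Delta_i,E]$; (c) for $2\le i\le s$, $\left([D^{(i-1)},E]\overset{1}{\otimes}[\Delta_i,E]\right)^{\overset{1}{\otimes}-1}=\mu'_i\cdot[D^{(i)},E]$; where all the divisors $D_0,D_i,\Delta_i,D^{(i)}$ are disjoint from $E$ and $E_0$. Define $\lambda_i=\dfrac{\mu'_i}{\mu_i\lambda_{i-1}}$ for $2\le i\le s$. Then $D^{(s)}$ represents $\sum_{i=1}^s n_i[\mathcal L^\vee(D_i)]\in J(K)$, i.e. $[\mathcal L^\vee(D^{(s)})]=\sum_{i=1}^s n_i[\mathcal L^\vee(D_i)]$, and $$\bigotimes_{1\le i\le s}^{1}[D_i,E]^{\overset{1}{\otimes}n_i}=\lambda_s\cdot[D^{(s)},E].$$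
   Context: $K$ is a field, $C$ is a nonsingular, complete, geometrically integral curve over $K$ of genus $g$ with $C(K)\neq\emptyset$, and $J$ is its Jacobian, so $J(K)=\operatorname{Pic}^0(C)$. For a nonzero rational function $f$, $(f)$ is its divisor; if $F=\sum_P n_P P$ is a divisor with support disjoint from that of $(f)$, then $f(F)=\prod_P N_{\kappa(P)/K}(f(P))^{n_P}\in K^\times$. Norms: for a divisor $F=\sum_P n_PP$ and a line bundle $\mathcal M$ on $C$, $\mathcal N_F(\mathcal M)$ is the one-dimensional $K$-vector space $\bigotimes_P \mathrm{Norm}_{\kappa(P)/K}(\mathcal M|_P)^{\otimes n_P}$. It is additive in $F$ and functorial and multiplicative in $\mathcal M$. A meromorphic section $s$ of $\mathcal M$ which is regular and non-vanishing around $\operatorname{Supp}F$ has a nonzero norm $\mathcal N_F(s\in\mathcal M)$. Poincaré torsor: $\mathcal P$ is the Poincaré (Mumford) bundle on $J\times J$ (identifying $J$ with its dual). For $x=[D]$, $y=[E]\in J(K)$ with $D,E\in\operatorname{Div}^0(C)$, its fibre at $(x,y)$ is $\mathcal P_{x,y}=\mathcal N_D(\mathcal O_C(E))$, where the spaces obtained from different choices of $D,E$ are identified as follows: (i) $\mathcal N_D(\mathcal O_C(E+(f)))\simeq\mathcal N_D(\mathcal O_C(E))$ is induced by the isomorphism $\mathcal O_C(E+(f))\to\mathcal O_C(E)$, $h\mapsto fh$; (ii) $\mathcal N_{D+(f)}(\mathcal O_C(E))\simeq\mathcal N_D(\mathcal O_C(E))$ identifies $\mathcal N_{D+(f)}(s)$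 with $f((s)_E)\cdot\mathcal N_D(s)$, for any meromorphic section $s$ of $\mathcal O_C(E)$ whose divisor $(s)_E$ as a section of $\mathcal O_C(E)$ is disjoint from $D$ and from $(f)$. $\mathcal P^\times$ is $\mathcal P$ with its zero section removed; its fibres are $K^\times$-torsors, the action being written $\lambda\cdot\pi$. For $D,E\in\operatorname{Div}^0(C)$ with disjoint supports, $(D,E)$ denotes the point $\mathcal N_D(1\in\mathcal O_C(E))\in\mathcal P^\times_{[D],[E]}$. The left partial group law $\overset{1}{\otimes}:\mathcal P^\times_{x,y}\times\mathcal P^\times_{x',y}\to\mathcal P^\times_{x+x',y}$ is induced by the canonical isomorphism $\mathcal N_D(\mathcal O_C(E))\otimes\mathcal N_{D'}(\mathcal O_C(E))\simeq\mathcal N_{D+D'}(\mathcal O_C(E))$. For fixed $y$ it makes $\bigsqcup_x\mathcal P^\times_{x,y}$ a commutative group with identity the element $1\in\mathcal P^\times_{0,y}=\mathcal N_0(\mathcal O_C(E))\setminus\{0\}=K^\times$; $\pi^{\overset{1}{\otimes}n}$ ($n\in\mathbb Z$) and $\bigotimes^{1}$ denote powers and products in this group, and $(\lambda\cdot\pi)^{\overset{1}{\otimes}n}=\lambda^n\cdot\pi^{\overset{1}{\otimes}n}$. Fix a line bundle $\mathcal L$ on $C$ of degree $\delta\ge 2g+1$, with dual $\mathcal L^\vee$, and nonzero $d_0,e_0\in H^0(C,\mathcal L)$ whose divisors $D_0$ and $E_0$ are disjoint. An effective divisor $D$ of degree $\delta$ represents the point $[\mathcal L^\vee(D)]=[D-D_0]=[D-E_0]$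 of $J(K)$. For effective divisors $D,E$ of degree $\delta$ such that $D$ and $D_0$ are disjoint from $E$ and $E_0$, put $[D,E]:=(D-D_0,\,E-E_0)\in\mathcal P^\times$. "Disjoint" means having disjoint supports. *)

theory Defs
  imports
    "HOL-Library.Poly_Mapping"
    "HOL-Algebra.Free_Abelian_Groups"
    "HOL-Algebra.Algebraic_Closure_Type"
    "Jordan_Normal_Form.Determinant"
begin

text \<open>
  A nonsingular complete integral curve over a field \<open>K\<close> is given by its function field: the type
  \<open>'f\<close> is \<open>K(C)\<close>, the type \<open>'k\<close> is \<open>K\<close>, and \<open>\<iota>\<close> is the inclusion of \<open>K\<close> into \<open>K(C)\<close>. The closed
  points of \<open>C\<close> are the normalised discrete valuations of \<open>K(C)\<close> that are trivial on \<open>K\<close>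
  (Hartshorne I.6); the valuation of \<open>0\<close> is set to the dummy value \<open>0\<close>, so that \<open>0\<close> satisfies
  \<open>0 \<le> v 0\<close> and has to be excluded in some definitions.
\<close>

type_synonym 'f point = "'f \<Rightarrow> int"
type_synonym 'f divisor = "'f point \<Rightarrow>\<^sub>0 int"


section \<open>Curves\<close>

definition points :: "('k::field \<Rightarrow> 'f::field) \<Rightarrow> 'f point set" where
  "points \<iota> = {v. v 0 = 0 \<and>
     (\<forall>a b. a \<noteq> 0 \<longrightarrow> b \<noteq> 0 \<longrightarrow> v (a * b) = v a + v b) \<and>
     (\<forall>a b. a \<noteq> 0 \<longrightarrow> b \<noteq> 0 \<longrightarrow> a + b \<noteq> 0 \<longrightarrow> min (v a) (v b) \<le> v (a + b)) \<and>
     (\<forall>c. v (\<iota> c) = 0) \<and>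
     (\<exists>a. v a = 1)}"

definition local_ring :: "'f::field point \<Rightarrow> 'f set" where
  "local_ring P = {a. a = 0 \<or> 0 \<le> P a}"

definition local_ideal :: "'f::field point \<Rightarrow> 'f set" where
  "local_ideal P = {a. a = 0 \<or> 0 < P a}"

definition transcendental_over :: "('k::field \<Rightarrow> 'f::field) \<Rightarrow> 'f \<Rightarrow> bool" where
  "transcendental_over \<iota> x \<longleftrightarrow> (\<forall>p. p \<noteq> 0 \<longrightarrow> poly (map_poly \<iota> p) x \<noteq> 0)"

definition simple_extension :: "('k::field \<Rightarrow> 'f::field) \<Rightarrow> 'f \<Rightarrow> 'f set" where
  "simple_extension \<iota> x =
     {poly (map_poly \<iota> p) x / poly (map_poly \<iota> q) x | p q. poly (map_poly \<iota> q) x \<noteq> 0}"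

definition function_field :: "('k::field \<Rightarrow> 'f::field) \<Rightarrow> bool" where
  "function_field \<iota> \<longleftrightarrow> (\<exists>x. transcendental_over \<iota> x \<and>
     (\<exists>B. finite B \<and>
       (\<forall>h. \<exists>r. (\<forall>b\<in>B. r b \<in> simple_extension \<iota> x) \<and> h = (\<Sum>b\<in>B. r b * b))))"

text \<open>
  Elements of the tensor product of \<open>K(C)\<close> with the algebraic closure of \<open>K\<close> are written as lists
  of pairs (sums of pure tensors). Over a field the bilinear forms separate the elements of a tensor
  product, so such a sum is zero iff all \<open>K\<close>-bilinear forms vanish on it. The curve is geometrically
  integral iff this tensor product is an integral domain.
\<close>

definition bilinear_form :: "('k::field \<Rightarrow> 'f::field) \<Rightarrow> ('f \<Rightarrow> 'k alg_closure \<Rightarrow> 'k) \<Rightarrow> bool" where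
  "bilinear_form \<iota> \<beta> \<longleftrightarrow>
     (\<forall>a a' b. \<beta> (a + a') b = \<beta> a b + \<beta> a' b) \<and>
     (\<forall>a b b'. \<beta> a (b + b') = \<beta> a b + \<beta> a b') \<and>
     (\<forall>c a b. \<beta> (\<iota> c * a) b = c * \<beta> a b) \<and>
     (\<forall>c a b. \<beta> a (to_ac c * b) = c * \<beta> a b)"

definition tensor_zero :: "('k::field \<Rightarrow> 'f::field) \<Rightarrow> ('f \<times> 'k alg_closure) list \<Rightarrow> bool" where
  "tensor_zero \<iota> us \<longleftrightarrow> (\<forall>\<beta>. bilinear_form \<iota> \<beta> \<longrightarrow> (\<Sum>(a, b)\<leftarrow>us. \<beta> a b) = 0)"

definition geometrically_integral :: "('k::field \<Rightarrow> 'f::field) \<Rightarrow> bool" where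
  "geometrically_integral \<iota> \<longleftrightarrow>
     (\<forall>us vs. tensor_zero \<iota> [(a * a', b * b'). (a, b) \<leftarrow> us, (a', b') \<leftarrow> vs] \<longrightarrow>
        tensor_zero \<iota> us \<or> tensor_zero \<iota> vs)"

definition curve :: "('k::field \<Rightarrow> 'f::field) \<Rightarrow> bool" where
  "curve \<iota> \<longleftrightarrow> field_hom \<iota> \<and> function_field \<iota> \<and> geometrically_integral \<iota>"


section \<open>Residue fields and norms\<close>

text \<open>
  The residue field at \<open>P\<close> is \<open>local_ring P\<close> modulo \<open>local_ideal P\<close>. Its elements are written through
  representatives; \<open>residue_basis\<close> says that the classes of the members of a list form a \<open>K\<close>-basis.
\<close>

definition lin_comb :: "('k::field \<Rightarrow> 'f::field) \<Rightarrow> 'f list \<Rightarrow> 'k vec \<Rightarrow> 'f" where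
  "lin_comb \<iota> bs c = (\<Sum>i<length bs. \<iota> (c $ i) * bs ! i)"

definition residue_basis :: "('k::field \<Rightarrow> 'f::field) \<Rightarrow> 'f point \<Rightarrow> 'f list \<Rightarrow> bool" where
  "residue_basis \<iota> P bs \<longleftrightarrow> set bs \<subseteq> local_ring P \<and>
     (\<forall>a\<in>local_ring P. \<exists>!c. c \<in> carrier_vec (length bs) \<and> a - lin_comb \<iota> bs c \<in> local_ideal P)"

definition some_basis :: "('k::field \<Rightarrow> 'f::field) \<Rightarrow> 'f point \<Rightarrow> 'f list" where
  "some_basis \<iota> P = (SOME bs. residue_basis \<iota> P bs)"

definition coords :: "('k::field \<Rightarrow> 'f::field) \<Rightarrow> 'f point \<Rightarrow> 'f \<Rightarrow> 'k vec" where
  "coords \<iota> P a = (THE c. c \<in> carrier_vec (length (some_basis \<iota> P)) \<and>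
     a - lin_comb \<iota> (some_basis \<iota> P) c \<in> local_ideal P)"

definition point_degree :: "('k::field \<Rightarrow> 'f::field) \<Rightarrow> 'f point \<Rightarrow> nat" where
  "point_degree \<iota> P = length (some_basis \<iota> P)"

text \<open>For \<open>u\<close> regular at \<open>P\<close>, the norm from the residue field to \<open>K\<close> of the value of \<open>u\<close> at \<open>P\<close>.\<close>

definition residue_norm :: "('k::field \<Rightarrow> 'f::field) \<Rightarrow> 'f point \<Rightarrow> 'f \<Rightarrow> 'k" where
  "residue_norm \<iota> P u = det (mat (point_degree \<iota> P) (point_degree \<iota> P)
     (\<lambda>(i, j). coords \<iota> P (u * some_basis \<iota> P ! j) $ i))"


section \<open>Divisors and the Jacobian\<close>

definition Div :: "('k::field \<Rightarrow> 'f::field) \<Rightarrow> 'f divisor monoid" where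
  "Div \<iota> = free_Abelian_group (points \<iota>)"

definition degree_div :: "('k::field \<Rightarrow> 'f::field) \<Rightarrow> 'f divisor \<Rightarrow> int" where
  "degree_div \<iota> D = (\<Sum>P\<in>Poly_Mapping.keys D. Poly_Mapping.lookup D P * int (point_degree \<iota> P))"

definition Div0 :: "('k::field \<Rightarrow> 'f::field) \<Rightarrow> 'f divisor set" where
  "Div0 \<iota> = {D \<in> carrier (Div \<iota>). degree_div \<iota> D = 0}"

definition disjoint_div :: "'f divisor \<Rightarrow> 'f divisor \<Rightarrow> bool" where
  "disjoint_div D E \<longleftrightarrow> Poly_Mapping.keys D \<inter> Poly_Mapping.keys E = {}"

definition effective :: "('k::field \<Rightarrow> 'f::field) \<Rightarrow> int \<Rightarrow> 'f divisor \<Rightarrow> bool" where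
  "effective \<iota> d D \<longleftrightarrow>
     D \<in> carrier (Div \<iota>) \<and> (\<forall>P. 0 \<le> Poly_Mapping.lookup D P) \<and> degree_div \<iota> D = d"

definition div_fun :: "('k::field \<Rightarrow> 'f::field) \<Rightarrow> 'f \<Rightarrow> 'f divisor" where
  "div_fun \<iota> f = Abs_poly_mapping (\<lambda>P. if P \<in> points \<iota> then P f else 0)"

definition principal :: "('k::field \<Rightarrow> 'f::field) \<Rightarrow> 'f divisor set" where
  "principal \<iota> = {div_fun \<iota> f | f. f \<noteq> 0}"

definition Pic :: "('k::field \<Rightarrow> 'f::field) \<Rightarrow> 'f divisor set monoid" where
  "Pic \<iota> = Div \<iota> Mod principal \<iota>"

definition div_class :: "('k::field \<Rightarrow> 'f::field) \<Rightarrow> 'f divisor \<Rightarrow> 'f divisor set" where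
  "div_class \<iota> D = principal \<iota> #>\<^bsub>Div \<iota>\<^esub> D"

text \<open>The group \<open>J(K)\<close>; its law is written multiplicatively, following HOL-Algebra.\<close>

definition Jac :: "('k::field \<Rightarrow> 'f::field) \<Rightarrow> 'f divisor set monoid" where
  "Jac \<iota> = (Pic \<iota>)\<lparr>carrier := div_class \<iota> ` Div0 \<iota>\<rparr>"

text \<open>
  \<open>eval_div D u\<close> is the product over \<open>P\<close> of the \<open>n\<^sub>P\<close>-th powers of the norms of \<open>u\<^sub>P(P)\<close>, for a
  family \<open>u\<close> of local functions; the value of one function at a divisor is the case of a constant
  family.
\<close>

definition eval_div :: "('k::field \<Rightarrow> 'f::field) \<Rightarrow> 'f divisor \<Rightarrow> ('f point \<Rightarrow> 'f) \<Rightarrow> 'k" where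
  "eval_div \<iota> D u =
     (\<Prod>P\<in>Poly_Mapping.keys D. residue_norm \<iota> P (u P) powi Poly_Mapping.lookup D P)"

definition fun_at_div :: "('k::field \<Rightarrow> 'f::field) \<Rightarrow> 'f \<Rightarrow> 'f divisor \<Rightarrow> 'k" where
  "fun_at_div \<iota> f D = eval_div \<iota> D (\<lambda>_. f)"

text \<open>
  The genus is the dimension of \<open>H\<^sup>1(C, O)\<close>, computed by the flasque resolution of the structure sheaf
  by the constant sheaf \<open>K(C)\<close> as the space of families \<open>r\<close> in \<open>K(C)\<close> that are regular at almost all
  points, modulo the everywhere regular families and the constant families.
\<close>

definition h1_independent ::
    "('k::field \<Rightarrow> 'f::field) \<Rightarrow> nat \<Rightarrow> (nat \<Rightarrow> 'f point \<Rightarrow> 'f) \<Rightarrow> bool" where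
  "h1_independent \<iota> n r \<longleftrightarrow>
     (\<forall>i<n. finite {P \<in> points \<iota>. r i P \<notin> local_ring P}) \<and>
     (\<forall>c. (\<exists>h. \<forall>P\<in>points \<iota>. (\<Sum>i<n. \<iota> (c i) * r i P) - h \<in> local_ring P) \<longrightarrow>
        (\<forall>i<n. c i = 0))"

definition genus :: "('k::field \<Rightarrow> 'f::field) \<Rightarrow> nat" where
  "genus \<iota> = (GREATEST n. \<exists>r. h1_independent \<iota> n r)"


section \<open>Line bundles\<close>

text \<open>
  Every line bundle on an integral curve is isomorphic to an invertible subsheaf of the constant sheaf
  \<open>K(C)\<close>. Such a subsheaf is given by its stalks at the closed points, and its nonzero rational
  sections are the nonzero elements of \<open>K(C)\<close>. Values outside \<open>points \<iota>\<close> are irrelevant.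
\<close>

type_synonym 'f lbundle = "'f point \<Rightarrow> 'f set"

definition generators :: "'f::field lbundle \<Rightarrow> 'f point \<Rightarrow> 'f set" where
  "generators M P = {t. t \<noteq> 0 \<and> M P = {a * t | a. a \<in> local_ring P}}"

definition line_bundle :: "('k::field \<Rightarrow> 'f::field) \<Rightarrow> 'f lbundle \<Rightarrow> bool" where
  "line_bundle \<iota> M \<longleftrightarrow>
     (\<forall>P\<in>points \<iota>. generators M P \<noteq> {}) \<and> finite {P \<in> points \<iota>. M P \<noteq> local_ring P}"

definition global_sections :: "('k::field \<Rightarrow> 'f::field) \<Rightarrow> 'f lbundle \<Rightarrow> 'f set" where
  "global_sections \<iota> M = {s. \<forall>P\<in>points \<iota>. s \<in> M P}"

text \<open>The divisor of a nonzero rational section \<open>s\<close> as a section of \<open>M\<close>.\<close>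

definition div_section :: "('k::field \<Rightarrow> 'f::field) \<Rightarrow> 'f lbundle \<Rightarrow> 'f \<Rightarrow> 'f divisor" where
  "div_section \<iota> M s = Abs_poly_mapping
     (\<lambda>P. if P \<in> points \<iota> then P (s / (SOME t. t \<in> generators M P)) else 0)"

text \<open>The degree of a line bundle is the common degree of the divisors of its rational sections.\<close>

definition has_degree :: "('k::field \<Rightarrow> 'f::field) \<Rightarrow> 'f lbundle \<Rightarrow> int \<Rightarrow> bool" where
  "has_degree \<iota> M d \<longleftrightarrow> (\<forall>s. s \<noteq> 0 \<longrightarrow> degree_div \<iota> (div_section \<iota> M s) = d)"

definition dual_bundle :: "'f::field lbundle \<Rightarrow> 'f lbundle" where
  "dual_bundle M P = {h. \<forall>m\<in>M P. h * m \<in> local_ring P}"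

definition bundle_of_div :: "'f::field divisor \<Rightarrow> 'f lbundle" where
  "bundle_of_div E P = {h. h = 0 \<or> - Poly_Mapping.lookup E P \<le> P h}"

text \<open>The twist \<open>M(D)\<close>, that is, the product of \<open>M\<close> with the bundle of \<open>D\<close>.\<close>

definition twist :: "'f::field lbundle \<Rightarrow> 'f divisor \<Rightarrow> 'f lbundle" where
  "twist M D P = {h * m | h m. h \<in> bundle_of_div D P \<and> m \<in> M P}"

text \<open>
  The class of a line bundle in \<open>Pic\<close>, which is realised as the divisor class group: the set of the
  divisors of all its nonzero rational sections.
\<close>

definition bundle_class :: "('k::field \<Rightarrow> 'f::field) \<Rightarrow> 'f lbundle \<Rightarrow> 'f divisor set" where
  "bundle_class \<iota> M = {div_section \<iota> M s | s. s \<noteq> 0}"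


section \<open>Norms of line bundles\<close>

text \<open>
  A frame \<open>t\<close> is a choice of a generator \<open>t\<^sub>P\<close> of every stalk \<open>M\<^sub>P\<close>. The \<open>K\<close>-line \<open>N\<^sub>D(M)\<close> is generated by
  the symbols \<open>N\<^sub>D(t)\<close>, the tensor products of the \<open>n\<^sub>P\<close>-th powers of the norms of the \<open>t\<^sub>P|\<^sub>P\<close>, subject to
  \<open>N\<^sub>D(u t) = eval_div D u \<cdot> N\<^sub>D(t)\<close> for families \<open>u\<close> of local units. An element is represented by the
  function sending \<open>t\<close> to its coordinate with respect to the basis \<open>N\<^sub>D(t)\<close>. Then
  \<open>N\<^sub>D(M) \<otimes> N\<^sub>D\<^sub>'(M) \<simeq> N\<^sub>D\<^sub>+\<^sub>D\<^sub>'(M)\<close> is pointwise multiplication, and an isomorphism \<open>\<alpha>\<close> of line bundles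
  acts by \<open>\<phi> \<mapsto> (\<lambda>t. \<phi> (\<alpha>\<^sup>-\<^sup>1 t))\<close>.
\<close>

type_synonym ('k, 'f) norm_elt = "('f point \<Rightarrow> 'f) \<Rightarrow> 'k"

definition frames :: "('k::field \<Rightarrow> 'f::field) \<Rightarrow> 'f lbundle \<Rightarrow> ('f point \<Rightarrow> 'f) set" where
  "frames \<iota> M = {t. \<forall>P\<in>points \<iota>. t P \<in> generators M P}"

definition norm_line ::
    "('k::field \<Rightarrow> 'f::field) \<Rightarrow> 'f divisor \<Rightarrow> 'f lbundle \<Rightarrow> ('k, 'f) norm_elt set" where
  "norm_line \<iota> D M = {\<phi>. (\<forall>t. t \<notin> frames \<iota> M \<longrightarrow> \<phi> t = 0) \<and>
     (\<forall>t\<in>frames \<iota> M. \<forall>t'\<in>frames \<iota> M. \<phi> t = \<phi> t' * eval_div \<iota> D (\<lambda>P. t' P / t P))}"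

text \<open>The norm of a rational section \<open>s\<close> that is regular and non-vanishing around the support of \<open>D\<close>.\<close>

definition norm_section ::
    "('k::field \<Rightarrow> 'f::field) \<Rightarrow> 'f divisor \<Rightarrow> 'f lbundle \<Rightarrow> 'f \<Rightarrow> ('k, 'f) norm_elt" where
  "norm_section \<iota> D M s = (\<lambda>t. if t \<in> frames \<iota> M then eval_div \<iota> D (\<lambda>P. s / t P) else 0)"


section \<open>The Poincare torsor\<close>

text \<open>
  A triple \<open>(D, E, \<phi>)\<close> stands for the nonzero element \<open>\<phi>\<close> of \<open>N\<^sub>D(O(E))\<close>. Points of the torsor are the
  classes of triples under the equivalence relation generated by the identifications of the fibres
  for different choices of \<open>D\<close> and \<open>E\<close>.
\<close>

type_synonym ('k, 'f) triple = "'f divisor \<times> 'f divisor \<times> ('k, 'f) norm_elt"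

definition triples :: "('k::field \<Rightarrow> 'f::field) \<Rightarrow> ('k, 'f) triple set" where
  "triples \<iota> = {(D, E, \<phi>). D \<in> Div0 \<iota> \<and> E \<in> Div0 \<iota> \<and>
     \<phi> \<in> norm_line \<iota> D (bundle_of_div E) \<and> \<phi> \<noteq> (\<lambda>_. 0)}"

inductive identified ::
    "('k::field \<Rightarrow> 'f::field) \<Rightarrow> ('k, 'f) triple \<Rightarrow> ('k, 'f) triple \<Rightarrow> bool" for \<iota> where
  change_right:
    "f \<noteq> 0 \<Longrightarrow> (D, E + div_fun \<iota> f, \<phi>) \<in> triples \<iota> \<Longrightarrow> (D, E, \<lambda>t. \<phi> (\<lambda>P. t P / f)) \<in> triples \<iota> \<Longrightarrow>
     identified \<iota> (D, E + div_fun \<iota> f, \<phi>) (D, E, \<lambda>t. \<phi> (\<lambda>P. t P / f))"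
| change_left:
    "f \<noteq> 0 \<Longrightarrow> s \<noteq> 0 \<Longrightarrow>
     disjoint_div (div_section \<iota> (bundle_of_div E) s) D \<Longrightarrow>
     disjoint_div (div_section \<iota> (bundle_of_div E) s) (div_fun \<iota> f) \<Longrightarrow>
     \<phi> = (\<lambda>t. c * norm_section \<iota> (D + div_fun \<iota> f) (bundle_of_div E) s t) \<Longrightarrow>
     \<psi> = (\<lambda>t. c * (fun_at_div \<iota> f (div_section \<iota> (bundle_of_div E) s) *
                    norm_section \<iota> D (bundle_of_div E) s t)) \<Longrightarrow>
     (D + div_fun \<iota> f, E, \<phi>) \<in> triples \<iota> \<Longrightarrow> (D, E, \<psi>) \<in> triples \<iota> \<Longrightarrow>
     identified \<iota> (D + div_fun \<iota> f, E, \<phi>) (D, E, \<psi>)"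

type_synonym ('k, 'f) torsor_point = "('k, 'f) triple set"

definition torsor_class ::
    "('k::field \<Rightarrow> 'f::field) \<Rightarrow> ('k, 'f) triple \<Rightarrow> ('k, 'f) torsor_point" where
  "torsor_class \<iota> \<tau> = {\<tau>'. equivclp (identified \<iota>) \<tau> \<tau>'}"

definition torsor_fibre ::
    "('k::field \<Rightarrow> 'f::field) \<Rightarrow> 'f divisor set \<Rightarrow> 'f divisor set \<Rightarrow> ('k, 'f) torsor_point set" where
  "torsor_fibre \<iota> x y = {torsor_class \<iota> (D, E, \<phi>) | D E \<phi>.
     (D, E, \<phi>) \<in> triples \<iota> \<and> div_class \<iota> D = x \<and> div_class \<iota> E = y}"

definition torsor_scale ::
    "'k::field \<Rightarrow> ('k, 'f::field) torsor_point \<Rightarrow> ('k, 'f) torsor_point" where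
  "torsor_scale c \<pi> = (\<lambda>(D, E, \<phi>). (D, E, \<lambda>t. c * \<phi> t)) ` \<pi>"

text \<open>
  The left partial group law: all pairs of representatives with a common \<open>E\<close> are multiplied, and the
  union of the resulting (coinciding) classes is taken.
\<close>

definition left_mult ::
    "('k::field \<Rightarrow> 'f::field) \<Rightarrow> ('k, 'f) torsor_point \<Rightarrow> ('k, 'f) torsor_point \<Rightarrow> ('k, 'f) torsor_point" where
  "left_mult \<iota> \<pi> \<pi>' = \<Union>{torsor_class \<iota> (D + D', E, \<lambda>t. \<phi> t * \<phi>' t) | D D' E \<phi> \<phi>'.
     (D, E, \<phi>) \<in> \<pi> \<and> (D', E, \<phi>') \<in> \<pi>'}"

definition left_one ::
    "('k::field \<Rightarrow> 'f::field) \<Rightarrow> 'f divisor set \<Rightarrow> ('k, 'f) torsor_point" where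
  "left_one \<iota> y = \<Union>{torsor_class \<iota> (0, E, norm_section \<iota> 0 (bundle_of_div E) 1) | E. E \<in> y}"

definition left_group ::
    "('k::field \<Rightarrow> 'f::field) \<Rightarrow> 'f divisor set \<Rightarrow> ('k, 'f) torsor_point monoid" where
  "left_group \<iota> y = \<lparr>carrier = (\<Union>x\<in>carrier (Jac \<iota>). torsor_fibre \<iota> x y),
     monoid.mult = left_mult \<iota>, one = left_one \<iota> y\<rparr>"

text \<open>
  The point \<open>(D, E)\<close>, for \<open>D\<close> and \<open>E\<close> of degree \<open>0\<close> with disjoint supports, and the point \<open>[D, E]\<close>
  relative to \<open>D\<^sub>0\<close> and \<open>E\<^sub>0\<close>.
\<close>

definition pair_point ::
    "('k::field \<Rightarrow> 'f::field) \<Rightarrow> 'f divisor \<Rightarrow> 'f divisor \<Rightarrow> ('k, 'f) torsor_point" where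
  "pair_point \<iota> D E = torsor_class \<iota> (D, E, norm_section \<iota> D (bundle_of_div E) 1)"

definition bracket ::
    "('k::field \<Rightarrow> 'f::field) \<Rightarrow> 'f divisor \<Rightarrow> 'f divisor \<Rightarrow> 'f divisor \<Rightarrow> 'f divisor \<Rightarrow>
     ('k, 'f) torsor_point" where
  "bracket \<iota> D\<^sub>0 E\<^sub>0 D E = pair_point \<iota> (D - D\<^sub>0) (E - E\<^sub>0)"

end

(*
  For a fixed second argument B, the elements of the torsor over B are the pairs (D, c), standing for
  c times the norm of a fixed frame of O(B), modulo the pairs ((g), N_(g)(s) / g((s)_B)) given by the
  identification (ii). Since D can be moved away from (s)_B by a principal divisor, one may use these
  relations for every D, whence the torsor over B is the quotient of the group of all pairs by the
  subgroup generated by them; Weil reciprocity is not needed for this. That the identification (i) by f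
  depends on the divisor of f only comes from the fact that functions without zeros and poles are
  constant, together with N_D(c) = 1 for D of degree 0. In the commutative group so obtained, scaling is
  multiplication by a pair (0, c), and the theorem is an induction over the chain.
*)

theory Submission
  imports Defs "Jordan_Normal_Form.Char_Poly"
begin

section \<open>Discrete valuations\<close>

text \<open>A curve is given only by its function field, so the finiteness behind the definitions
  has to be proved first: \<open>div_fun\<close> and \<open>div_section\<close> have their meaning
  only if a function has finitely many zeros and poles, and \<open>residue_norm\<close> only if the
  residue fields are finite over K. Both follow from one bound: K(C) has finite degree over K(t) for
  every transcendental t, and a K[t]-linear relation whose constant coefficients do not all vanish
  can be reduced at a zero of t. That principal divisors have degree 0 is read off from
  \<open>has_degree\<close>, since f and 1 are sections of L of the same degree. The assertion in
  J(K) is extracted from the one in the torsor: the generating relations have principal divisors as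
  first components, so a point of the torsor determines the class of D.\<close>

definition val_ge :: "'f::field point \<Rightarrow> int \<Rightarrow> 'f set" where
  "val_ge P n = {a. a = 0 \<or> n \<le> P a}"

lemma local_ring_eq_val_ge: "local_ring P = val_ge P 0"
  by (auto simp: local_ring_def val_ge_def)

lemma local_ideal_eq_val_ge: "local_ideal P = val_ge P 1"
  by (auto simp: local_ideal_def val_ge_def)

lemma val_geI: "n \<le> P a \<Longrightarrow> a \<in> val_ge P n"
  by (simp add: val_ge_def)

lemma zero_val_ge [simp]: "0 \<in> val_ge P n"
  by (simp add: val_ge_def)

lemma val_ge_mono: "a \<in> val_ge P n \<Longrightarrow> m \<le> n \<Longrightarrow> a \<in> val_ge P m"
  by (auto simp: val_ge_def)

locale curve_point =
  fixes \<iota> :: "'k::field \<Rightarrow> 'f::field" and P :: "'f point"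
  assumes point: "P \<in> points \<iota>"
begin

lemma val_zero [simp]: "P 0 = 0"
  using point by (simp add: points_def)

lemma val_const [simp]: "P (\<iota> c) = 0"
  using point by (simp add: points_def)

lemma val_mult: "a \<noteq> 0 \<Longrightarrow> b \<noteq> 0 \<Longrightarrow> P (a * b) = P a + P b"
  using point by (simp add: points_def)

lemma val_add: "a \<noteq> 0 \<Longrightarrow> b \<noteq> 0 \<Longrightarrow> a + b \<noteq> 0 \<Longrightarrow> min (P a) (P b) \<le> P (a + b)"
  using point by (simp add: points_def)

lemma uniformizer: obtains a where "P a = 1" "a \<noteq> 0"
proof -
  obtain a where "P a = 1" using point by (auto simp: points_def)
  moreover then have "a \<noteq> 0" by auto
  ultimately show ?thesis using that by blast
qed

lemma val_one [simp]: "P 1 = 0"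
  using val_mult[of 1 1] by simp

lemma val_minus_one: "P (-1) = 0"
  using val_mult[of "-1" "-1"] by simp

lemma val_minus [simp]: "P (- a) = P a"
proof (cases "a = 0")
  case False
  then show ?thesis using val_mult[of "-1" a] val_minus_one by simp
qed simp

lemma val_inverse [simp]: "P (inverse a) = - P a"
proof (cases "a = 0")
  case False
  then show ?thesis using val_mult[of a "inverse a"] by simp
qed simp

lemma val_divide: "a \<noteq> 0 \<Longrightarrow> b \<noteq> 0 \<Longrightarrow> P (a / b) = P a - P b"
  by (simp add: divide_inverse val_mult)

lemma val_power: "P (a ^ n) = int n * P a"
proof (cases "a = 0")
  case True
  then show ?thesis by (cases n) auto
next
  case False
  then show ?thesis by (induction n) (auto simp: val_mult algebra_simps)
qed

lemma val_power_int: "P (a powi n) = n * P a"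
  by (auto simp: power_int_def val_power simp flip: power_inverse)

lemma val_ge_add: "a \<in> val_ge P n \<Longrightarrow> b \<in> val_ge P n \<Longrightarrow> a + b \<in> val_ge P n"
  using val_add[of a b] by (cases "a = 0"; cases "b = 0"; cases "a + b = 0") (auto simp: val_ge_def)

lemma val_ge_minus: "a \<in> val_ge P n \<Longrightarrow> - a \<in> val_ge P n"
  by (auto simp: val_ge_def)

lemma val_ge_diff: "a \<in> val_ge P n \<Longrightarrow> b \<in> val_ge P n \<Longrightarrow> a - b \<in> val_ge P n"
  using val_ge_add[of a n "- b"] val_ge_minus[of b n] by simp

lemma val_ge_mult: "a \<in> val_ge P m \<Longrightarrow> b \<in> val_ge P n \<Longrightarrow> a * b \<in> val_ge P (m + n)"
  using val_mult[of a b] by (cases "a = 0"; cases "b = 0") (auto simp: val_ge_def)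

lemma val_ge_mult_left: "a \<in> val_ge P 0 \<Longrightarrow> b \<in> val_ge P n \<Longrightarrow> a * b \<in> val_ge P n"
  using val_ge_mult[of a 0 b n] by simp

lemma val_ge_mult_right: "a \<in> val_ge P n \<Longrightarrow> b \<in> val_ge P 0 \<Longrightarrow> a * b \<in> val_ge P n"
  using val_ge_mult[of a n b 0] by simp

lemma val_ge_const: "\<iota> c \<in> val_ge P 0"
  by (simp add: val_ge_def)

lemma val_ge_one: "1 \<in> val_ge P 0"
  by (simp add: val_ge_def)

lemma val_ge_sum: "(\<And>i. i \<in> A \<Longrightarrow> f i \<in> val_ge P n) \<Longrightarrow> sum f A \<in> val_ge P n"
  by (induction A rule: infinite_finite_induct) (auto intro: val_ge_add)

lemma one_notin_ideal: "1 \<notin> val_ge P 1"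
  by (simp add: val_ge_def)

text \<open>The reverse inequality comes from applying \<open>val_add\<close> to a = (a + b) + (-b).
  Membership of b in \<open>val_ge\<close>, in place of a bound on \<open>P b\<close>, admits b = 0,
  whose valuation is only the dummy value 0.\<close>

lemma val_add_dominant:
  assumes "a \<noteq> 0" "b \<in> val_ge P (P a + 1)"
  shows "a + b \<noteq> 0" "P (a + b) = P a"
proof -
  have *: "a + b \<noteq> 0 \<and> P (a + b) = P a"
  proof (cases "b = 0")
    case False
    then have b: "P a < P b" using assms by (auto simp: val_ge_def)
    have nz: "a + b \<noteq> 0"
    proof
      assume "a + b = 0"
      then have "b = - a" by (simp add: add_eq_0_iff)
      with b show False by simp
    qed
    have "min (P a) (P b) \<le> P (a + b)" using val_add nz assms False by blast
    moreover have "min (P (a + b)) (P (- b)) \<le> P ((a + b) + (- b))"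
      using nz False assms(1) by (intro val_add) auto
    ultimately show ?thesis using nz b by auto
  qed (use assms in auto)
  then show "a + b \<noteq> 0" "P (a + b) = P a" by auto
qed

end


section \<open>Weak approximation\<close>

text \<open>If there were no such a, the valuation ring of v would lie in that of w. Units of v
  would then be units of w, so w would be the multiple of v by \<open>w t\<close> for a uniformizer
  t of v, and the normalisation of both valuations would give v = w.\<close>

lemma point_order_witness:
  assumes v: "v \<in> points \<iota>" and w: "w \<in> points \<iota>" and ne: "v \<noteq> w"
  obtains (witness) a where "a \<noteq> 0" "0 \<le> v a" "w a < 0"
proof (rule ccontr)
  interpret v: curve_point \<iota> v by unfold_locales fact
  interpret w: curve_point \<iota> w by unfold_locales fact
  assume contra: "\<not> thesis"
  have imp: "0 \<le> w a" if "a \<noteq> 0" "0 \<le> v a" for a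
  proof (rule ccontr)
    assume "\<not> 0 \<le> w a"
    then have "w a < 0" by simp
    with \<open>a \<noteq> 0\<close> \<open>0 \<le> v a\<close> have thesis by (rule witness)
    with contra show False ..
  qed
  have units: "w a = 0" if "a \<noteq> 0" "v a = 0" for a
    using imp[of a] imp[of "inverse a"] that by auto
  obtain t where t: "v t = 1" "t \<noteq> 0" by (rule v.uniformizer)
  have eq: "w a = v a * w t" if "a \<noteq> 0" for a
  proof -
    have "v (a / t powi v a) = 0" using t that by (simp add: v.val_divide v.val_power_int)
    then have "w (a / t powi v a) = 0" using units[of "a / t powi v a"] t that by simp
    then show ?thesis using t that by (simp add: w.val_divide w.val_power_int)
  qed
  obtain b where b: "w b = 1" "b \<noteq> 0" by (rule w.uniformizer)
  have "v b * w t = 1" using eq[of b] b by simp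
  moreover have "0 \<le> w t" using imp[of t] t by simp
  ultimately have "w t = 1" by (simp add: zmult_eq_1_iff)
  then have "w a = v a" for a using eq[of a] by (cases "a = 0") auto
  then have "v = w" by (intro ext) simp
  with ne show False ..
qed

text \<open>When w joins S, the old c is corrected by adding a power of d = a / b, which has a zero
  at v and a pole at w.\<close>

lemma point_separation:
  assumes v: "v \<in> points \<iota>" and S: "finite S" "S \<subseteq> points \<iota>" "v \<notin> S"
  obtains c where "c \<noteq> 0" "0 < v c" "\<And>w. w \<in> S \<Longrightarrow> w c < 0"
proof -
  interpret v: curve_point \<iota> v by unfold_locales fact
  from S have "\<exists>c. c \<noteq> 0 \<and> 0 < v c \<and> (\<forall>w\<in>S. w c < 0)"
  proof (induction S rule: finite_induct)
    case empty
    obtain t where "v t = 1" "t \<noteq> 0" by (rule v.uniformizer)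
    then show ?case by (intro exI[of _ t]) auto
  next
    case (insert w S)
    then obtain c where c: "c \<noteq> 0" "0 < v c" "\<forall>u\<in>S. u c < 0" by auto
    have w: "w \<in> points \<iota>" "v \<noteq> w" using insert.prems by auto
    interpret w: curve_point \<iota> w by unfold_locales fact
    obtain a where a: "a \<noteq> 0" "0 \<le> v a" "w a < 0" by (rule point_order_witness[OF v w])
    obtain b where b: "b \<noteq> 0" "0 \<le> w b" "v b < 0"
      by (rule point_order_witness[OF w(1) v]) (use w in auto)
    define d where "d = a / b"
    have d: "d \<noteq> 0" "0 < v d" "w d < 0"
      using a b by (auto simp: d_def v.val_divide w.val_divide)
    show ?case
    proof (cases "w c < 0")
      case True
      then show ?thesis using c by auto
    next
      case False
      \<comment> \<open>An exponent r is bad at u if d ^ r and c have the same valuation there, so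
        that their poles might cancel. As u c < 0, each u excludes at most one exponent; r = 0 is
        excluded to keep the zero at v and the pole at w.\<close>
      define bad where "bad = (\<lambda>u. {r::nat. int r * u d = u c})"
      have fin: "finite (bad u)" if "u \<in> S" for u
      proof -
        have "u c < 0" using c that by auto
        then have "u d \<noteq> 0" if "r \<in> bad u" for r using that by (auto simp: bad_def)
        then have "inj_on (\<lambda>r. int r * u d) (bad u)" by (auto intro!: inj_onI)
        moreover have "(\<lambda>r. int r * u d) ` bad u \<subseteq> {u c}" by (auto simp: bad_def)
        ultimately show ?thesis using finite_imageD finite_subset by blast
      qed
      then have "finite ({0} \<union> (\<Union>u\<in>S. bad u))" using insert.hyps by auto
      then obtain r where r: "r \<notin> {0} \<union> (\<Union>u\<in>S. bad u)"
        using ex_new_if_finite[OF infinite_UNIV_nat] by meson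
      then have r0: "0 < r" by auto
      define h where "h = d ^ r"
      have h: "h \<noteq> 0" "0 < v h" "w h < 0"
        using d r0 by (auto simp: h_def v.val_power w.val_power mult_pos_neg)
      have wch: "h + c \<noteq> 0" "w (h + c) = w h"
        using w.val_add_dominant[of h c] h False by (auto simp: val_ge_def)
      have "0 < v (h + c)"
        using v.val_add[of h c] h c wch by auto
      moreover have "u (h + c) < 0" if u: "u \<in> S" for u
      proof -
        have "u \<in> points \<iota>" using u insert.prems by auto
        then interpret u: curve_point \<iota> u by unfold_locales
        have ne: "u h \<noteq> u c" using r u by (auto simp: h_def bad_def u.val_power)
        have uc: "u c < 0" using c u by auto
        show ?thesis
        proof (cases "u h < u c")
          case True
          then show ?thesis using u.val_add_dominant[of h c] h uc by (auto simp: val_ge_def)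
        next
          case False
          then show ?thesis using u.val_add_dominant[of c h] c ne uc
            by (auto simp: val_ge_def add.commute)
        qed
      qed
      ultimately show ?thesis using wch h by (intro exI[of _ "h + c"]) auto
    qed
  qed
  then show ?thesis using that by blast
qed

text \<open>For c with a zero at v and poles on S, the function 1 / (1 + c) is close to 1 at v and
  vanishes on S.\<close>

lemma point_partition:
  assumes v: "v \<in> points \<iota>" and S: "finite S" "S \<subseteq> points \<iota>" "v \<notin> S"
  obtains e where "e \<noteq> 0" "e - 1 \<in> val_ge v 1" "v e = 0" "\<And>w. w \<in> S \<Longrightarrow> 0 < w e"
proof -
  interpret v: curve_point \<iota> v by unfold_locales fact
  obtain c where c: "c \<noteq> 0" "0 < v c" "\<And>w. w \<in> S \<Longrightarrow> w c < 0"
    using point_separation[OF assms] by blast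
  have 1: "1 + c \<noteq> 0" "v (1 + c) = 0"
    using v.val_add_dominant[of 1 c] c by (auto simp: val_ge_def)
  show ?thesis
  proof (rule that[of "inverse (1 + c)"])
    have "inverse (1 + c) - 1 = - (c * inverse (1 + c))"
      using 1 by (simp add: field_simps)
    then show "inverse (1 + c) - 1 \<in> val_ge v 1"
      using 1 c by (auto simp: val_ge_def v.val_mult)
    show "0 < w (inverse (1 + c))" if w: "w \<in> S" for w
    proof -
      have "w \<in> points \<iota>" using w S by auto
      then interpret w: curve_point \<iota> w by unfold_locales
      show ?thesis using w.val_add_dominant[of c 1] c(1) c(3)[OF w] by (auto simp: val_ge_def add.commute)
    qed
  qed (use 1 in auto)
qed

text \<open>In the sum of the products of a_P with the M-th power of e_P, the term of index Q
  dominates at Q, because e_P is a unit at P and vanishes at the other points of S.\<close>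

lemma weak_approximation:
  assumes S: "finite S" "S \<subseteq> points \<iota>"
  obtains f where "f \<noteq> 0" "\<And>P. P \<in> S \<Longrightarrow> P f = n P"
proof -
  have "\<exists>e. e \<noteq> 0 \<and> P e = 0 \<and> (\<forall>Q\<in>S - {P}. 0 < Q e)" if "P \<in> S" for P
  proof -
    have "P \<in> points \<iota>" "finite (S - {P})" "S - {P} \<subseteq> points \<iota>" "P \<notin> S - {P}"
      using S that by auto
    then obtain e where "e \<noteq> 0" "P e = 0" "\<And>Q. Q \<in> S - {P} \<Longrightarrow> 0 < Q e"
      by (rule point_partition) blast
    then show ?thesis by blast
  qed
  then obtain e where e: "\<And>P. P \<in> S \<Longrightarrow> e P \<noteq> 0 \<and> P (e P) = 0 \<and> (\<forall>Q\<in>S - {P}. 0 < Q (e P))"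
    by metis
  have "\<exists>a. a \<noteq> 0 \<and> P a = n P" if "P \<in> S" for P
  proof -
    interpret curve_point \<iota> P using S that by unfold_locales auto
    obtain t where "P t = 1" "t \<noteq> 0" by (rule uniformizer)
    then show ?thesis by (intro exI[of _ "t powi n P"]) (simp add: val_power_int)
  qed
  then obtain a where a: "\<And>P. P \<in> S \<Longrightarrow> a P \<noteq> 0 \<and> P (a P) = n P" by metis
  \<comment> \<open>M is at least n Q + 1 - Q (a P) for all P and Q in S, which pushes the term of
    index P beyond the order n Q at Q; the inserted 0 keeps the set nonempty.\<close>
  define M where "M = nat (Max (insert 0 ((\<lambda>(P, Q). n Q + 1 - Q (a P)) ` (S \<times> S))))"
  have M: "n Q + 1 - Q (a P) \<le> int M" if "P \<in> S" "Q \<in> S" for P Q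
  proof -
    have "n Q + 1 - Q (a P) \<le> Max (insert 0 ((\<lambda>(P, Q). n Q + 1 - Q (a P)) ` (S \<times> S)))"
      using that S by (intro Max_ge) auto
    then show ?thesis by (simp add: M_def)
  qed
  define f where "f = (\<Sum>P\<in>S. a P * e P ^ M)"
  have f: "f \<noteq> 0 \<and> Q f = n Q" if Q: "Q \<in> S" for Q
  proof -
    interpret curve_point \<iota> Q using S Q by unfold_locales auto
    have main: "a Q * e Q ^ M \<noteq> 0" "Q (a Q * e Q ^ M) = n Q"
      using a[OF Q] e[OF Q] by (auto simp: val_mult val_power)
    have "(\<Sum>P\<in>S - {Q}. a P * e P ^ M) \<in> val_ge Q (n Q + 1)"
    proof (rule val_ge_sum)
      fix P assume P: "P \<in> S - {Q}"
      have "0 < Q (e P)" using e[of P] P Q by blast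
      then have "int M * 1 \<le> int M * Q (e P)" by (intro mult_left_mono) auto
      then show "a P * e P ^ M \<in> val_ge Q (n Q + 1)"
        using M[of P Q] P Q a[of P] e[of P] by (intro val_geI) (auto simp: val_mult val_power)
    qed
    then show ?thesis
      using val_add_dominant[OF main(1)] main S Q by (auto simp: f_def sum.remove[of S Q])
  qed
  show ?thesis
  proof (cases "S = {}")
    case True
    then show ?thesis using that[of 1] by auto
  next
    case False
    then show ?thesis using that[of f] f by auto
  qed
qed


section \<open>Finiteness of the function field over a rational subfield\<close>

text \<open>Gaussian elimination without division, since the coefficients will be polynomials: the
  rows are cross-multiplied with the pivot row, and the solution of the smaller system is scaled by
  the pivot before the variable p is restored.\<close>

lemma homogeneous_system_solution:
  fixes A :: "'i \<Rightarrow> 'j \<Rightarrow> 'r::idom"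
  assumes "finite I" "finite J" "card I < card J"
  shows "\<exists>x. (\<exists>j\<in>J. x j \<noteq> 0) \<and> (\<forall>i\<in>I. (\<Sum>j\<in>J. A i j * x j) = 0)"
  using assms
proof (induction I arbitrary: J A rule: finite_induct)
  case empty
  then have "J \<noteq> {}" by auto
  then show ?case by (intro exI[of _ "\<lambda>_. 1"]) auto
next
  case (insert i I)
  show ?case
  proof (cases "\<forall>j\<in>J. A i j = 0")
    case True
    moreover have "card I < card J" using insert by simp
    ultimately show ?thesis using insert.IH[of J A] insert.prems by auto
  next
    case False
    then obtain p where p: "p \<in> J" "A i p \<noteq> 0" by blast
    have "finite (J - {p})" "card I < card (J - {p})"
      using insert p by auto
    from insert.IH[OF this, of "\<lambda>k j. A i p * A k j - A k p * A i j"]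
    obtain y where y: "\<exists>j\<in>J - {p}. y j \<noteq> 0"
      "\<And>k. k \<in> I \<Longrightarrow> (\<Sum>j\<in>J - {p}. (A i p * A k j - A k p * A i j) * y j) = 0" by blast
    define x where "x = (\<lambda>j. if j = p then - (\<Sum>j\<in>J - {p}. A i j * y j) else A i p * y j)"
    have sum_x: "(\<Sum>j\<in>J. A k j * x j) = (\<Sum>j\<in>J - {p}. (A i p * A k j - A k p * A i j) * y j)" for k
    proof -
      have "(\<Sum>j\<in>J. A k j * x j) = A k p * x p + (\<Sum>j\<in>J - {p}. A k j * x j)"
        using insert.prems p by (simp add: sum.remove)
      also have "(\<Sum>j\<in>J - {p}. A k j * x j) = (\<Sum>j\<in>J - {p}. A i p * A k j * y j)"
        by (intro sum.cong) (auto simp: x_def)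
      also have "A k p * x p = - (\<Sum>j\<in>J - {p}. A k p * A i j * y j)"
        by (simp add: x_def sum_distrib_left mult.assoc)
      also have "- (\<Sum>j\<in>J - {p}. A k p * A i j * y j) + (\<Sum>j\<in>J - {p}. A i p * A k j * y j)
        = (\<Sum>j\<in>J - {p}. (A i p * A k j - A k p * A i j) * y j)"
        by (simp add: sum_subtractf left_diff_distrib)
      finally show ?thesis .
    qed
    have "\<exists>j\<in>J. x j \<noteq> 0" using y(1) p by (auto simp: x_def)
    moreover have "(\<Sum>j\<in>J. A i j * x j) = 0"
      unfolding sum_x by (simp add: mult.commute)
    moreover have "(\<Sum>j\<in>J. A k j * x j) = 0" if "k \<in> I" for k
      unfolding sum_x using y(2) that by blast
    ultimately show ?thesis by auto
  qed
qed

definition poly_at :: "('k::field \<Rightarrow> 'f::field) \<Rightarrow> 'k poly \<Rightarrow> 'f \<Rightarrow> 'f" where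
  "poly_at \<iota> p t = poly (map_poly \<iota> p) t"

text \<open>For transcendental t this bounds the degree of K(C) over K(t) by N: a dependence over
  K(t) becomes one over K[t] once denominators are cleared.\<close>

definition poly_dependent :: "('k::field \<Rightarrow> 'f::field) \<Rightarrow> 'f \<Rightarrow> nat \<Rightarrow> bool" where
  "poly_dependent \<iota> t N \<longleftrightarrow> (\<forall>a. \<exists>r. (\<exists>i\<le>N. r i \<noteq> 0) \<and> (\<Sum>i\<le>N. poly_at \<iota> (r i) t * a i) = 0)"

text \<open>Clearing denominators avoids the field \<open>K(t)\<close>: this is the \<open>K(t)\<close>-span of the \<open>g l\<close>.\<close>

definition poly_span ::
    "('k::field \<Rightarrow> 'f::field) \<Rightarrow> 'f \<Rightarrow> 'i set \<Rightarrow> ('i \<Rightarrow> 'f) \<Rightarrow> 'f set" where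
  "poly_span \<iota> t I g =
     {h. \<exists>c w. c \<noteq> 0 \<and> poly_at \<iota> c t * h = (\<Sum>l\<in>I. poly_at \<iota> (w l) t * g l)}"

section \<open>Spans over K(t) in terms of polynomials in t\<close>

context field_hom
begin

interpretation map_poly_hom: map_poly_idom_hom hom ..

lemma poly_at_add: "poly_at hom (p + q) t = poly_at hom p t + poly_at hom q t"
  by (simp add: poly_at_def hom_distribs)

lemma poly_at_mult: "poly_at hom (p * q) t = poly_at hom p t * poly_at hom q t"
  by (simp add: poly_at_def hom_distribs)

lemma poly_at_0 [simp]: "poly_at hom 0 t = 0"
  by (simp add: poly_at_def)

lemma poly_at_1 [simp]: "poly_at hom 1 t = 1"
  by (simp add: poly_at_def)

lemma poly_at_pCons: "poly_at hom (pCons a p) t = hom a + t * poly_at hom p t"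
  by (simp add: poly_at_def hom_distribs)

lemma poly_at_minus: "poly_at hom (- p) t = - poly_at hom p t"
  by (simp add: poly_at_def hom_distribs)

lemma poly_at_monom: "poly_at hom (monom a n) t = hom a * t ^ n"
  by (simp add: poly_at_def map_poly_monom poly_monom)

lemma poly_at_sum: "poly_at hom (\<Sum>i\<in>A. p i) t = (\<Sum>i\<in>A. poly_at hom (p i) t)"
  by (induction A rule: infinite_finite_induct) (auto simp: poly_at_add)

lemma poly_at_altdef:
  assumes "degree p \<le> n"
  shows "poly_at hom p t = (\<Sum>j\<le>n. hom (coeff p j) * t ^ j)"
proof -
  have "poly_at hom (\<Sum>j\<le>n. monom (coeff p j) j) t = (\<Sum>j\<le>n. hom (coeff p j) * t ^ j)"
    by (simp add: poly_at_sum poly_at_monom)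
  then show ?thesis by (simp add: poly_as_sum_of_monoms'[OF assms])
qed

lemma poly_at_nonzero: "transcendental_over hom t \<Longrightarrow> p \<noteq> 0 \<Longrightarrow> poly_at hom p t \<noteq> 0"
  by (simp add: transcendental_over_def poly_at_def)

lemma poly_span_zero: "0 \<in> poly_span hom t I g"
  unfolding poly_span_def by (intro CollectI exI[of _ 1] exI[of _ "\<lambda>_. 0"]) auto

lemma poly_span_add:
  assumes "h' \<in> poly_span hom t I g" "h \<in> poly_span hom t I g"
  shows "h' + h \<in> poly_span hom t I g"
proof -
  obtain c w d u where *: "c \<noteq> 0" "poly_at hom c t * h' = (\<Sum>l\<in>I. poly_at hom (w l) t * g l)"
    "d \<noteq> 0" "poly_at hom d t * h = (\<Sum>l\<in>I. poly_at hom (u l) t * g l)"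
    using assms unfolding poly_span_def by blast
  have "poly_at hom (c * d) t * (h' + h)
      = poly_at hom d t * (poly_at hom c t * h') + poly_at hom c t * (poly_at hom d t * h)"
    by (simp add: poly_at_mult algebra_simps)
  also have "\<dots> = (\<Sum>l\<in>I. poly_at hom (d * w l + c * u l) t * g l)"
    unfolding * by (simp add: poly_at_mult poly_at_add sum_distrib_left sum.distrib algebra_simps)
  finally show ?thesis using * unfolding poly_span_def
    by (intro CollectI exI[of _ "c * d"] exI[of _ "\<lambda>l. d * w l + c * u l"]) auto
qed

lemma poly_span_scale:
  assumes "h \<in> poly_span hom t I g"
  shows "poly_at hom p t * h \<in> poly_span hom t I g"
proof -
  obtain c w where *: "c \<noteq> 0" "poly_at hom c t * h = (\<Sum>l\<in>I. poly_at hom (w l) t * g l)"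
    using assms unfolding poly_span_def by blast
  have "poly_at hom c t * (poly_at hom p t * h) = poly_at hom p t * (poly_at hom c t * h)"
    by (simp add: algebra_simps)
  also have "\<dots> = (\<Sum>l\<in>I. poly_at hom (p * w l) t * g l)"
    unfolding * by (simp add: poly_at_mult sum_distrib_left algebra_simps)
  finally show ?thesis using * unfolding poly_span_def
    by (intro CollectI exI[of _ c] exI[of _ "\<lambda>l. p * w l"]) auto
qed

lemma poly_span_descale:
  assumes "poly_at hom p t * h \<in> poly_span hom t I g" "p \<noteq> 0"
  shows "h \<in> poly_span hom t I g"
proof -
  obtain c w where *: "c \<noteq> 0"
    "poly_at hom c t * (poly_at hom p t * h) = (\<Sum>l\<in>I. poly_at hom (w l) t * g l)"
    using assms unfolding poly_span_def by blast
  then have "poly_at hom (c * p) t * h = (\<Sum>l\<in>I. poly_at hom (w l) t * g l)"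
    by (simp add: poly_at_mult algebra_simps)
  then show ?thesis using * assms unfolding poly_span_def
    by (intro CollectI exI[of _ "c * p"] exI[of _ w]) auto
qed

lemma poly_span_generator:
  assumes "finite I" "l \<in> I"
  shows "g l \<in> poly_span hom t I g"
proof -
  have "(\<Sum>k\<in>I. poly_at hom (if k = l then 1 else 0) t * g k) = (\<Sum>k\<in>I. if k = l then g k else 0)"
    by (intro sum.cong) auto
  then show ?thesis using assms unfolding poly_span_def
    by (intro CollectI exI[of _ 1] exI[of _ "\<lambda>k. if k = l then 1 else 0"]) auto
qed

lemma poly_span_sum:
  "(\<And>i. i \<in> A \<Longrightarrow> f i \<in> poly_span hom t I g) \<Longrightarrow> sum f A \<in> poly_span hom t I g"
  by (induction A rule: infinite_finite_induct) (auto intro: poly_span_add poly_span_zero)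

text \<open>A denominator times each a j is a combination of the g l with polynomial coefficients. A
  relation between these card I + 1 coefficient rows solves a homogeneous system of card I
  equations, and multiplying it by the denominators gives a relation between the a j.\<close>

lemma poly_span_dependent:
  assumes "finite I" and a: "\<And>j. j \<le> card I \<Longrightarrow> a j \<in> poly_span hom t I g"
  shows "\<exists>r. (\<exists>j\<le>card I. r j \<noteq> 0) \<and> (\<Sum>j\<le>card I. poly_at hom (r j) t * a j) = 0"
proof -
  have "\<forall>j. \<exists>c w. j \<le> card I \<longrightarrow>
      c \<noteq> 0 \<and> poly_at hom c t * a j = (\<Sum>l\<in>I. poly_at hom (w l) t * g l)"
    using a unfolding poly_span_def by blast
  then obtain c w where cw: "\<And>j. j \<le> card I \<Longrightarrow> c j \<noteq> 0"
    "\<And>j. j \<le> card I \<Longrightarrow> poly_at hom (c j) t * a j = (\<Sum>l\<in>I. poly_at hom (w j l) t * g l)"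
    by metis
  obtain r where r: "\<exists>j\<in>{..card I}. r j \<noteq> 0" "\<forall>l\<in>I. (\<Sum>j\<le>card I. w j l * r j) = 0"
    using homogeneous_system_solution[of I "{..card I}" "\<lambda>l j. w j l"] assms by auto
  have "(\<Sum>j\<le>card I. poly_at hom (r j * c j) t * a j)
      = (\<Sum>j\<le>card I. \<Sum>l\<in>I. poly_at hom (w j l * r j) t * g l)"
    by (intro sum.cong refl) (simp add: poly_at_mult mult.assoc cw sum_distrib_left mult.left_commute)
  also have "\<dots> = (\<Sum>l\<in>I. poly_at hom (\<Sum>j\<le>card I. w j l * r j) t * g l)"
    by (subst sum.swap) (simp add: poly_at_sum sum_distrib_right)
  also have "\<dots> = 0" using r by simp
  finally show ?thesis using r cw by (intro exI[of _ "\<lambda>j. r j * c j"]) auto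
qed

lemma simple_extension_span:
  assumes B: "finite B" and h: "h = (\<Sum>b\<in>B. r b * b)" "\<forall>b\<in>B. r b \<in> simple_extension hom x"
  shows "h \<in> poly_span hom x B (\<lambda>b. b)"
  unfolding h(1)
proof (rule poly_span_sum)
  fix b assume b: "b \<in> B"
  then obtain p q where pq: "r b = poly_at hom p x / poly_at hom q x" "poly_at hom q x \<noteq> 0"
    using h(2) unfolding simple_extension_def poly_at_def by fastforce
  then have "poly_at hom q x * (r b * b) = poly_at hom p x * b" by simp
  also have "\<dots> \<in> poly_span hom x B (\<lambda>b. b)"
    by (intro poly_span_scale poly_span_generator[of B b "\<lambda>b. b"] B b)
  finally show "r b * b \<in> poly_span hom x B (\<lambda>b. b)"
    using poly_span_descale[of q x "r b * b"] pq(2) by fastforce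
qed

text \<open>This is the exchange step: a relation between the powers of t with coefficients in K[x]
  is a polynomial relation between x and t, which can be reordered by powers of x. Hence x is
  algebraic over K(t).\<close>

lemma algebraic_relation_swap:
  assumes dep: "poly_dependent hom x N" and t: "transcendental_over hom t"
  obtains e c where "0 < e" "c e \<noteq> 0" "(\<Sum>j\<le>e. poly_at hom (c j) t * x ^ j) = 0"
proof -
  obtain r where r: "\<exists>i\<le>N. r i \<noteq> 0" "(\<Sum>i\<le>N. poly_at hom (r i) x * t ^ i) = 0"
    using dep unfolding poly_dependent_def by meson
  define D where "D = Max (degree ` r ` {..N})"
  have D: "degree (r i) \<le> D" if "i \<le> N" for i
    using that unfolding D_def by (intro Max_ge) auto
  \<comment> \<open>The transposed coefficients: c j collects the coefficients of x ^ j in all the r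
    i as a polynomial in t.\<close>
  define c where "c = (\<lambda>j. \<Sum>i\<le>N. monom (coeff (r i) j) i)"
  have sum_D: "(\<Sum>j\<le>D. poly_at hom (c j) t * x ^ j) = 0"
  proof -
    have "(\<Sum>j\<le>D. poly_at hom (c j) t * x ^ j)
      = (\<Sum>j\<le>D. \<Sum>i\<le>N. hom (coeff (r i) j) * x ^ j * t ^ i)"
      by (simp add: c_def poly_at_sum poly_at_monom sum_distrib_left mult_ac)
    also have "\<dots> = (\<Sum>i\<le>N. (\<Sum>j\<le>D. hom (coeff (r i) j) * x ^ j) * t ^ i)"
      by (subst sum.swap) (simp add: sum_distrib_right)
    also have "\<dots> = (\<Sum>i\<le>N. poly_at hom (r i) x * t ^ i)"
      by (intro sum.cong refl) (simp add: poly_at_altdef[OF D])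
    finally show ?thesis using r by simp
  qed
  obtain i where i: "i \<le> N" "r i \<noteq> 0" using r by blast
  have "coeff (c (degree (r i))) i = (\<Sum>k\<le>N. if k = i then lead_coeff (r i) else 0)"
    unfolding c_def coeff_sum by (intro sum.cong) auto
  then have "c (degree (r i)) \<noteq> 0" using i by auto
  then have ex: "\<exists>j\<le>D. c j \<noteq> 0" using D i by blast
  define e where "e = Max {j. j \<le> D \<and> c j \<noteq> 0}"
  have "e \<in> {j. j \<le> D \<and> c j \<noteq> 0}"
    unfolding e_def using ex by (intro Max_in) auto
  then have e: "e \<le> D" "c e \<noteq> 0" by auto
  have above: "c j = 0" if "e < j" "j \<le> D" for j
  proof (rule ccontr)
    assume "c j \<noteq> 0"
    then have "j \<le> e" unfolding e_def using that by (intro Max_ge) auto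
    with that show False by simp
  qed
  have "(\<Sum>j\<le>D. poly_at hom (c j) t * x ^ j) = (\<Sum>j\<le>e. poly_at hom (c j) t * x ^ j)"
    using e above by (intro sum.mono_neutral_right) auto
  with sum_D have sum_e: "(\<Sum>j\<le>e. poly_at hom (c j) t * x ^ j) = 0" by simp
  \<comment> \<open>For e = 0 the relation would say that the nonzero polynomial c 0 vanishes at t,
    against the transcendence of t.\<close>
  have "0 < e"
    using sum_e e poly_at_nonzero[OF t, of "c 0"] by (cases "e = 0") auto
  with e sum_e show ?thesis using that by blast
qed

text \<open>The definition of a function field gives finiteness over K(x) for one x only. By
  exchange x has degree at most e over K(t), so the products of b in B with the powers of x below e
  generate K(C) over K(t), up to denominators in K[x].\<close>

theorem function_field_poly_dependent:
  assumes ff: "function_field hom" and t: "transcendental_over hom t"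
  obtains N where "poly_dependent hom t N"
proof -
  obtain x B where x: "transcendental_over hom x" and B: "finite B"
    and span: "\<And>h. \<exists>r. (\<forall>b\<in>B. r b \<in> simple_extension hom x) \<and> h = (\<Sum>b\<in>B. r b * b)"
    using ff unfolding function_field_def by blast
  have all: "h \<in> poly_span hom x B (\<lambda>b. b)" for h
    using span[of h] simple_extension_span[OF B] by blast
  have "poly_dependent hom x (card B)"
    unfolding poly_dependent_def using poly_span_dependent[OF B all] by blast
  from algebraic_relation_swap[OF this t] obtain e c where e: "0 < e" "c e \<noteq> 0"
    and rel: "(\<Sum>j\<le>e. poly_at hom (c j) t * x ^ j) = 0" .
  define I where "I = {..<e} \<times> B"
  define g where "g = (\<lambda>(l, b). x ^ l * b)"
  define V where "V = poly_span hom t I g"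
  have fin: "finite I" using B by (simp add: I_def)
  have gen: "x ^ l * b \<in> V" if "l < e" "b \<in> B" for l b
    using poly_span_generator[OF fin, of "(l, b)" g] that by (auto simp: I_def g_def V_def)
  \<comment> \<open>The power x ^ e is rewritten by the relation of degree e; the leading
    coefficient c e is divided out inside the span over K(t).\<close>
  have gen_Suc: "x ^ Suc l * b \<in> V" if l: "l < e" and b: "b \<in> B" for l b
  proof (cases "Suc l = e")
    case False
    then show ?thesis using gen[of "Suc l" b] l b by simp
  next
    case True
    have "poly_at hom (c e) t * x ^ e = - (\<Sum>j<e. poly_at hom (c j) t * x ^ j)"
      using rel by (simp add: sum.atMost_shift lessThan_Suc_atMost[symmetric] add_eq_0_iff add.commute)
    then have "poly_at hom (c e) t * (x ^ e * b) = (\<Sum>j<e. poly_at hom (- c j) t * (x ^ j * b))"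
      by (simp add: mult.assoc[symmetric] sum_distrib_right sum_negf poly_at_minus)
    also have "\<dots> \<in> V" unfolding V_def
      by (intro poly_span_sum poly_span_scale) (use gen b in \<open>auto simp: V_def\<close>)
    finally show ?thesis
      using poly_span_descale e True unfolding V_def by blast
  qed
  have mult_x: "x * h \<in> V" if h: "h \<in> V" for h
  proof -
    obtain d w where dw: "d \<noteq> 0" "poly_at hom d t * h = (\<Sum>l\<in>I. poly_at hom (w l) t * g l)"
      using h unfolding V_def poly_span_def by blast
    have "poly_at hom d t * (x * h) = (\<Sum>l\<in>I. poly_at hom (w l) t * (x * g l))"
      using arg_cong[OF dw(2), of "\<lambda>u. x * u"] by (simp add: sum_distrib_left mult_ac)
    also have "\<dots> \<in> V" unfolding V_def
    proof (intro poly_span_sum poly_span_scale)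
      fix l assume "l \<in> I"
      then show "x * g l \<in> poly_span hom t I g"
        using gen_Suc[of "fst l" "snd l"] by (auto simp: V_def I_def g_def mult.assoc split: prod.splits)
    qed
    finally show ?thesis using poly_span_descale dw(1) unfolding V_def by blast
  qed
  have mult_const: "hom a * h \<in> V" if "h \<in> V" for a h
    using poly_span_scale[of h t I g "[:a:]"] that by (simp add: V_def poly_at_pCons)
  have mult_poly: "poly_at hom p x * h \<in> V" if "h \<in> V" for p h
    using that
  proof (induction p)
    case 0
    then show ?case by (simp add: V_def poly_span_zero)
  next
    case (pCons a p)
    then show ?case
      using poly_span_add[of "hom a * h" t I g "x * (poly_at hom p x * h)"]
        mult_x[of "poly_at hom p x * h"] mult_const[of h a]
      by (simp add: poly_at_pCons V_def[symmetric] distrib_right mult.assoc)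
  qed
  have B_V: "b \<in> V" if "b \<in> B" for b using gen[of 0 b] e that by simp
  have num: "\<exists>q. q \<noteq> 0 \<and> poly_at hom q x * h \<in> V" for h
  proof -
    obtain q w where qw: "q \<noteq> 0" "poly_at hom q x * h = (\<Sum>b\<in>B. poly_at hom (w b) x * b)"
      using all[of h] unfolding poly_span_def by blast
    have "(\<Sum>b\<in>B. poly_at hom (w b) x * b) \<in> V"
      unfolding V_def by (rule poly_span_sum) (use mult_poly B_V in \<open>auto simp: V_def\<close>)
    then show ?thesis using qw by auto
  qed
  have "\<exists>r. (\<exists>j\<le>card I. r j \<noteq> 0) \<and> (\<Sum>j\<le>card I. poly_at hom (r j) t * a j) = 0" for a
  proof -
    have "\<forall>j. \<exists>q. q \<noteq> 0 \<and> poly_at hom q x * a j \<in> V" using num by blast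
    from choice[OF this] obtain q where q: "\<And>j. q j \<noteq> 0 \<and> poly_at hom (q j) x * a j \<in> V" by blast
    \<comment> \<open>A common denominator in K[x] for all the a j: the relation is found between
      the multiples of the a j by Q(x), which lie in V, and Q(x) cancels because x is
      transcendental.\<close>
    define Q where "Q = (\<Prod>j\<le>card I. q j)"
    have Q: "Q \<noteq> 0" using q by (simp add: Q_def)
    have QV: "poly_at hom Q x * a j \<in> V" if "j \<le> card I" for j
    proof -
      have eq: "poly_at hom Q x * a j
        = poly_at hom (\<Prod>i\<in>{..card I} - {j}. q i) x * (poly_at hom (q j) x * a j)"
        unfolding Q_def using that by (subst prod.remove[of _ j]) (auto simp: poly_at_mult mult_ac)
      show ?thesis unfolding eq by (rule mult_poly) (use q in blast)
    qed
    have "\<exists>r. (\<exists>j\<le>card I. r j \<noteq> 0)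
        \<and> (\<Sum>j\<le>card I. poly_at hom (r j) t * (poly_at hom Q x * a j)) = 0"
      by (rule poly_span_dependent[OF fin]) (use QV in \<open>simp add: V_def\<close>)
    then obtain r where r: "\<exists>j\<le>card I. r j \<noteq> 0"
      "(\<Sum>j\<le>card I. poly_at hom (r j) t * (poly_at hom Q x * a j)) = 0"
      by blast
    have "poly_at hom Q x * (\<Sum>j\<le>card I. poly_at hom (r j) t * a j) = 0"
      using r(2) by (simp add: sum_distrib_left mult_ac)
    then have "(\<Sum>j\<le>card I. poly_at hom (r j) t * a j) = 0"
      using poly_at_nonzero[OF x Q] by simp
    with r(1) show ?thesis by blast
  qed
  then have "poly_dependent hom t (card I)" unfolding poly_dependent_def by blast
  then show ?thesis by (rule that)
qed

text \<open>Reduction at a zero of t is useful only if some constant coefficient survives. As long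
  as all of them vanish, the relation can be divided by t, which lowers the degree of the fixed
  nonzero coefficient \<open>r i\<close>.\<close>

lemma poly_dependent_normalised:
  assumes "poly_dependent hom t N" "t \<noteq> 0"
  shows "\<exists>r. (\<exists>i\<le>N. coeff (r i) 0 \<noteq> 0) \<and> (\<Sum>i\<le>N. poly_at hom (r i) t * a i) = 0"
proof -
  obtain r i where r: "i \<le> N" "r i \<noteq> 0" "(\<Sum>i\<le>N. poly_at hom (r i) t * a i) = 0"
    using assms unfolding poly_dependent_def by meson
  define n where "n = degree (r i)"
  from r n_def show ?thesis
  proof (induction n arbitrary: r rule: less_induct)
    case (less n)
    show ?case
    proof (cases "\<exists>i\<le>N. coeff (r i) 0 \<noteq> 0")
      case True
      then show ?thesis using less.prems by blast
    next
      case False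
      define r' where "r' = (\<lambda>j. poly_shift 1 (r j))"
      have r': "r j = pCons 0 (r' j)" if "j \<le> N" for j
        using False that unfolding r'_def
        by (intro poly_eqI) (auto simp: coeff_pCons coeff_poly_shift split: nat.split)
      have nz: "r' i \<noteq> 0" using less.prems r'[of i] by auto
      then have "degree (r' i) < n" using less.prems r'[of i] by simp
      moreover have "t * (\<Sum>i\<le>N. poly_at hom (r' i) t * a i) = (\<Sum>i\<le>N. poly_at hom (r i) t * a i)"
        unfolding sum_distrib_left
        by (intro sum.cong refl) (use r' in \<open>auto simp: poly_at_pCons mult_ac\<close>)
      then have "(\<Sum>i\<le>N. poly_at hom (r' i) t * a i) = 0"
        using less.prems \<open>t \<noteq> 0\<close> by simp
      ultimately show ?thesis using less.IH[of "degree (r' i)" r'] nz less.prems(1) by blast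
    qed
  qed
qed

end


section \<open>Zeros, poles and residue fields\<close>

locale function_field_curve = field_hom \<iota> for \<iota> :: "'k::field \<Rightarrow> 'f::field" +
  assumes function_field: "function_field \<iota>"
begin

context
  fixes P assumes P: "P \<in> points \<iota>"
begin

interpretation curve_point \<iota> P
  by unfold_locales (rule P)

lemma poly_at_regular: "t \<in> val_ge P 0 \<Longrightarrow> poly_at \<iota> q t \<in> val_ge P 0"
  by (induction q) (auto simp: poly_at_pCons intro!: val_ge_add val_ge_mult_left val_ge_const)

text \<open>After the powers of t are split off, p(t) is a nonzero constant plus an element of
  positive valuation.\<close>

lemma positive_valuation_transcendental:
  assumes "0 < P t"
  shows "transcendental_over \<iota> t"
  unfolding transcendental_over_def
proof (intro allI impI)
  have t: "t \<noteq> 0" using assms by auto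
  have regular: "poly_at \<iota> q t \<in> val_ge P 0" for q
    using assms by (intro poly_at_regular val_geI) auto
  have "poly_at \<iota> p t \<noteq> 0" if "p \<noteq> 0" for p
    using that
  proof (induction p)
    case (pCons a q)
    show ?case
    proof (cases "a = 0")
      case True
      with pCons t show ?thesis by (auto simp: poly_at_pCons)
    next
      case False
      have "t * poly_at \<iota> q t \<in> val_ge P 1"
        using assms by (intro val_ge_mult_right regular val_geI) auto
      then show ?thesis
        using val_add_dominant[of "\<iota> a" "t * poly_at \<iota> q t"] False by (simp add: poly_at_pCons)
    qed
  qed simp
  then show "poly (map_poly \<iota> p) t \<noteq> 0" if "p \<noteq> 0" for p
    using that by (simp add: poly_at_def)
qed

lemma poly_at_residue:
  assumes "0 < P t"
  shows "poly_at \<iota> p t - \<iota> (coeff p 0) \<in> val_ge P 1"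
proof -
  have regular: "poly_at \<iota> q t \<in> val_ge P 0" for q
    using assms by (intro poly_at_regular val_geI) auto
  have "t * poly_at \<iota> q t \<in> val_ge P 1" for q
    using assms by (intro val_ge_mult_right regular val_geI) auto
  then show ?thesis by (cases p) (auto simp: poly_at_pCons)
qed

text \<open>Reduction of a relation over K[t] to the residue field of P, where t becomes 0 and every
  coefficient becomes its constant term.\<close>

lemma residue_relation:
  assumes t: "0 < P t" and rel: "(\<Sum>i\<le>N. poly_at \<iota> (r i) t * a i) = 0"
    and a: "\<And>i. i \<le> N \<Longrightarrow> a i \<in> val_ge P 0"
  shows "(\<Sum>i\<le>N. \<iota> (coeff (r i) 0) * a i) \<in> val_ge P 1"
proof -
  have "(\<Sum>i\<le>N. (poly_at \<iota> (r i) t - \<iota> (coeff (r i) 0)) * a i) \<in> val_ge P 1"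
    by (intro val_ge_sum val_ge_mult_right poly_at_residue t a) auto
  then have "- (\<Sum>i\<le>N. \<iota> (coeff (r i) 0) * a i) \<in> val_ge P 1"
    using rel by (simp add: left_diff_distrib sum_subtractf)
  from val_ge_minus[OF this] show ?thesis by simp
qed

end

text \<open>Given N + 1 zeros of t, take e i to be a unit at the i-th zero and to vanish at the
  others. In a normalised relation between them some \<open>r j\<close> has a nonzero constant
  coefficient; reduced at the j-th zero, the relation loses all other terms and contradicts that e j
  is a unit there.\<close>

lemma finite_zeros: "finite {P \<in> points \<iota>. 0 < P t}"
proof (rule ccontr)
  assume inf: "infinite {P \<in> points \<iota>. 0 < P t}"
  then obtain P0 where P0: "P0 \<in> points \<iota>" "0 < P0 t"
    using not_finite_existsD by blast
  then have trans: "transcendental_over \<iota> t" by (rule positive_valuation_transcendental)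
  have t0: "t \<noteq> 0" using P0 by (auto simp: points_def)
  obtain N where N: "poly_dependent \<iota> t N"
    using function_field_poly_dependent[OF function_field trans] .
  obtain S where S: "S \<subseteq> {P \<in> points \<iota>. 0 < P t}" "finite S" "card S = Suc N"
    using infinite_arbitrarily_large[OF inf] by blast
  have "card {..N} = card S" using S by simp
  then obtain Q where Q: "bij_betw Q {..N} S"
    using S finite_same_card_bij[of "{..N}" S] by auto
  then have QS: "Q i \<in> S" if "i \<le> N" for i using that by (auto simp: bij_betw_def)
  have "\<exists>e. e - 1 \<in> val_ge (Q i) 1 \<and> Q i e = 0 \<and> e \<noteq> 0 \<and> (\<forall>w\<in>S - {Q i}. 0 < w e)" if "i \<le> N" for i
  proof -
    have "Q i \<in> points \<iota>" "finite (S - {Q i})" "S - {Q i} \<subseteq> points \<iota>" "Q i \<notin> S - {Q i}"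
      using S QS[OF that] by auto
    then obtain e where "e \<noteq> 0" "e - 1 \<in> val_ge (Q i) 1" "Q i e = 0"
      "\<And>w. w \<in> S - {Q i} \<Longrightarrow> 0 < w e"
      by (rule point_partition) blast
    then show ?thesis by blast
  qed
  then obtain e where e: "\<And>i. i \<le> N \<Longrightarrow> Q i (e i) = 0 \<and> e i \<noteq> 0 \<and> (\<forall>w\<in>S - {Q i}. 0 < w (e i))"
    by metis
  obtain r j where j: "j \<le> N" "coeff (r j) 0 \<noteq> 0"
    and rel: "(\<Sum>i\<le>N. poly_at \<iota> (r i) t * e i) = 0"
    using poly_dependent_normalised[OF N t0, of e] by blast
  have Qj: "Q j \<in> points \<iota>" "0 < Q j t" using QS[OF j(1)] S by auto
  interpret curve_point \<iota> "Q j" by unfold_locales (rule Qj)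
  have others: "e i \<in> val_ge (Q j) 1" if i: "i \<le> N" "i \<noteq> j" for i
  proof -
    have "Q i \<noteq> Q j" using Q i j by (auto simp: bij_betw_def inj_on_def)
    then have "Q j \<in> S - {Q i}" using QS[OF j(1)] by auto
    with e[OF i(1)] have "0 < Q j (e i)" by simp
    then show ?thesis by (intro val_geI) auto
  qed
  have regular: "e i \<in> val_ge (Q j) 0" if "i \<le> N" for i
    using e[OF j(1)] others[of i] val_ge_mono[of "e i" "Q j" 1 0] that by (cases "i = j") (auto simp: val_ge_def)
  have "(\<Sum>i\<le>N. \<iota> (coeff (r i) 0) * e i) \<in> val_ge (Q j) 1"
    by (rule residue_relation[OF Qj rel regular])
  moreover have "(\<Sum>i\<in>{..N} - {j}. \<iota> (coeff (r i) 0) * e i) \<in> val_ge (Q j) 1"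
    by (intro val_ge_sum val_ge_mult_left val_ge_const others) auto
  ultimately have "\<iota> (coeff (r j) 0) * e j \<in> val_ge (Q j) 1"
    using val_ge_diff[of "\<Sum>i\<le>N. \<iota> (coeff (r i) 0) * e i" 1
        "\<Sum>i\<in>{..N} - {j}. \<iota> (coeff (r i) 0) * e i"] j(1)
    by (simp add: sum.remove[of "{..N}" j])
  then show False using e[OF j(1)] j(2) by (auto simp: val_ge_def val_mult)
qed

lemma finite_support: "finite {P \<in> points \<iota>. P f \<noteq> 0}"
proof -
  have "P f \<noteq> 0 \<longleftrightarrow> 0 < P f \<or> 0 < P (inverse f)" if "P \<in> points \<iota>" for P
  proof -
    interpret curve_point \<iota> P by unfold_locales (rule that)
    show ?thesis by auto
  qed
  then have "{P \<in> points \<iota>. P f \<noteq> 0} = {P \<in> points \<iota>. 0 < P f} \<union> {P \<in> points \<iota>. 0 < P (inverse f)}"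
    by blast
  then show ?thesis by (simp add: finite_zeros)
qed

end

section \<open>Bases of the residue fields\<close>

context curve_point
begin

definition residue_independent :: "'f list \<Rightarrow> bool" where
  "residue_independent bs \<longleftrightarrow> set bs \<subseteq> local_ring P \<and>
     (\<forall>c\<in>carrier_vec (length bs). lin_comb \<iota> bs c \<in> local_ideal P \<longrightarrow> c = 0\<^sub>v (length bs))"

end

lemma lin_comb_append:
  "lin_comb \<iota> (bs @ [a]) c = lin_comb \<iota> bs c + \<iota> (c $ length bs) * a"
  by (simp add: lin_comb_def nth_append)

context field_hom
begin

lemma lin_comb_smult:
  "c \<in> carrier_vec (length bs) \<Longrightarrow> lin_comb hom bs (x \<cdot>\<^sub>v c) = hom x * lin_comb hom bs c"
  by (simp add: lin_comb_def hom_mult algebra_simps sum_distrib_left)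

lemma lin_comb_diff:
  "c \<in> carrier_vec (length bs) \<Longrightarrow> d \<in> carrier_vec (length bs) \<Longrightarrow>
     lin_comb hom bs (c - d) = lin_comb hom bs c - lin_comb hom bs d"
  by (simp add: lin_comb_def hom_minus algebra_simps sum_subtractf)

lemma lin_comb_cong_first:
  "(\<And>i. i < length bs \<Longrightarrow> c $ i = d $ i) \<Longrightarrow> lin_comb hom bs c = lin_comb hom bs d"
  by (simp add: lin_comb_def)

end

locale function_field_point = function_field_curve \<iota> + curve_point \<iota> P
  for \<iota> :: "'k::field \<Rightarrow> 'f::field" and P :: "'f point"
begin

text \<open>Lifts of N + 1 residues satisfy a normalised relation over K[t], where t is a
  uniformizer; reduced at P it becomes a nontrivial relation over K.\<close>

lemma residue_independent_bounded:
  obtains N where "\<And>bs. residue_independent bs \<Longrightarrow> length bs \<le> N"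
proof -
  obtain t where t: "P t = 1" "t \<noteq> 0" by (rule uniformizer)
  have "transcendental_over \<iota> t"
    using positive_valuation_transcendental[OF point, of t] t by simp
  then obtain N where N: "poly_dependent \<iota> t N"
    using function_field_poly_dependent[OF function_field] by blast
  have "length bs \<le> N" if bs: "residue_independent bs" for bs
  proof (rule ccontr)
    assume "\<not> length bs \<le> N"
    then have len: "N < length bs" by simp
    obtain r j where j: "j \<le> N" "coeff (r j) 0 \<noteq> 0"
      and rel: "(\<Sum>i\<le>N. poly_at \<iota> (r i) t * bs ! i) = 0"
      using poly_dependent_normalised[OF N t(2), of "(!) bs"] by blast
    define c where "c = vec (length bs) (\<lambda>i. if i \<le> N then coeff (r i) 0 else 0)"
    have "lin_comb \<iota> bs c = (\<Sum>i\<le>N. \<iota> (coeff (r i) 0) * bs ! i)"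
      unfolding lin_comb_def using len by (intro sum.mono_neutral_cong_right) (auto simp: c_def)
    also have "\<dots> \<in> val_ge P 1"
    proof (rule residue_relation[OF point _ rel])
      show "bs ! i \<in> val_ge P 0" if "i \<le> N" for i
        using bs len that by (auto simp: residue_independent_def local_ring_eq_val_ge)
    qed (use t in simp)
    finally have "c = 0\<^sub>v (length bs)"
      using bs by (auto simp: residue_independent_def local_ideal_eq_val_ge c_def)
    then have "c $ j = 0" using j len by simp
    then show False using j len by (simp add: c_def)
  qed
  then show ?thesis by (rule that)
qed

text \<open>An independent list of greatest length is a basis: adjoining a forces a dependence in
  which a has a nonzero coefficient, and dividing by it expresses a. Only now does the choice in
  \<open>some_basis\<close> yield a basis.\<close>

lemma residue_basis_exists: "\<exists>bs. residue_basis \<iota> P bs"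
proof -
  obtain N where N: "\<And>bs. residue_independent bs \<Longrightarrow> length bs \<le> N"
    using residue_independent_bounded by blast
  have "residue_independent []" by (auto simp: residue_independent_def intro!: eq_vecI)
  then obtain bs where bs: "residue_independent bs"
    and max: "\<And>bs'. residue_independent bs' \<Longrightarrow> length bs' \<le> length bs"
    using ex_has_greatest_nat[of residue_independent "[]" length "Suc N"] N
    by (auto simp: less_Suc_eq_le)
  have sub: "set bs \<subseteq> local_ring P" using bs by (simp add: residue_independent_def)
  let ?n = "length bs"
  have ex: "\<exists>c. c \<in> carrier_vec ?n \<and> a - lin_comb \<iota> bs c \<in> local_ideal P"
    if a: "a \<in> local_ring P" for a
  proof -
    have "\<not> residue_independent (bs @ [a])" using max[of "bs @ [a]"] by auto
    then obtain c where c: "c \<in> carrier_vec (Suc ?n)" "lin_comb \<iota> (bs @ [a]) c \<in> local_ideal P"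
      "c \<noteq> 0\<^sub>v (Suc ?n)"
      using sub a by (auto simp: residue_independent_def)
    define d where "d = vec ?n (\<lambda>i. c $ i)"
    have d: "d \<in> carrier_vec ?n" "lin_comb \<iota> bs c = lin_comb \<iota> bs d"
      by (auto simp: d_def intro: lin_comb_cong_first)
    show ?thesis
    proof (cases "c $ ?n = 0")
      case True
      then have "lin_comb \<iota> bs d \<in> local_ideal P" using c d by (simp add: lin_comb_append)
      then have "d = 0\<^sub>v ?n" using bs d by (auto simp: residue_independent_def)
      then have "c = 0\<^sub>v (Suc ?n)"
        using True c by (intro eq_vecI) (auto simp: d_def less_Suc_eq vec_eq_iff)
      with c show ?thesis by simp
    next
      case False
      let ?e = "(- inverse (c $ ?n)) \<cdot>\<^sub>v d"
      have "\<iota> (inverse (c $ ?n)) * (lin_comb \<iota> bs d + \<iota> (c $ ?n) * a) \<in> local_ideal P"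
        using c d unfolding local_ideal_eq_val_ge
        by (intro val_ge_mult_left val_ge_const) (simp add: lin_comb_append)
      moreover have "\<iota> (inverse (c $ ?n)) * (lin_comb \<iota> bs d + \<iota> (c $ ?n) * a) = a - lin_comb \<iota> bs ?e"
        using False d by (simp add: lin_comb_smult distrib_left mult.assoc[symmetric] hom_mult[symmetric] hom_uminus)
      ultimately show ?thesis using d by (intro exI[of _ ?e]) auto
    qed
  qed
  have uniq: "c = d" if "c \<in> carrier_vec ?n" "a - lin_comb \<iota> bs c \<in> local_ideal P"
    "d \<in> carrier_vec ?n" "a - lin_comb \<iota> bs d \<in> local_ideal P" for a c d
  proof -
    have "(a - lin_comb \<iota> bs d) - (a - lin_comb \<iota> bs c) \<in> local_ideal P"
      unfolding local_ideal_eq_val_ge by (rule val_ge_diff) (use that in \<open>simp_all add: local_ideal_eq_val_ge\<close>)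
    then have "lin_comb \<iota> bs (c - d) \<in> local_ideal P" using that by (simp add: lin_comb_diff)
    then have *: "c - d = 0\<^sub>v ?n" using bs that by (auto simp: residue_independent_def)
    show ?thesis
    proof (rule eq_vecI)
      fix i assume "i < dim_vec d"
      then show "c $ i = d $ i" using arg_cong[OF *, of "\<lambda>v. vec_index v i"] that by simp
    qed (use that in auto)
  qed
  show ?thesis unfolding residue_basis_def using sub ex uniq by blast
qed

lemma some_basis: "residue_basis \<iota> P (some_basis \<iota> P)"
  unfolding some_basis_def using residue_basis_exists by (rule someI_ex)

abbreviation "basis \<equiv> some_basis \<iota> P"
abbreviation "pdeg \<equiv> point_degree \<iota> P"

lemma basis_regular: "i < pdeg \<Longrightarrow> basis ! i \<in> val_ge P 0"
  using some_basis by (auto simp: residue_basis_def point_degree_def local_ring_eq_val_ge)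

lemma coords:
  assumes "a \<in> val_ge P 0"
  shows "coords \<iota> P a \<in> carrier_vec pdeg" "a - lin_comb \<iota> basis (coords \<iota> P a) \<in> val_ge P 1"
proof -
  have "\<exists>!c. c \<in> carrier_vec (length basis) \<and> a - lin_comb \<iota> basis c \<in> local_ideal P"
    using some_basis assms by (auto simp: residue_basis_def local_ring_eq_val_ge)
  from theI'[OF this] show "coords \<iota> P a \<in> carrier_vec pdeg" "a - lin_comb \<iota> basis (coords \<iota> P a) \<in> val_ge P 1"
    by (auto simp: coords_def point_degree_def local_ideal_eq_val_ge)
qed

lemma coords_unique:
  assumes "a \<in> val_ge P 0" "c \<in> carrier_vec pdeg" "a - lin_comb \<iota> basis c \<in> val_ge P 1"
  shows "coords \<iota> P a = c"
proof -
  have "\<exists>!c. c \<in> carrier_vec (length basis) \<and> a - lin_comb \<iota> basis c \<in> local_ideal P"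
    using some_basis assms by (auto simp: residue_basis_def local_ring_eq_val_ge)
  then show ?thesis
    using coords[OF assms(1)] assms by (auto simp: point_degree_def local_ideal_eq_val_ge)
qed

section \<open>Norms from the residue fields to K\<close>

definition mult_matrix :: "'f \<Rightarrow> 'k mat" where
  "mult_matrix u = mat pdeg pdeg (\<lambda>(i, j). coords \<iota> P (u * basis ! j) $ i)"

lemma residue_norm_eq_det: "residue_norm \<iota> P u = det (mult_matrix u)"
  by (simp add: residue_norm_def mult_matrix_def)

text \<open>In the residue field this is the composition of two multiplications. On representatives,
  expanding v times the j-th basis element and then u times every basis element produces errors; all
  of them lie in the maximal ideal, so uniqueness of coordinates applies.\<close>

lemma mult_matrix_mult:
  assumes u: "u \<in> val_ge P 0" and v: "v \<in> val_ge P 0"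
  shows "mult_matrix (u * v) = mult_matrix u * mult_matrix v"
proof (rule eq_matI)
  fix i j assume "i < dim_row (mult_matrix u * mult_matrix v)" "j < dim_col (mult_matrix u * mult_matrix v)"
  then have i: "i < pdeg" and j: "j < pdeg" by (auto simp: mult_matrix_def)
  let ?c = "coords \<iota> P (v * basis ! j)"
  let ?w = "vec pdeg (\<lambda>i. \<Sum>k<pdeg. coords \<iota> P (u * basis ! k) $ i * ?c $ k)"
  have vb: "v * basis ! j \<in> val_ge P 0" using v basis_regular[OF j] by (rule val_ge_mult_left)
  have ub: "u * basis ! k \<in> val_ge P 0" if "k < pdeg" for k
    using u basis_regular[OF that] by (rule val_ge_mult_left)
  have uvb: "u * v * basis ! j \<in> val_ge P 0"
    using val_ge_mult_left[OF u vb] by (simp add: mult.assoc)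
  have "u * (v * basis ! j - lin_comb \<iota> basis ?c) \<in> val_ge P 1"
    by (intro val_ge_mult_left u coords vb)
  moreover have "(\<Sum>k<pdeg. \<iota> (?c $ k) * (u * basis ! k - lin_comb \<iota> basis (coords \<iota> P (u * basis ! k)))) \<in> val_ge P 1"
    by (intro val_ge_sum val_ge_mult_left val_ge_const coords ub) auto
  ultimately have "u * (v * basis ! j - lin_comb \<iota> basis ?c)
      + (\<Sum>k<pdeg. \<iota> (?c $ k) * (u * basis ! k - lin_comb \<iota> basis (coords \<iota> P (u * basis ! k)))) \<in> val_ge P 1"
    by (rule val_ge_add)
  also have "u * (v * basis ! j - lin_comb \<iota> basis ?c)
      + (\<Sum>k<pdeg. \<iota> (?c $ k) * (u * basis ! k - lin_comb \<iota> basis (coords \<iota> P (u * basis ! k))))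
      = u * v * basis ! j - lin_comb \<iota> basis ?w"
  proof -
    have "lin_comb \<iota> basis ?w = (\<Sum>i<pdeg. \<Sum>k<pdeg. \<iota> (?c $ k) * (\<iota> (coords \<iota> P (u * basis ! k) $ i) * basis ! i))"
      by (simp add: lin_comb_def point_degree_def hom_sum hom_mult sum_distrib_left sum_distrib_right mult_ac)
    also have "\<dots> = (\<Sum>k<pdeg. \<iota> (?c $ k) * lin_comb \<iota> basis (coords \<iota> P (u * basis ! k)))"
      by (subst sum.swap) (simp add: lin_comb_def point_degree_def sum_distrib_left)
    finally have w: "lin_comb \<iota> basis ?w = (\<Sum>k<pdeg. \<iota> (?c $ k) * lin_comb \<iota> basis (coords \<iota> P (u * basis ! k)))" .
    have "u * lin_comb \<iota> basis ?c = (\<Sum>k<pdeg. \<iota> (?c $ k) * (u * basis ! k))"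
      by (simp add: lin_comb_def point_degree_def sum_distrib_left mult_ac)
    then show ?thesis unfolding w by (simp add: right_diff_distrib sum_subtractf mult.assoc)
  qed
  finally have "coords \<iota> P (u * v * basis ! j) = ?w"
    by (intro coords_unique uvb) auto
  then show "mult_matrix (u * v) $$ (i, j) = (mult_matrix u * mult_matrix v) $$ (i, j)"
    using i j by (simp add: mult_matrix_def scalar_prod_def atLeast0LessThan)
qed (auto simp: mult_matrix_def)

lemma mult_matrix_const: "mult_matrix (\<iota> c) = c \<cdot>\<^sub>m 1\<^sub>m pdeg"
proof (rule eq_matI)
  fix i j assume "i < dim_row (c \<cdot>\<^sub>m 1\<^sub>m pdeg)" "j < dim_col (c \<cdot>\<^sub>m 1\<^sub>m pdeg)"
  then have i: "i < pdeg" and j: "j < pdeg" by auto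
  have "lin_comb \<iota> basis (c \<cdot>\<^sub>v unit_vec pdeg j) = (\<Sum>k<pdeg. if k = j then \<iota> c * basis ! j else 0)"
    unfolding lin_comb_def point_degree_def[symmetric]
    by (intro sum.cong refl) (use j in \<open>auto simp: unit_vec_def\<close>)
  then have "coords \<iota> P (\<iota> c * basis ! j) = c \<cdot>\<^sub>v unit_vec pdeg j"
    using j by (intro coords_unique val_ge_mult_left val_ge_const basis_regular) auto
  then show "mult_matrix (\<iota> c) $$ (i, j) = (c \<cdot>\<^sub>m 1\<^sub>m pdeg) $$ (i, j)"
    using i j by (simp add: mult_matrix_def unit_vec_def)
qed (auto simp: mult_matrix_def)

lemma residue_norm_mult:
  assumes "u \<in> val_ge P 0" "v \<in> val_ge P 0"
  shows "residue_norm \<iota> P (u * v) = residue_norm \<iota> P u * residue_norm \<iota> P v"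
  unfolding residue_norm_eq_det mult_matrix_mult[OF assms]
  by (rule det_mult[of _ pdeg]) (auto simp: mult_matrix_def)

lemma residue_norm_const: "residue_norm \<iota> P (\<iota> c) = c ^ pdeg"
  by (simp add: residue_norm_eq_det mult_matrix_const)

lemma residue_norm_one [simp]: "residue_norm \<iota> P 1 = 1"
  using residue_norm_const[of 1] by simp

lemma residue_norm_unit_mult:
  assumes "u \<noteq> 0" "P u = 0" "v \<noteq> 0" "P v = 0"
  shows "residue_norm \<iota> P (u * v) = residue_norm \<iota> P u * residue_norm \<iota> P v"
  using assms by (intro residue_norm_mult val_geI) auto

lemma residue_norm_unit_nonzero:
  assumes "u \<noteq> 0" "P u = 0"
  shows "residue_norm \<iota> P u \<noteq> 0"
  using residue_norm_unit_mult[of u "inverse u"] assms by auto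

end


section \<open>Divisors\<close>

context function_field_curve
begin

lemma point_locale: "P \<in> points \<iota> \<Longrightarrow> function_field_point \<iota> P"
  by unfold_locales

text \<open>\<open>Abs_poly_mapping\<close> returns the intended function only for finite support;
  this is where the finiteness of zeros and poles enters.\<close>

lemma lookup_div_fun: "Poly_Mapping.lookup (div_fun \<iota> f) P = (if P \<in> points \<iota> then P f else 0)"
proof -
  have "finite {P. (if P \<in> points \<iota> then P f else 0) \<noteq> 0}"
    using finite_support[of f] by (rule rev_finite_subset) auto
  then show ?thesis unfolding div_fun_def by simp
qed

lemma div_fun_mult:
  assumes "f \<noteq> 0" "g \<noteq> 0"
  shows "div_fun \<iota> (f * g) = div_fun \<iota> f + div_fun \<iota> g"
proof (rule poly_mapping_eqI)
  fix P
  show "Poly_Mapping.lookup (div_fun \<iota> (f * g)) P = Poly_Mapping.lookup (div_fun \<iota> f + div_fun \<iota> g) P"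
    using curve_point.val_mult[of \<iota> P f g] assms
    by (auto simp: lookup_div_fun lookup_add curve_point_def)
qed

lemma div_fun_one [simp]: "div_fun \<iota> 1 = 0"
  using div_fun_mult[of 1 1] by simp

lemma div_fun_inverse: "f \<noteq> 0 \<Longrightarrow> div_fun \<iota> (inverse f) = - div_fun \<iota> f"
  using div_fun_mult[of f "inverse f"] by (simp add: eq_neg_iff_add_eq_0 add.commute)

lemma div_fun_divide: "f \<noteq> 0 \<Longrightarrow> g \<noteq> 0 \<Longrightarrow> div_fun \<iota> (f / g) = div_fun \<iota> f - div_fun \<iota> g"
  by (simp add: divide_inverse div_fun_mult div_fun_inverse)

lemma carrier_Div_iff: "D \<in> carrier (Div \<iota>) \<longleftrightarrow> Poly_Mapping.keys D \<subseteq> points \<iota>"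
  by (simp add: Div_def)

lemma keys_div_fun: "Poly_Mapping.keys (div_fun \<iota> f) \<subseteq> points \<iota>"
  by (auto simp: in_keys_iff lookup_div_fun split: if_splits)

lemma degree_div_superset:
  assumes "finite S" "Poly_Mapping.keys D \<subseteq> S"
  shows "degree_div \<iota> D = (\<Sum>P\<in>S. Poly_Mapping.lookup D P * int (point_degree \<iota> P))"
  unfolding degree_div_def using assms by (intro sum.mono_neutral_left) (auto simp: in_keys_iff)

lemma degree_div_add: "degree_div \<iota> (D + E) = degree_div \<iota> D + degree_div \<iota> E"
proof -
  let ?S = "Poly_Mapping.keys D \<union> Poly_Mapping.keys E"
  show ?thesis
    using degree_div_superset[of ?S "D + E"] degree_div_superset[of ?S D] degree_div_superset[of ?S E]
      keys_add[of D E] by (simp add: lookup_add distrib_right sum.distrib)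
qed

lemma degree_div_minus: "degree_div \<iota> (- D) = - degree_div \<iota> D"
  by (simp add: degree_div_def sum_negf)

lemma Div0_iff: "D \<in> Div0 \<iota> \<longleftrightarrow> Poly_Mapping.keys D \<subseteq> points \<iota> \<and> degree_div \<iota> D = 0"
  by (simp add: Div0_def carrier_Div_iff)

lemma Div0_add: "D \<in> Div0 \<iota> \<Longrightarrow> E \<in> Div0 \<iota> \<Longrightarrow> D + E \<in> Div0 \<iota>"
  using keys_add[of D E] by (auto simp: Div0_iff degree_div_add)

lemma Div0_minus: "D \<in> Div0 \<iota> \<Longrightarrow> - D \<in> Div0 \<iota>"
  by (auto simp: Div0_iff degree_div_minus)

lemma Div0_zero: "0 \<in> Div0 \<iota>"
  by (simp add: Div0_iff degree_div_def)

lemma effective_diff_Div0: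
  assumes "effective \<iota> d D" "Poly_Mapping.keys E \<subseteq> points \<iota>" "degree_div \<iota> E = d"
  shows "D - E \<in> Div0 \<iota>"
  using assms keys_diff[of D E] degree_div_add[of D "- E"]
  by (auto simp: Div0_iff effective_def carrier_Div_iff degree_div_minus)


subsection \<open>Evaluation at divisors\<close>

definition unit_on :: "'f point set \<Rightarrow> ('f point \<Rightarrow> 'f) \<Rightarrow> bool" where
  "unit_on S u \<longleftrightarrow> (\<forall>P\<in>S. P \<in> points \<iota> \<and> u P \<noteq> 0 \<and> P (u P) = 0)"

lemma residue_norm_nonzero_on: "unit_on S u \<Longrightarrow> P \<in> S \<Longrightarrow> residue_norm \<iota> P (u P) \<noteq> 0"
  by (auto simp: unit_on_def function_field_point.residue_norm_unit_nonzero[OF point_locale])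

lemma eval_div_superset:
  assumes "finite S" "Poly_Mapping.keys D \<subseteq> S"
  shows "eval_div \<iota> D u = (\<Prod>P\<in>S. residue_norm \<iota> P (u P) powi Poly_Mapping.lookup D P)"
  unfolding eval_div_def using assms by (intro prod.mono_neutral_left) (auto simp: in_keys_iff)

text \<open>D and E may cancel at a point, so both sides are compared over the union of the
  supports. The norms there must be nonzero, because the law of exponents for integer powers fails
  at 0.\<close>

lemma eval_div_add:
  assumes "unit_on (Poly_Mapping.keys D \<union> Poly_Mapping.keys E) u"
  shows "eval_div \<iota> (D + E) u = eval_div \<iota> D u * eval_div \<iota> E u"
proof -
  let ?S = "Poly_Mapping.keys D \<union> Poly_Mapping.keys E"
  have "eval_div \<iota> (D + E) u
      = (\<Prod>P\<in>?S. residue_norm \<iota> P (u P) powi Poly_Mapping.lookup D P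
          * residue_norm \<iota> P (u P) powi Poly_Mapping.lookup E P)"
    using keys_add[of D E] residue_norm_nonzero_on[OF assms]
    by (subst eval_div_superset[of ?S]) (auto intro!: prod.cong simp: lookup_add power_int_add)
  then show ?thesis
    using eval_div_superset[of ?S D u] eval_div_superset[of ?S E u] by (simp add: prod.distrib)
qed

lemma eval_div_mult:
  assumes "unit_on (Poly_Mapping.keys D) u" "unit_on (Poly_Mapping.keys D) v"
  shows "eval_div \<iota> D (\<lambda>P. u P * v P) = eval_div \<iota> D u * eval_div \<iota> D v"
  unfolding eval_div_def prod.distrib[symmetric]
proof (intro prod.cong refl)
  fix P assume "P \<in> Poly_Mapping.keys D"
  then show "residue_norm \<iota> P (u P * v P) powi Poly_Mapping.lookup D P
      = residue_norm \<iota> P (u P) powi Poly_Mapping.lookup D P * residue_norm \<iota> P (v P) powi Poly_Mapping.lookup D P"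
    using assms function_field_point.residue_norm_unit_mult[OF point_locale, of P "u P" "v P"]
    by (auto simp: unit_on_def power_int_mult_distrib)
qed

lemma eval_div_one [simp]:
  assumes "Poly_Mapping.keys D \<subseteq> points \<iota>"
  shows "eval_div \<iota> D (\<lambda>_. 1) = 1"
  unfolding eval_div_def
  using assms function_field_point.residue_norm_one[OF point_locale]
  by (intro prod.neutral) auto

lemma eval_div_nonzero: "unit_on (Poly_Mapping.keys D) u \<Longrightarrow> eval_div \<iota> D u \<noteq> 0"
  unfolding eval_div_def using residue_norm_nonzero_on by (auto simp: power_int_eq_0_iff)

lemma eval_div_cong:
  "(\<And>P. P \<in> Poly_Mapping.keys D \<Longrightarrow> u P = v P) \<Longrightarrow> eval_div \<iota> D u = eval_div \<iota> D v"
  unfolding eval_div_def by (intro prod.cong) auto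

lemma eval_div_zero [simp]: "eval_div \<iota> 0 u = 1"
  by (simp add: eval_div_def)

text \<open>The norm of c at P is c to the power of the degree of P, so the total exponent of c is
  the degree of D.\<close>

lemma eval_div_const:
  assumes D: "D \<in> Div0 \<iota>" and c: "c \<noteq> 0"
  shows "eval_div \<iota> D (\<lambda>_. \<iota> c) = 1"
proof -
  have "eval_div \<iota> D (\<lambda>_. \<iota> c)
      = (\<Prod>P\<in>Poly_Mapping.keys D. c powi (Poly_Mapping.lookup D P * int (point_degree \<iota> P)))"
    unfolding eval_div_def
  proof (intro prod.cong refl)
    fix P assume "P \<in> Poly_Mapping.keys D"
    then have "P \<in> points \<iota>" using D by (auto simp: Div0_iff)
    then show "residue_norm \<iota> P (\<iota> c) powi Poly_Mapping.lookup D P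
        = c powi (Poly_Mapping.lookup D P * int (point_degree \<iota> P))"
      using function_field_point.residue_norm_const[OF point_locale, of P c]
      by (simp add: power_int_mult mult.commute[of "Poly_Mapping.lookup D P"])
  qed
  also have "\<dots> = c powi degree_div \<iota> D"
  proof -
    have "(\<Prod>P\<in>A. c powi g P) = c powi (\<Sum>P\<in>A. g P)" if "finite A" for A and g :: "'f point \<Rightarrow> int"
      using that by (induction A rule: finite_induct) (auto simp: power_int_add c)
    then show ?thesis by (simp add: degree_div_def)
  qed
  finally show ?thesis using D by (simp add: Div0_iff)
qed


section \<open>Line bundles\<close>

lemma stalk_of_generator:
  assumes P: "P \<in> points \<iota>" and t: "t \<noteq> 0"
  shows "{a * t | a. a \<in> local_ring P} = val_ge P (P t)"
proof -
  interpret curve_point \<iota> P by unfold_locales (rule P)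
  have "h \<in> {a * t | a. a \<in> local_ring P}" if "h \<in> val_ge P (P t)" for h
  proof -
    have "h = h / t * t" "h / t \<in> local_ring P"
      using that t by (cases "h = 0"; auto simp: local_ring_def val_ge_def val_divide)+
    then show ?thesis by blast
  qed
  moreover have "a * t \<in> val_ge P (P t)" if "a \<in> local_ring P" for a
    using that t by (cases "a = 0") (auto simp: local_ring_def val_ge_def val_mult)
  ultimately show ?thesis by blast
qed

lemma val_ge_inject:
  assumes P: "P \<in> points \<iota>" and eq: "val_ge P m = val_ge P n"
  shows "m = n"
proof -
  interpret curve_point \<iota> P by unfold_locales (rule P)
  obtain t where t: "P t = 1" "t \<noteq> 0" by (rule uniformizer)
  have "t powi k \<in> val_ge P l \<longleftrightarrow> l \<le> k" for k l
    using t by (auto simp: val_ge_def val_power_int)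
  then have "l \<le> m \<longleftrightarrow> l \<le> n" for l using eq by (metis antisym order_refl)
  then show ?thesis by (meson antisym order_refl)
qed

lemma generators_val_ge:
  assumes "P \<in> points \<iota>" "M P = val_ge P n"
  shows "generators M P = {t. t \<noteq> 0 \<and> P t = n}"
proof -
  have "t \<in> generators M P \<longleftrightarrow> t \<noteq> 0 \<and> val_ge P n = val_ge P (P t)" for t
    using assms stalk_of_generator[of P t] by (cases "t = 0") (simp_all add: generators_def)
  then show ?thesis using val_ge_inject[OF assms(1)] by blast
qed

lemma bundle_of_div_val_ge: "bundle_of_div E P = val_ge P (- Poly_Mapping.lookup E P)"
  by (simp add: bundle_of_div_def val_ge_def)

lemma generators_bundle_of_div:
  "P \<in> points \<iota> \<Longrightarrow> generators (bundle_of_div E) P = {t. t \<noteq> 0 \<and> P t = - Poly_Mapping.lookup E P}"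
  by (intro generators_val_ge) (simp_all add: bundle_of_div_val_ge)

lemma exists_valuation:
  assumes "P \<in> points \<iota>"
  shows "\<exists>t. t \<noteq> 0 \<and> P t = n"
proof -
  interpret curve_point \<iota> P by unfold_locales (rule assms)
  obtain t where "P t = 1" "t \<noteq> 0" by (rule uniformizer)
  then show ?thesis by (intro exI[of _ "t powi n"]) (simp add: val_power_int)
qed

text \<open>All generators of a stalk have the same valuation, so the choice made in
  \<open>div_section\<close> drops out. The stalks are compared at the points of C only, because
  elsewhere a bundle takes arbitrary values.\<close>

lemma div_section_eq:
  assumes A: "Poly_Mapping.keys A \<subseteq> points \<iota>" and s: "s \<noteq> 0"
    and M: "\<And>P. P \<in> points \<iota> \<Longrightarrow> M P = bundle_of_div A P"
  shows "div_section \<iota> M s = A + div_fun \<iota> s"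
proof -
  have val: "(if P \<in> points \<iota> then P (s / (SOME t. t \<in> generators M P)) else 0)
      = Poly_Mapping.lookup (A + div_fun \<iota> s) P" for P
  proof (cases "P \<in> points \<iota>")
    case True
    interpret curve_point \<iota> P by unfold_locales (rule True)
    have gen: "generators M P = {t. t \<noteq> 0 \<and> P t = - Poly_Mapping.lookup A P}"
      using True M by (intro generators_val_ge) (simp_all add: bundle_of_div_val_ge)
    then have "\<exists>t. t \<in> generators M P" using exists_valuation[OF True] by auto
    then have "(SOME t. t \<in> generators M P) \<in> generators M P" by (rule someI_ex)
    then show ?thesis using True s unfolding gen by (simp add: val_divide lookup_add lookup_div_fun)
  next
    case False
    then show ?thesis using A by (auto simp: lookup_add lookup_div_fun in_keys_iff)
  qed
  show ?thesis unfolding div_section_def val by simp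
qed

text \<open>A stalk with generator t consists of 0 and the functions of order at least
  \<open>P t\<close>. This order is 0 wherever the stalk is the local ring, which leaves finitely
  many exceptions, and the negatives of the orders form A.\<close>

lemma line_bundle_divisor:
  assumes "line_bundle \<iota> L"
  obtains A where "Poly_Mapping.keys A \<subseteq> points \<iota>" "\<And>P. P \<in> points \<iota> \<Longrightarrow> L P = bundle_of_div A P"
proof -
  have "\<exists>n. L P = val_ge P n" if "P \<in> points \<iota>" for P
    using assms that stalk_of_generator by (fastforce simp: line_bundle_def generators_def)
  then obtain n where n: "\<And>P. P \<in> points \<iota> \<Longrightarrow> L P = val_ge P (n P)" by metis
  define a where "a = (\<lambda>P. if P \<in> points \<iota> then - n P else 0)"
  have "{P. a P \<noteq> 0} \<subseteq> {P \<in> points \<iota>. L P \<noteq> local_ring P}"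
  proof (intro subsetI CollectI conjI notI)
    fix P assume P: "P \<in> {P. a P \<noteq> 0}"
    then show "P \<in> points \<iota>" by (auto simp: a_def split: if_splits)
    assume "L P = local_ring P"
    then have "n P = 0"
      using n[of P] \<open>P \<in> points \<iota>\<close> val_ge_inject[of P "n P" 0] by (simp add: local_ring_eq_val_ge)
    with P show False by (auto simp: a_def split: if_splits)
  qed
  then have fin: "finite {P. a P \<noteq> 0}"
    by (rule finite_subset) (use assms in \<open>simp add: line_bundle_def\<close>)
  show ?thesis
  proof (rule that)
    have lookup: "Poly_Mapping.lookup (Abs_poly_mapping a) = a"
      using fin by simp
    show "Poly_Mapping.keys (Abs_poly_mapping a) \<subseteq> points \<iota>"
    proof
      fix P assume "P \<in> Poly_Mapping.keys (Abs_poly_mapping a)"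
      then have "a P \<noteq> 0" by (simp add: in_keys_iff lookup)
      then show "P \<in> points \<iota>" by (auto simp: a_def split: if_splits)
    qed
    show "L P = bundle_of_div (Abs_poly_mapping a) P" if "P \<in> points \<iota>" for P
      using that n by (simp add: bundle_of_div_val_ge lookup) (simp add: a_def)
  qed
qed

lemma dual_bundle_eq:
  assumes P: "P \<in> points \<iota>" and L: "L P = bundle_of_div A P"
  shows "dual_bundle L P = bundle_of_div (- A) P"
proof -
  interpret curve_point \<iota> P by unfold_locales (rule P)
  obtain t where t: "t \<noteq> 0" "P t = - Poly_Mapping.lookup A P" using exists_valuation[OF P] by blast
  have "h \<in> val_ge P (Poly_Mapping.lookup A P)" if "\<forall>m\<in>val_ge P (- Poly_Mapping.lookup A P). h * m \<in> val_ge P 0" for h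
  proof -
    have "t \<in> val_ge P (- Poly_Mapping.lookup A P)" using t by (simp add: val_ge_def)
    then have "h * t \<in> val_ge P 0" using that by blast
    then show ?thesis using t by (cases "h = 0") (auto simp: val_ge_def val_mult)
  qed
  moreover have "h * m \<in> val_ge P 0"
    if "h \<in> val_ge P (Poly_Mapping.lookup A P)" "m \<in> val_ge P (- Poly_Mapping.lookup A P)" for h m
    using val_ge_mult[OF that] by simp
  ultimately show ?thesis
    by (auto simp: dual_bundle_def L bundle_of_div_val_ge local_ring_eq_val_ge)
qed

lemma twist_eq:
  assumes P: "P \<in> points \<iota>" and M: "M P = bundle_of_div A P"
  shows "twist M D P = bundle_of_div (A + D) P"
proof -
  interpret curve_point \<iota> P by unfold_locales (rule P)
  let ?a = "Poly_Mapping.lookup A P" and ?d = "Poly_Mapping.lookup D P"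
  have "\<exists>h m. x = h * m \<and> h \<in> val_ge P (- ?d) \<and> m \<in> val_ge P (- ?a)"
    if x: "x \<in> val_ge P (- ?a - ?d)" for x
  proof -
    obtain t where t: "t \<noteq> 0" "P t = - ?a" using exists_valuation[OF P] by blast
    have "x = x / t * t" "x / t \<in> val_ge P (- ?d)" "t \<in> val_ge P (- ?a)"
      using x t by (cases "x = 0"; auto simp: val_ge_def val_divide)+
    then show ?thesis by blast
  qed
  moreover have "h * m \<in> val_ge P (- ?a - ?d)" if "h \<in> val_ge P (- ?d)" "m \<in> val_ge P (- ?a)" for h m
    using val_ge_mult[OF that] by (simp add: algebra_simps)
  ultimately show ?thesis
    by (auto simp: twist_def M bundle_of_div_val_ge lookup_add)
qed

lemma div_section_bundle_of_div:
  "Poly_Mapping.keys E \<subseteq> points \<iota> \<Longrightarrow> s \<noteq> 0 \<Longrightarrow> div_section \<iota> (bundle_of_div E) s = E + div_fun \<iota> s"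
  by (rule div_section_eq) auto

lemma div_class_eq: "div_class \<iota> D = {D + div_fun \<iota> f | f. f \<noteq> 0}"
  by (auto simp: div_class_def r_coset_def principal_def Div_def add.commute)

text \<open>If L is O(A), then the bundle on the left is O(R - A), while d as a section of L has
  divisor A + (d). The two families of divisors are matched by the substitution s = f / d.\<close>

lemma bundle_class_twist_dual:
  assumes L: "line_bundle \<iota> L" and d: "d \<noteq> 0" and R: "Poly_Mapping.keys R \<subseteq> points \<iota>"
  shows "bundle_class \<iota> (twist (dual_bundle L) R) = div_class \<iota> (R - div_section \<iota> L d)"
proof -
  obtain A where A: "Poly_Mapping.keys A \<subseteq> points \<iota>" "\<And>P. P \<in> points \<iota> \<Longrightarrow> L P = bundle_of_div A P"
    using line_bundle_divisor[OF L] by blast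
  have sec: "div_section \<iota> (twist (dual_bundle L) R) s = R - A + div_fun \<iota> s" if "s \<noteq> 0" for s
    using A R that keys_diff[of R A]
    by (subst div_section_eq[of "- A + R"]) (auto simp: twist_eq dual_bundle_eq)
  have "div_section \<iota> L d = A + div_fun \<iota> d" using A d by (intro div_section_eq) auto
  then have cls: "div_class \<iota> (R - div_section \<iota> L d) = {R - A + div_fun \<iota> f - div_fun \<iota> d | f. f \<noteq> 0}"
    by (auto simp: div_class_eq algebra_simps)
  show ?thesis unfolding cls bundle_class_def
  proof (intro equalityI subsetI)
    fix Z assume "Z \<in> {div_section \<iota> (twist (dual_bundle L) R) s | s. s \<noteq> 0}"
    then obtain s where "s \<noteq> 0" "Z = R - A + div_fun \<iota> s" using sec by auto
    then show "Z \<in> {R - A + div_fun \<iota> f - div_fun \<iota> d | f. f \<noteq> 0}"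
      using d by (intro CollectI exI[of _ "s * d"]) (simp add: div_fun_mult)
  next
    fix Z assume "Z \<in> {R - A + div_fun \<iota> f - div_fun \<iota> d | f. f \<noteq> 0}"
    then obtain f where "f \<noteq> 0" "Z = R - A + div_fun \<iota> f - div_fun \<iota> d" by auto
    then show "Z \<in> {div_section \<iota> (twist (dual_bundle L) R) s | s. s \<noteq> 0}"
      using d by (intro CollectI exI[of _ "f / d"]) (simp add: sec div_fun_divide)
  qed
qed

text \<open>For the third claim, f and 1 are both rational sections of L, of equal degree by
  \<open>has_degree\<close>, and their divisors differ by (f).\<close>

lemma degree_div_section:
  assumes L: "line_bundle \<iota> L" and deg: "has_degree \<iota> L d" and f: "f \<noteq> 0"
  shows "Poly_Mapping.keys (div_section \<iota> L f) \<subseteq> points \<iota>"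
    "degree_div \<iota> (div_section \<iota> L f) = d" "degree_div \<iota> (div_fun \<iota> f) = 0"
proof -
  obtain A where A: "Poly_Mapping.keys A \<subseteq> points \<iota>" "\<And>P. P \<in> points \<iota> \<Longrightarrow> L P = bundle_of_div A P"
    using line_bundle_divisor[OF L] by blast
  have sec: "div_section \<iota> L s = A + div_fun \<iota> s" if "s \<noteq> 0" for s
    using A that by (intro div_section_eq) auto
  show "Poly_Mapping.keys (div_section \<iota> L f) \<subseteq> points \<iota>"
    using sec[OF f] A keys_div_fun[of f] keys_add[of A "div_fun \<iota> f"] by auto
  show "degree_div \<iota> (div_section \<iota> L f) = d" using deg f by (simp add: has_degree_def)
  have "degree_div \<iota> (div_section \<iota> L f) = degree_div \<iota> (div_section \<iota> L 1)"
    using deg f by (simp add: has_degree_def)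
  then show "degree_div \<iota> (div_fun \<iota> f) = 0" using f by (simp add: sec degree_div_add)
qed

end


section \<open>The Jacobian\<close>

locale curve_with_point = function_field_curve +
  assumes principal_degree: "f \<noteq> 0 \<Longrightarrow> degree_div \<iota> (div_fun \<iota> f) = 0"
    and rational_point: "\<exists>P\<in>points \<iota>. point_degree \<iota> P = 1"
begin

lemma div_fun_Div0: "f \<noteq> 0 \<Longrightarrow> div_fun \<iota> f \<in> Div0 \<iota>"
  by (simp add: Div0_iff principal_degree keys_div_fun)

text \<open>
  The residue field at a rational point is \<open>K\<close>, so some \<open>f - c\<close> vanishes there; having no poles, it
  must be \<open>0\<close>.
\<close>

lemma unit_function_constant:
  assumes "f \<noteq> 0" "div_fun \<iota> f = 0"
  obtains c where "c \<noteq> 0" "f = \<iota> c"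
proof -
  have val: "P f = 0" if "P \<in> points \<iota>" for P
    using arg_cong[OF assms(2), of "\<lambda>D. Poly_Mapping.lookup D P"] that by (simp add: lookup_div_fun)
  obtain P where P: "P \<in> points \<iota>" "point_degree \<iota> P = 1" using rational_point by blast
  interpret function_field_point \<iota> P by (rule point_locale) (rule P)
  have lc: "lin_comb \<iota> basis v = \<iota> (vec_index v 0) * basis ! 0" for v
    using P(2) by (simp add: lin_comb_def point_degree_def)
  have "f \<in> val_ge P 0" using val[OF P(1)] by (intro val_geI) simp
  from coords(2)[OF this] obtain a where a: "f - \<iota> a * basis ! 0 \<in> val_ge P 1" unfolding lc by blast
  from coords(2)[OF val_ge_one] obtain b where b: "1 - \<iota> b * basis ! 0 \<in> val_ge P 1" unfolding lc by blast
  have b0: "b \<noteq> 0" using b one_notin_ideal by auto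
  \<comment> \<open>The chosen basis element need not be 1, so the constant is the coordinate of f
    divided by that of 1.\<close>
  define c where "c = a / b"
  have "(f - \<iota> a * basis ! 0) - \<iota> c * (1 - \<iota> b * basis ! 0) \<in> val_ge P 1"
    by (intro val_ge_diff a val_ge_mult_left val_ge_const b)
  moreover have "(f - \<iota> a * basis ! 0) - \<iota> c * (1 - \<iota> b * basis ! 0) = f - \<iota> c"
    using b0 by (simp add: c_def right_diff_distrib mult.assoc[symmetric] hom_mult[symmetric])
  ultimately have fc: "f - \<iota> c \<in> val_ge P 1" by simp
  have "f - \<iota> c = 0"
  proof (rule ccontr)
    assume nz: "f - \<iota> c \<noteq> 0"
    let ?D = "div_fun \<iota> (f - \<iota> c)"
    have pos: "1 \<le> P (f - \<iota> c)" using fc nz by (simp add: val_ge_def)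
    have nonneg: "0 \<le> Poly_Mapping.lookup ?D Q" for Q
    proof (cases "Q \<in> points \<iota>")
      case True
      interpret Q: curve_point \<iota> Q by unfold_locales (rule True)
      have "f - \<iota> c \<in> val_ge Q 0"
        using val[OF True] by (intro Q.val_ge_diff Q.val_ge_const val_geI) simp
      then show ?thesis using nz True by (simp add: lookup_div_fun val_ge_def)
    qed (simp add: lookup_div_fun)
    have PD: "Poly_Mapping.lookup ?D P = P (f - \<iota> c)" "P \<in> Poly_Mapping.keys ?D"
      using P pos by (auto simp: lookup_div_fun in_keys_iff)
    have "0 < Poly_Mapping.lookup ?D P * int (point_degree \<iota> P)" using PD P pos by simp
    also have "\<dots> \<le> degree_div \<iota> ?D"
      unfolding degree_div_def using PD nonneg
      by (intro member_le_sum[of P]) auto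
    finally show False using principal_degree[OF nz] by simp
  qed
  then have "f = \<iota> c" by simp
  with assms(1) that[of c] show ?thesis by auto
qed

section \<open>Divisor classes of degree 0 as a group\<close>

lemma comm_group_Div: "comm_group (Div \<iota>)"
  unfolding Div_def by (rule abelian_free_Abelian_group)

lemma inv_Div: "D \<in> carrier (Div \<iota>) \<Longrightarrow> inv\<^bsub>Div \<iota>\<^esub> D = - D"
  unfolding Div_def by simp

lemma mult_Div [simp]: "D \<otimes>\<^bsub>Div \<iota>\<^esub> E = D + E" and one_Div [simp]: "\<one>\<^bsub>Div \<iota>\<^esub> = 0"
  by (simp_all add: Div_def)

lemma principal_subgroup: "subgroup (principal \<iota>) (Div \<iota>)"
proof -
  interpret comm_group "Div \<iota>" by (rule comm_group_Div)
  show ?thesis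
  proof (rule subgroupI)
    show "principal \<iota> \<subseteq> carrier (Div \<iota>)" by (auto simp: principal_def carrier_Div_iff dest: subsetD[OF keys_div_fun])
    have "div_fun \<iota> 1 \<in> principal \<iota>" unfolding principal_def
      by (intro CollectI exI[of _ 1]) simp
    then show "principal \<iota> \<noteq> {}" by blast
    show "inv\<^bsub>Div \<iota>\<^esub> D \<in> principal \<iota>" if D: "D \<in> principal \<iota>" for D
    proof -
      obtain f where f: "f \<noteq> 0" "D = div_fun \<iota> f" using D by (auto simp: principal_def)
      then have "inv\<^bsub>Div \<iota>\<^esub> D = div_fun \<iota> (inverse f)"
        by (simp add: inv_Div carrier_Div_iff keys_div_fun div_fun_inverse)
      with f show ?thesis by (auto simp: principal_def)
    qed
    show "D \<otimes>\<^bsub>Div \<iota>\<^esub> E \<in> principal \<iota>" if DE: "D \<in> principal \<iota>" "E \<in> principal \<iota>" for D E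
    proof -
      obtain f g where "f \<noteq> 0" "D = div_fun \<iota> f" "g \<noteq> 0" "E = div_fun \<iota> g"
        using DE by (auto simp: principal_def)
      then have "D + E = div_fun \<iota> (f * g)" "f * g \<noteq> 0" by (auto simp: div_fun_mult)
      then show ?thesis by (auto simp: principal_def)
    qed
  qed
qed

lemma div_class_add:
  assumes "D \<in> carrier (Div \<iota>)" "E \<in> carrier (Div \<iota>)"
  shows "div_class \<iota> (D + E) = div_class \<iota> D \<otimes>\<^bsub>Pic \<iota>\<^esub> div_class \<iota> E"
proof -
  interpret comm_group "Div \<iota>" by (rule comm_group_Div)
  interpret normal "principal \<iota>" "Div \<iota>" by (rule subgroup_imp_normal[OF principal_subgroup])
  show ?thesis using rcos_sum[OF assms] by (simp add: div_class_def Pic_def)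
qed

lemma div_class_eq_iff: "div_class \<iota> D = div_class \<iota> E \<longleftrightarrow> (\<exists>f. f \<noteq> 0 \<and> D = E + div_fun \<iota> f)"
proof
  assume "div_class \<iota> D = div_class \<iota> E"
  moreover have "D \<in> div_class \<iota> D"
    unfolding div_class_eq by (intro CollectI exI[of _ 1]) simp
  ultimately show "\<exists>f. f \<noteq> 0 \<and> D = E + div_fun \<iota> f" by (auto simp: div_class_eq)
next
  assume "\<exists>f. f \<noteq> 0 \<and> D = E + div_fun \<iota> f"
  then obtain f where f: "f \<noteq> 0" "D = E + div_fun \<iota> f" by blast
  have "Z \<in> div_class \<iota> E" if "Z \<in> div_class \<iota> D" for Z
  proof -
    obtain g where "g \<noteq> 0" "Z = D + div_fun \<iota> g" using \<open>Z \<in> div_class \<iota> D\<close> by (auto simp: div_class_eq)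
    then have "f * g \<noteq> 0" "Z = E + div_fun \<iota> (f * g)" using f by (auto simp: div_fun_mult add.assoc)
    then show ?thesis by (auto simp: div_class_eq)
  qed
  moreover have "Z \<in> div_class \<iota> D" if "Z \<in> div_class \<iota> E" for Z
  proof -
    obtain g where "g \<noteq> 0" "Z = E + div_fun \<iota> g" using \<open>Z \<in> div_class \<iota> E\<close> by (auto simp: div_class_eq)
    then have "g / f \<noteq> 0" "Z = D + div_fun \<iota> (g / f)" using f by (auto simp: div_fun_divide)
    then show ?thesis by (auto simp: div_class_eq)
  qed
  ultimately show "div_class \<iota> D = div_class \<iota> E" by blast
qed

definition Div0_group :: "'b divisor monoid" where
  "Div0_group = (Div \<iota>)\<lparr>carrier := Div0 \<iota>\<rparr>"

lemma Div0_group_simps [simp]: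
  "carrier Div0_group = Div0 \<iota>" "D \<otimes>\<^bsub>Div0_group\<^esub> E = D + E" "\<one>\<^bsub>Div0_group\<^esub> = 0"
  by (simp_all add: Div0_group_def)

lemma comm_group_Div0: "comm_group Div0_group"
proof (rule comm_groupI)
  show "\<exists>E\<in>carrier Div0_group. E \<otimes>\<^bsub>Div0_group\<^esub> D = \<one>\<^bsub>Div0_group\<^esub>" if "D \<in> carrier Div0_group" for D
    using that Div0_minus[of D] by (intro bexI[of _ "- D"]) auto
qed (auto simp: Div0_add Div0_zero add_ac)

lemma div_class_hom: "div_class \<iota> \<in> hom Div0_group (Jac \<iota>)"
proof (rule homI)
  show "div_class \<iota> (D \<otimes>\<^bsub>Div0_group\<^esub> E) = div_class \<iota> D \<otimes>\<^bsub>Jac \<iota>\<^esub> div_class \<iota> E"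
    if "D \<in> carrier Div0_group" "E \<in> carrier Div0_group" for D E
    using that by (simp add: div_class_add Div0_def Jac_def)
qed (simp add: Jac_def)

text \<open>The carrier of \<open>Jac\<close> is the image of the divisors of degree 0 under a
  homomorphism to \<open>Pic\<close>, so the axioms are inherited. The image comes with the class of
  0 as its unit, which must be identified with the unit of \<open>Pic\<close>.\<close>

lemma comm_group_Jac: "comm_group (Jac \<iota>)"
proof -
  interpret D: comm_group Div0_group by (rule comm_group_Div0)
  have "div_class \<iota> \<in> hom Div0_group (Pic \<iota>)"
  proof (rule homI)
    show "div_class \<iota> D \<in> carrier (Pic \<iota>)" if "D \<in> carrier Div0_group" for D
      using that by (auto simp: Div0_def Pic_def FactGroup_def div_class_def RCOSETS_def)
    show "div_class \<iota> (D \<otimes>\<^bsub>Div0_group\<^esub> E) = div_class \<iota> D \<otimes>\<^bsub>Pic \<iota>\<^esub> div_class \<iota> E"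
      if "D \<in> carrier Div0_group" "E \<in> carrier Div0_group" for D E
      using that by (simp add: div_class_add Div0_def)
  qed
  from D.hom_imp_img_comm_group[OF this]
  have "comm_group ((Pic \<iota>)\<lparr>carrier := div_class \<iota> ` Div0 \<iota>, one := div_class \<iota> 0\<rparr>)" by simp
  moreover have "div_class \<iota> 0 = \<one>\<^bsub>Pic \<iota>\<^esub>"
    by (auto simp: Pic_def div_class_eq principal_def)
  ultimately show ?thesis by (simp add: Jac_def)
qed

end


section \<open>Norm lines\<close>

context curve_with_point
begin

lemma frames_iff:
  "t \<in> frames \<iota> (bundle_of_div E) \<longleftrightarrow>
     (\<forall>P\<in>points \<iota>. t P \<noteq> 0 \<and> P (t P) = - Poly_Mapping.lookup E P)"
  by (auto simp: frames_def generators_bundle_of_div)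

lemma norm_lineD:
  assumes "\<phi> \<in> norm_line \<iota> D M" "t \<in> frames \<iota> M" "t' \<in> frames \<iota> M"
  shows "\<phi> t = \<phi> t' * eval_div \<iota> D (\<lambda>P. t' P / t P)"
proof -
  have "\<forall>t\<in>frames \<iota> M. \<forall>t'\<in>frames \<iota> M. \<phi> t = \<phi> t' * eval_div \<iota> D (\<lambda>P. t' P / t P)"
    using assms(1) unfolding norm_line_def mem_Collect_eq by (rule conjunct2)
  from bspec[OF bspec[OF this assms(2)] assms(3)] show ?thesis .
qed

lemma norm_line_outside: "\<phi> \<in> norm_line \<iota> D M \<Longrightarrow> t \<notin> frames \<iota> M \<Longrightarrow> \<phi> t = 0"
  unfolding norm_line_def by blast

lemma norm_lineI:
  assumes "\<And>t. t \<notin> frames \<iota> M \<Longrightarrow> \<phi> t = 0"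
    and "\<And>t t'. t \<in> frames \<iota> M \<Longrightarrow> t' \<in> frames \<iota> M \<Longrightarrow>
      \<phi> t = \<phi> t' * eval_div \<iota> D (\<lambda>P. t' P / t P)"
  shows "\<phi> \<in> norm_line \<iota> D M"
  unfolding norm_line_def by (intro CollectI conjI allI impI ballI assms)

definition frame :: "'b divisor \<Rightarrow> 'b point \<Rightarrow> 'b" where
  "frame E P = (SOME t. t \<noteq> 0 \<and> P t = - Poly_Mapping.lookup E P)"

lemma frame_props: "P \<in> points \<iota> \<Longrightarrow> frame E P \<noteq> 0 \<and> P (frame E P) = - Poly_Mapping.lookup E P"
  unfolding frame_def using exists_valuation by (rule someI_ex)

lemma frame_in_frames: "frame E \<in> frames \<iota> (bundle_of_div E)"
  by (simp add: frames_iff frame_props)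

text \<open>Multiplication by f sends O(E + (f)) to O(E), so frames are transported in the opposite
  direction by division by f, as in \<open>change_right\<close>.\<close>

lemma frames_shift:
  assumes "t \<in> frames \<iota> (bundle_of_div E)" "f \<noteq> 0"
  shows "(\<lambda>P. t P / f) \<in> frames \<iota> (bundle_of_div (E + div_fun \<iota> f))"
  unfolding frames_iff
proof
  fix P assume P: "P \<in> points \<iota>"
  then have "t P \<noteq> 0" "P (t P) = - Poly_Mapping.lookup E P" using assms by (simp_all add: frames_iff)
  then show "t P / f \<noteq> 0 \<and> P (t P / f) = - Poly_Mapping.lookup (E + div_fun \<iota> f) P"
    using P assms(2)
    by (simp add: lookup_add lookup_div_fun curve_point.val_divide[OF curve_point.intro])
qed

lemma unit_on_frames_divide:
  assumes "t \<in> frames \<iota> (bundle_of_div E)" "t' \<in> frames \<iota> (bundle_of_div E)" "S \<subseteq> points \<iota>"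
  shows "unit_on S (\<lambda>P. t P / t' P)"
  unfolding unit_on_def
proof
  fix P assume "P \<in> S"
  then have P: "P \<in> points \<iota>" using assms by auto
  have "t P \<noteq> 0" "P (t P) = - Poly_Mapping.lookup E P" using P assms(1) by (simp_all add: frames_iff)
  moreover have "t' P \<noteq> 0" "P (t' P) = - Poly_Mapping.lookup E P" using P assms(2) by (simp_all add: frames_iff)
  ultimately show "P \<in> points \<iota> \<and> t P / t' P \<noteq> 0 \<and> P (t P / t' P) = 0"
    using P by (simp add: curve_point.val_divide[OF curve_point.intro])
qed

text \<open>Outside its divisor as a section of O(E), s itself generates the stalk.\<close>

lemma unit_on_section:
  assumes "s \<noteq> 0" "t \<in> frames \<iota> (bundle_of_div E)" "S \<subseteq> points \<iota>"
    and "S \<inter> Poly_Mapping.keys (E + div_fun \<iota> s) = {}"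
  shows "unit_on S (\<lambda>P. s / t P)"
  unfolding unit_on_def
proof
  fix P assume PS: "P \<in> S"
  then have P: "P \<in> points \<iota>" using assms by auto
  have "Poly_Mapping.lookup (E + div_fun \<iota> s) P = 0" using PS assms(4) by (auto simp: in_keys_iff)
  then have "P s = - Poly_Mapping.lookup E P" using P by (simp add: lookup_add lookup_div_fun)
  moreover have "t P \<noteq> 0" "P (t P) = - Poly_Mapping.lookup E P" using P assms(2) by (simp_all add: frames_iff)
  ultimately show "P \<in> points \<iota> \<and> s / t P \<noteq> 0 \<and> P (s / t P) = 0"
    using P assms(1) by (simp add: curve_point.val_divide[OF curve_point.intro])
qed

definition norm_elt :: "'b divisor \<Rightarrow> 'b divisor \<Rightarrow> 'a \<Rightarrow> ('a, 'b) norm_elt" where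
  "norm_elt E D c = (\<lambda>t. if t \<in> frames \<iota> (bundle_of_div E)
     then c * eval_div \<iota> D (\<lambda>P. frame E P / t P) else 0)"

text \<open>The norm line is one-dimensional: the coordinate at one frame determines all the
  others.\<close>

lemma norm_line_eq_norm_elt:
  assumes "\<phi> \<in> norm_line \<iota> D (bundle_of_div E)"
  shows "\<phi> = norm_elt E D (\<phi> (frame E))"
proof
  fix t
  show "\<phi> t = norm_elt E D (\<phi> (frame E)) t"
    using norm_lineD[OF assms _ frame_in_frames, of t] norm_line_outside[OF assms, of t]
    by (simp add: norm_elt_def)
qed

lemma norm_elt_in_norm_line:
  assumes D: "Poly_Mapping.keys D \<subseteq> points \<iota>"
  shows "norm_elt E D c \<in> norm_line \<iota> D (bundle_of_div E)"
proof -
  have eq: "eval_div \<iota> D (\<lambda>P. frame E P / t P)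
      = eval_div \<iota> D (\<lambda>P. frame E P / t' P) * eval_div \<iota> D (\<lambda>P. t' P / t P)"
    if t: "t \<in> frames \<iota> (bundle_of_div E)" and t': "t' \<in> frames \<iota> (bundle_of_div E)" for t t'
  proof -
    have "eval_div \<iota> D (\<lambda>P. frame E P / t P) = eval_div \<iota> D (\<lambda>P. (frame E P / t' P) * (t' P / t P))"
      using D t' by (intro eval_div_cong) (auto simp: frames_iff)
    also have "\<dots> = eval_div \<iota> D (\<lambda>P. frame E P / t' P) * eval_div \<iota> D (\<lambda>P. t' P / t P)"
      by (intro eval_div_mult unit_on_frames_divide[OF frame_in_frames t' D] unit_on_frames_divide[OF t' t D])
    finally show ?thesis .
  qed
  show ?thesis
  proof (rule norm_lineI)
    show "norm_elt E D c t = norm_elt E D c t' * eval_div \<iota> D (\<lambda>P. t' P / t P)"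
      if "t \<in> frames \<iota> (bundle_of_div E)" "t' \<in> frames \<iota> (bundle_of_div E)" for t t'
      unfolding norm_elt_def eq[OF that] using that by (simp only: if_True mult.assoc)
  qed (simp add: norm_elt_def)
qed

lemma norm_elt_frame:
  assumes D: "Poly_Mapping.keys D \<subseteq> points \<iota>"
  shows "norm_elt E D c (frame E) = c"
proof -
  have "eval_div \<iota> D (\<lambda>P. frame E P / frame E P) = eval_div \<iota> D (\<lambda>_. 1)"
    using D frame_props by (intro eval_div_cong) auto
  then show ?thesis using D by (simp add: norm_elt_def frame_in_frames)
qed

lemma norm_elt_scale: "(\<lambda>t. a * norm_elt E D c t) = norm_elt E D (a * c)"
  by (auto simp: norm_elt_def)

lemma norm_section_eq:
  assumes D: "Poly_Mapping.keys D \<subseteq> points \<iota>" and s: "s \<noteq> 0"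
    and disj: "disjoint_div (E + div_fun \<iota> s) D"
  shows "norm_section \<iota> D (bundle_of_div E) s = norm_elt E D (eval_div \<iota> D (\<lambda>P. s / frame E P))"
proof -
  have "eval_div \<iota> D (\<lambda>P. s / t P)
      = eval_div \<iota> D (\<lambda>P. s / frame E P) * eval_div \<iota> D (\<lambda>P. frame E P / t P)"
    if t: "t \<in> frames \<iota> (bundle_of_div E)" for t
  proof -
    have "eval_div \<iota> D (\<lambda>P. s / t P) = eval_div \<iota> D (\<lambda>P. (s / frame E P) * (frame E P / t P))"
      using D frame_props by (intro eval_div_cong) auto
    also have "\<dots> = eval_div \<iota> D (\<lambda>P. s / frame E P) * eval_div \<iota> D (\<lambda>P. frame E P / t P)"
      using disj
      by (intro eval_div_mult unit_on_frames_divide[OF frame_in_frames t D]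
          unit_on_section[OF s frame_in_frames D]) (auto simp: disjoint_div_def)
    finally show ?thesis .
  qed
  then show ?thesis by (auto simp: norm_section_def norm_elt_def)
qed

section \<open>Triples and their operations\<close>

lemma triples_iff:
  "(D, E, \<phi>) \<in> triples \<iota> \<longleftrightarrow> D \<in> Div0 \<iota> \<and> E \<in> Div0 \<iota> \<and>
     \<phi> \<in> norm_line \<iota> D (bundle_of_div E) \<and> \<phi> \<noteq> (\<lambda>_. 0)"
  by (simp add: triples_def)

lemma norm_elt_triple:
  assumes "D \<in> Div0 \<iota>" "E \<in> Div0 \<iota>" "c \<noteq> 0"
  shows "(D, E, norm_elt E D c) \<in> triples \<iota>"
proof -
  have D: "Poly_Mapping.keys D \<subseteq> points \<iota>" using assms by (simp add: Div0_iff)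
  have "norm_elt E D c \<noteq> (\<lambda>_. 0)" using norm_elt_frame[OF D, of E c] assms(3) by auto
  then show ?thesis using assms norm_elt_in_norm_line[OF D] by (simp add: triples_iff)
qed

lemma triple_nonzero:
  assumes "(D, E, \<phi>) \<in> triples \<iota>" "t \<in> frames \<iota> (bundle_of_div E)"
  shows "\<phi> t \<noteq> 0"
proof
  assume 0: "\<phi> t = 0"
  have \<phi>: "\<phi> \<in> norm_line \<iota> D (bundle_of_div E)" using assms by (simp add: triples_iff)
  have "\<phi> t' = 0" for t'
    using norm_lineD[OF \<phi> _ assms(2), of t'] norm_line_outside[OF \<phi>, of t'] 0 by fastforce
  then have "\<phi> = (\<lambda>_. 0)" by auto
  with assms show False by (simp add: triples_iff)
qed

lemma triple_mult:
  assumes 1: "(D, E, \<phi>) \<in> triples \<iota>" and 2: "(D', E, \<phi>') \<in> triples \<iota>"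
  shows "(D + D', E, \<lambda>t. \<phi> t * \<phi>' t) \<in> triples \<iota>"
proof -
  have keys: "Poly_Mapping.keys D \<union> Poly_Mapping.keys D' \<subseteq> points \<iota>"
    using 1 2 by (auto simp: triples_iff Div0_iff)
  have "\<phi> t * \<phi>' t = \<phi> t' * \<phi>' t' * eval_div \<iota> (D + D') (\<lambda>P. t' P / t P)"
    if t: "t \<in> frames \<iota> (bundle_of_div E)" and t': "t' \<in> frames \<iota> (bundle_of_div E)" for t t'
  proof -
    have "\<phi> t = \<phi> t' * eval_div \<iota> D (\<lambda>P. t' P / t P)" "\<phi>' t = \<phi>' t' * eval_div \<iota> D' (\<lambda>P. t' P / t P)"
      using 1 2 t t' by (auto simp: triples_iff intro: norm_lineD)
    moreover have "eval_div \<iota> (D + D') (\<lambda>P. t' P / t P)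
        = eval_div \<iota> D (\<lambda>P. t' P / t P) * eval_div \<iota> D' (\<lambda>P. t' P / t P)"
      by (intro eval_div_add unit_on_frames_divide[OF t' t] keys)
    ultimately show ?thesis by simp
  qed
  moreover have "\<phi> t * \<phi>' t = 0" if "t \<notin> frames \<iota> (bundle_of_div E)" for t
    using 1 that norm_line_outside by (auto simp: triples_iff)
  ultimately have "(\<lambda>t. \<phi> t * \<phi>' t) \<in> norm_line \<iota> (D + D') (bundle_of_div E)"
    by (intro norm_lineI) blast+
  moreover have "\<phi> (frame E) * \<phi>' (frame E) \<noteq> 0"
    using triple_nonzero[OF 1 frame_in_frames] triple_nonzero[OF 2 frame_in_frames] by simp
  then have "(\<lambda>t. \<phi> t * \<phi>' t) \<noteq> (\<lambda>_. 0)" by (auto dest: fun_cong)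
  ultimately show ?thesis using 1 2 by (simp add: triples_iff Div0_add)
qed

lemma triple_scale:
  assumes "(D, E, \<phi>) \<in> triples \<iota>" "c \<noteq> 0"
  shows "(D, E, \<lambda>t. c * \<phi> t) \<in> triples \<iota>"
proof -
  have "c * \<phi> (frame E) \<noteq> 0" using triple_nonzero[OF assms(1) frame_in_frames] assms(2) by simp
  then have "(\<lambda>t. c * \<phi> t) \<noteq> (\<lambda>_. 0)" by (auto dest: fun_cong)
  moreover have "(\<lambda>t. c * \<phi> t) \<in> norm_line \<iota> D (bundle_of_div E)"
  proof (rule norm_lineI)
    have \<phi>: "\<phi> \<in> norm_line \<iota> D (bundle_of_div E)" using assms by (simp add: triples_iff)
    show "c * \<phi> t = 0" if "t \<notin> frames \<iota> (bundle_of_div E)" for t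
      using norm_line_outside[OF \<phi> that] by simp
    show "c * \<phi> t = c * \<phi> t' * eval_div \<iota> D (\<lambda>P. t' P / t P)"
      if "t \<in> frames \<iota> (bundle_of_div E)" "t' \<in> frames \<iota> (bundle_of_div E)" for t t'
      using norm_lineD[OF \<phi> that] by simp
  qed
  ultimately show ?thesis using assms by (simp add: triples_iff)
qed

text \<open>\<open>change_right\<close> demands that both sides are triples; by this lemma it
  applies to every triple whose second component has the form E + (f) with f nonzero.\<close>

lemma triple_shift:
  assumes \<tau>: "(D, E + div_fun \<iota> f, \<phi>) \<in> triples \<iota>" and f: "f \<noteq> 0"
  shows "(D, E, \<lambda>t. \<phi> (\<lambda>P. t P / f)) \<in> triples \<iota>"
proof -
  let ?E = "E + div_fun \<iota> f"
  \<comment> \<open>Needed for the value 0 outside the frames: if t is not a frame of O(E), then t /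
    f is not one of O(E + (f)).\<close>
  have unshift: "t \<in> frames \<iota> (bundle_of_div E)" if "(\<lambda>P. t P / f) \<in> frames \<iota> (bundle_of_div ?E)" for t
    using frames_shift[OF that, of "inverse f"] f by (simp add: div_fun_inverse)
  have "\<phi> (\<lambda>P. t P / f) = \<phi> (\<lambda>P. t' P / f) * eval_div \<iota> D (\<lambda>P. t' P / t P)"
    if t: "t \<in> frames \<iota> (bundle_of_div E)" and t': "t' \<in> frames \<iota> (bundle_of_div E)" for t t'
  proof -
    have "\<phi> (\<lambda>P. t P / f) = \<phi> (\<lambda>P. t' P / f) * eval_div \<iota> D (\<lambda>P. (t' P / f) / (t P / f))"
      using \<tau> by (intro norm_lineD[OF _ frames_shift[OF t f] frames_shift[OF t' f]]) (simp add: triples_iff)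
    then show ?thesis using f by simp
  qed
  moreover have "\<phi> (\<lambda>P. t P / f) = 0" if "t \<notin> frames \<iota> (bundle_of_div E)" for t
    using \<tau> by (intro norm_line_outside) (use unshift that in \<open>auto simp: triples_iff\<close>)
  ultimately have "(\<lambda>t. \<phi> (\<lambda>P. t P / f)) \<in> norm_line \<iota> D (bundle_of_div E)"
    by (intro norm_lineI) blast+
  moreover have "\<phi> (\<lambda>P. frame E P / f) \<noteq> 0"
    by (intro triple_nonzero[OF \<tau>] frames_shift frame_in_frames f)
  then have "(\<lambda>t. \<phi> (\<lambda>P. t P / f)) \<noteq> (\<lambda>_. 0)" by (auto dest: fun_cong)
  moreover have "E \<in> Div0 \<iota>"
    using \<tau> Div0_add[of ?E "- div_fun \<iota> f"] Div0_minus[OF div_fun_Div0[OF f]] by (simp add: triples_iff)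
  ultimately show ?thesis using \<tau> by (simp add: triples_iff)
qed

end


section \<open>The Poincare torsor over a fixed second argument\<close>

locale torsor_base = curve_with_point +
  fixes B :: "'b divisor"
  assumes B: "B \<in> Div0 \<iota>"
begin

text \<open>\<open>(D, c)\<close> stands for the element \<open>c \<cdot> N\<^sub>D(t)\<close> of \<open>N\<^sub>D(O(B))\<close>, where \<open>t\<close> is a fixed frame of \<open>O(B)\<close>.\<close>

definition pairs :: "('b divisor \<times> 'a) monoid" where
  "pairs = \<lparr>carrier = Div0 \<iota> \<times> {c. c \<noteq> 0}, monoid.mult = (\<lambda>x y. (fst x + fst y, snd x * snd y)), one = (0, 1)\<rparr>"

lemma pairs_simps [simp]:
  "x \<in> carrier pairs \<longleftrightarrow> fst x \<in> Div0 \<iota> \<and> snd x \<noteq> 0"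
  "x \<otimes>\<^bsub>pairs\<^esub> y = (fst x + fst y, snd x * snd y)" "\<one>\<^bsub>pairs\<^esub> = (0, 1)"
  by (auto simp: pairs_def mem_Times_iff)

lemma comm_group_pairs: "comm_group pairs"
proof (rule comm_groupI)
  show "\<exists>y\<in>carrier pairs. y \<otimes>\<^bsub>pairs\<^esub> x = \<one>\<^bsub>pairs\<^esub>" if "x \<in> carrier pairs" for x
    using that Div0_minus[of "fst x"] by (intro bexI[of _ "(- fst x, inverse (snd x))"]) auto
qed (auto simp: Div0_add Div0_zero add_ac)

sublocale pairs: comm_group pairs
  by (rule comm_group_pairs)

definition base :: "'b divisor \<times> 'a \<Rightarrow> ('a, 'b) triple" where
  "base x = (fst x, B, norm_elt B (fst x) (snd x))"

definition pair_class :: "'b divisor \<times> 'a \<Rightarrow> ('a, 'b) torsor_point" where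
  "pair_class x = torsor_class \<iota> (base x)"

text \<open>The quotient of the two sides of the identification (ii) for \<open>g\<close> and \<open>s\<close>.\<close>

definition relator :: "'b \<Rightarrow> 'b \<Rightarrow> 'b divisor \<times> 'a" where
  "relator g s = (div_fun \<iota> g,
     eval_div \<iota> (div_fun \<iota> g) (\<lambda>P. s / frame B P) / fun_at_div \<iota> g (B + div_fun \<iota> s))"

definition relators :: "('b divisor \<times> 'a) set" where
  "relators = {relator g s | g s. g \<noteq> 0 \<and> s \<noteq> 0 \<and> disjoint_div (B + div_fun \<iota> s) (div_fun \<iota> g)}"

definition relations :: "('b divisor \<times> 'a) set" where
  "relations = generate pairs relators"

section \<open>The subgroup of relations between pairs\<close>

lemma relatorsI:
  "g \<noteq> 0 \<Longrightarrow> s \<noteq> 0 \<Longrightarrow> disjoint_div (B + div_fun \<iota> s) (div_fun \<iota> g) \<Longrightarrow> relator g s \<in> relators"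
  unfolding relators_def by blast

lemma B_keys: "Poly_Mapping.keys B \<subseteq> points \<iota>"
  using B by (simp add: Div0_iff)

lemma fun_at_div_nonzero:
  assumes "g \<noteq> 0" "s \<noteq> 0" "disjoint_div (B + div_fun \<iota> s) (div_fun \<iota> g)"
  shows "fun_at_div \<iota> g (B + div_fun \<iota> s) \<noteq> 0"
  unfolding fun_at_div_def
proof (rule eval_div_nonzero)
  have "Poly_Mapping.keys (B + div_fun \<iota> s) \<subseteq> points \<iota>"
    using keys_add[of B "div_fun \<iota> s"] B_keys keys_div_fun by blast
  moreover have "Poly_Mapping.lookup (div_fun \<iota> g) P = 0" if "P \<in> Poly_Mapping.keys (B + div_fun \<iota> s)" for P
    using assms(3) that by (auto simp: disjoint_div_def in_keys_iff)
  ultimately show "unit_on (Poly_Mapping.keys (B + div_fun \<iota> s)) (\<lambda>_. g)"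
    using assms(1) by (fastforce simp: unit_on_def lookup_div_fun)
qed

lemma section_eval_nonzero:
  assumes "s \<noteq> 0" "Poly_Mapping.keys D \<subseteq> points \<iota>" "disjoint_div (B + div_fun \<iota> s) D"
  shows "eval_div \<iota> D (\<lambda>P. s / frame B P) \<noteq> 0"
  using assms
  by (intro eval_div_nonzero unit_on_section[of s _ B] frame_in_frames) (auto simp: disjoint_div_def)

lemma relators_carrier: "relators \<subseteq> carrier pairs"
proof
  fix x assume "x \<in> relators"
  then obtain g s where x: "x = relator g s" "g \<noteq> 0" "s \<noteq> 0" "disjoint_div (B + div_fun \<iota> s) (div_fun \<iota> g)"
    by (auto simp: relators_def)
  then show "x \<in> carrier pairs"
    using fun_at_div_nonzero[of g s] section_eval_nonzero[of s "div_fun \<iota> g"] div_fun_Div0[of g] keys_div_fun[of g]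
    by (simp add: relator_def)
qed

lemma relations_subgroup: "subgroup relations pairs"
  unfolding relations_def by (rule pairs.generate_is_subgroup) (rule relators_carrier)

lemma relations_carrier: "k \<in> relations \<Longrightarrow> k \<in> carrier pairs"
  using subgroup.mem_carrier[OF relations_subgroup] .

lemma relations_mult: "k \<in> relations \<Longrightarrow> l \<in> relations \<Longrightarrow> k \<otimes>\<^bsub>pairs\<^esub> l \<in> relations"
  by (rule subgroup.m_closed[OF relations_subgroup])

lemma relations_one: "(0, 1) \<in> relations"
  using subgroup.one_closed[OF relations_subgroup] by simp

text \<open>The generators have principal first components, and products and inverses keep this. It
  is what makes the class in J(K) depend on the point of the torsor alone.\<close>

lemma relations_principal:
  assumes "k \<in> relations"
  shows "\<exists>f. f \<noteq> 0 \<and> fst k = div_fun \<iota> f"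
  using assms unfolding relations_def
proof (induction rule: generate.induct)
  case one
  show ?case by (intro exI[of _ 1]) simp
next
  case (incl h)
  then show ?case by (auto simp: relators_def relator_def)
next
  case (inv h)
  then have h: "h \<in> carrier pairs" using relators_carrier by blast
  obtain g where g: "g \<noteq> 0" "fst h = div_fun \<iota> g" using inv by (auto simp: relators_def relator_def)
  have "inv\<^bsub>pairs\<^esub> h \<otimes>\<^bsub>pairs\<^esub> h = \<one>\<^bsub>pairs\<^esub>" using h by (rule pairs.l_inv)
  then have "fst (inv\<^bsub>pairs\<^esub> h) = - fst h" by (simp add: eq_neg_iff_add_eq_0)
  then show ?case using g by (intro exI[of _ "inverse g"]) (simp add: div_fun_inverse)
next
  case (eng h h')
  then obtain f f' where "f \<noteq> 0" "fst h = div_fun \<iota> f" "f' \<noteq> 0" "fst h' = div_fun \<iota> f'" by blast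
  then show ?case by (intro exI[of _ "f * f'"]) (simp add: div_fun_mult)
qed

text \<open>An explicit description of the class of \<open>base x\<close>: E is brought back to B by
  identification (i), the coordinate is read at the transported frame, and what remains may differ
  from x by a relation. The function f is left open, since E determines it only up to a
  constant.\<close>

definition represents :: "'b divisor \<times> 'a \<Rightarrow> ('a, 'b) triple \<Rightarrow> bool" where
  "represents x \<tau> \<longleftrightarrow> (case \<tau> of (D, E, \<phi>) \<Rightarrow> \<exists>f k. f \<noteq> 0 \<and> E = B + div_fun \<iota> f \<and> k \<in> relations \<and>
     (D, \<phi> (\<lambda>P. frame B P / f)) = x \<otimes>\<^bsub>pairs\<^esub> k)"

lemma representsI:
  "f \<noteq> 0 \<Longrightarrow> E = B + div_fun \<iota> f \<Longrightarrow> k \<in> relations \<Longrightarrow>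
     (D, \<phi> (\<lambda>P. frame B P / f)) = x \<otimes>\<^bsub>pairs\<^esub> k \<Longrightarrow> represents x (D, E, \<phi>)"
  unfolding represents_def by blast

lemma representsE:
  assumes "represents x (D, E, \<phi>)"
  obtains f k where "f \<noteq> 0" "E = B + div_fun \<iota> f" "k \<in> relations"
    "(D, \<phi> (\<lambda>P. frame B P / f)) = x \<otimes>\<^bsub>pairs\<^esub> k"
  using assms unfolding represents_def by blast

lemma identified_triples: "identified \<iota> \<tau> \<tau>' \<Longrightarrow> \<tau> \<in> triples \<iota> \<and> \<tau>' \<in> triples \<iota>"
  by (induction rule: identified.induct) auto

text \<open>Identification (i) by g only replaces f by f / g. The two sides of identification (ii)
  for g and s differ by \<open>relator g (f * s)\<close>: multiplication by f carries O(E) to O(B)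
  and the section s to f s, whose divisor is the same.\<close>

lemma identified_represents:
  assumes "identified \<iota> \<tau> \<tau>'" and x: "x \<in> carrier pairs"
  shows "represents x \<tau> \<longleftrightarrow> represents x \<tau>'"
  using assms(1)
proof cases
  case (change_right g D E \<phi>)
  have fwd: "represents x \<tau>'" if r: "represents x \<tau>"
  proof -
    obtain f k where f: "f \<noteq> 0" "E + div_fun \<iota> g = B + div_fun \<iota> f" "k \<in> relations"
      "(D, \<phi> (\<lambda>P. frame B P / f)) = x \<otimes>\<^bsub>pairs\<^esub> k"
      using r unfolding change_right(1) by (rule representsE)
    show ?thesis unfolding change_right(2)
    proof (rule representsI[of "f / g" _ k])
      show "E = B + div_fun \<iota> (f / g)" using f change_right by (simp add: div_fun_divide algebra_simps)
    qed (use f change_right in auto)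
  qed
  have bwd: "represents x \<tau>" if r: "represents x \<tau>'"
  proof -
    obtain f k where f: "f \<noteq> 0" "E = B + div_fun \<iota> f" "k \<in> relations"
      "(D, \<phi> (\<lambda>P. frame B P / f / g)) = x \<otimes>\<^bsub>pairs\<^esub> k"
      using r unfolding change_right(2) by (rule representsE)
    show ?thesis unfolding change_right(1)
    proof (rule representsI[of "f * g" _ k])
      show "E + div_fun \<iota> g = B + div_fun \<iota> (f * g)" using f change_right by (simp add: div_fun_mult add.assoc)
    qed (use f change_right in auto)
  qed
  from fwd bwd show ?thesis by blast
next
  case (change_left g s E D \<phi> c \<psi>)
  have E: "Poly_Mapping.keys E \<subseteq> points \<iota>" and D: "D \<in> Div0 \<iota>"
    using change_left(10) by (auto simp: triples_iff Div0_iff)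
  have rel: "\<exists>r\<in>relations. (D + div_fun \<iota> g, \<phi> (\<lambda>P. frame B P / f)) = (D, \<psi> (\<lambda>P. frame B P / f)) \<otimes>\<^bsub>pairs\<^esub> r"
    if f: "f \<noteq> 0" "E = B + div_fun \<iota> f" for f
  proof
    have sec: "div_section \<iota> (bundle_of_div E) s = B + div_fun \<iota> (f * s)"
      using E change_left(4) f by (simp add: div_section_bundle_of_div div_fun_mult add.assoc)
    have fs: "f * s \<noteq> 0" using f change_left(4) by simp
    have disj: "disjoint_div (B + div_fun \<iota> (f * s)) D" "disjoint_div (B + div_fun \<iota> (f * s)) (div_fun \<iota> g)"
      using change_left(5,6) sec by simp_all
    show "relator g (f * s) \<in> relations"
      unfolding relations_def by (intro generate.incl relatorsI change_left(3) fs disj)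
    have t: "(\<lambda>P. frame B P / f) \<in> frames \<iota> (bundle_of_div E)"
      unfolding f(2) by (rule frames_shift[OF frame_in_frames f(1)])
    have unit: "unit_on (Poly_Mapping.keys D \<union> Poly_Mapping.keys (div_fun \<iota> g)) (\<lambda>P. f * s / frame B P)"
      using D disj keys_div_fun[of g]
      by (intro unit_on_section[of _ _ B] frame_in_frames fs) (auto simp: Div0_iff disjoint_div_def)
    have nz: "fun_at_div \<iota> g (B + div_fun \<iota> (f * s)) \<noteq> 0"
      by (rule fun_at_div_nonzero[OF change_left(3) fs disj(2)])
    have "\<phi> (\<lambda>P. frame B P / f) = c * eval_div \<iota> (D + div_fun \<iota> g) (\<lambda>P. f * s / frame B P)"
      using t by (simp add: change_left(7) norm_section_def mult.commute[of s f])
    moreover have "\<psi> (\<lambda>P. frame B P / f)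
        = c * (fun_at_div \<iota> g (B + div_fun \<iota> (f * s)) * eval_div \<iota> D (\<lambda>P. f * s / frame B P))"
      using t by (simp add: change_left(8) norm_section_def mult.commute[of s f] sec)
    ultimately show "(D + div_fun \<iota> g, \<phi> (\<lambda>P. frame B P / f))
        = (D, \<psi> (\<lambda>P. frame B P / f)) \<otimes>\<^bsub>pairs\<^esub> relator g (f * s)"
      using nz eval_div_add[OF unit] by (simp add: relator_def)
  qed
  have fwd: "represents x \<tau>'" if r: "represents x \<tau>"
  proof -
    obtain f k where f: "f \<noteq> 0" "E = B + div_fun \<iota> f" "k \<in> relations"
      "(D + div_fun \<iota> g, \<phi> (\<lambda>P. frame B P / f)) = x \<otimes>\<^bsub>pairs\<^esub> k"
      using r unfolding change_left(1) by (rule representsE)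
    let ?d = "(D, \<psi> (\<lambda>P. frame B P / f))"
    obtain r where r: "r \<in> relations" "(D + div_fun \<iota> g, \<phi> (\<lambda>P. frame B P / f)) = ?d \<otimes>\<^bsub>pairs\<^esub> r"
      using rel[OF f(1,2)] by blast
    have "\<psi> (\<lambda>P. frame B P / f) \<noteq> 0"
      by (rule triple_nonzero[OF change_left(10)]) (use frames_shift[OF frame_in_frames f(1), of B] f(2) in simp)
    then have d: "?d \<in> carrier pairs" using D by simp
    have kr: "k \<in> carrier pairs" "r \<in> carrier pairs" using f r relations_carrier by blast+
    have eq: "x \<otimes>\<^bsub>pairs\<^esub> k = ?d \<otimes>\<^bsub>pairs\<^esub> r" using f r by simp
    have "x \<otimes>\<^bsub>pairs\<^esub> (k \<otimes>\<^bsub>pairs\<^esub> inv\<^bsub>pairs\<^esub> r) = (?d \<otimes>\<^bsub>pairs\<^esub> r) \<otimes>\<^bsub>pairs\<^esub> inv\<^bsub>pairs\<^esub> r"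
      unfolding eq[symmetric] by (rule pairs.m_assoc[symmetric]) (use x kr in blast)+
    also have "\<dots> = ?d \<otimes>\<^bsub>pairs\<^esub> (r \<otimes>\<^bsub>pairs\<^esub> inv\<^bsub>pairs\<^esub> r)"
      by (rule pairs.m_assoc) (use d kr in blast)+
    also have "\<dots> = ?d" using pairs.r_inv[OF kr(2)] by simp
    finally have "?d = x \<otimes>\<^bsub>pairs\<^esub> (k \<otimes>\<^bsub>pairs\<^esub> inv\<^bsub>pairs\<^esub> r)" ..
    moreover have "k \<otimes>\<^bsub>pairs\<^esub> inv\<^bsub>pairs\<^esub> r \<in> relations"
      by (rule relations_mult) (use f r subgroup.m_inv_closed[OF relations_subgroup] in blast)+
    ultimately show ?thesis unfolding change_left(2) using f by (intro representsI)
  qed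
  have bwd: "represents x \<tau>" if r: "represents x \<tau>'"
  proof -
    obtain f k where f: "f \<noteq> 0" "E = B + div_fun \<iota> f" "k \<in> relations"
      "(D, \<psi> (\<lambda>P. frame B P / f)) = x \<otimes>\<^bsub>pairs\<^esub> k"
      using r unfolding change_left(2) by (rule representsE)
    obtain r where r: "r \<in> relations"
      "(D + div_fun \<iota> g, \<phi> (\<lambda>P. frame B P / f)) = (D, \<psi> (\<lambda>P. frame B P / f)) \<otimes>\<^bsub>pairs\<^esub> r"
      using rel[OF f(1,2)] by blast
    have "(D + div_fun \<iota> g, \<phi> (\<lambda>P. frame B P / f)) = x \<otimes>\<^bsub>pairs\<^esub> (k \<otimes>\<^bsub>pairs\<^esub> r)"
      unfolding r(2) f(4) by (simp add: add.assoc mult.assoc)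
    then show ?thesis unfolding change_left(1) using f r relations_mult by (intro representsI)
  qed
  from fwd bwd show ?thesis by blast
qed

section \<open>Classes of pairs\<close>

lemma base_triple: "x \<in> carrier pairs \<Longrightarrow> base x \<in> triples \<iota>"
  unfolding base_def using B by (intro norm_elt_triple) auto

lemma base_represents: "x \<in> carrier pairs \<Longrightarrow> represents x (base x)"
  unfolding base_def
  by (rule representsI[of 1 _ "(0, 1)"]) (auto simp: relations_one norm_elt_frame Div0_iff)

lemma base_move:
  assumes x: "x \<in> carrier pairs" and g: "g \<noteq> 0" and s: "s \<noteq> 0"
    and disj: "disjoint_div (B + div_fun \<iota> s) (div_fun \<iota> g)" "disjoint_div (B + div_fun \<iota> s) (fst x)"
  shows "identified \<iota> (base (x \<otimes>\<^bsub>pairs\<^esub> relator g s)) (base x)"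
proof -
  let ?D = "fst x" and ?u = "\<lambda>P. s / frame B P" and ?v = "fun_at_div \<iota> g (B + div_fun \<iota> s)"
  \<comment> \<open>The scalar for which c times the right-hand side of identification (ii),
    expressed in the fixed frame, has coordinate \<open>snd x\<close>.\<close>
  define c where "c = snd x / (?v * eval_div \<iota> ?D ?u)"
  have keys: "Poly_Mapping.keys ?D \<subseteq> points \<iota>" using x by (simp add: Div0_iff)
  have keys': "Poly_Mapping.keys (?D + div_fun \<iota> g) \<subseteq> points \<iota>"
    using keys_add[of ?D "div_fun \<iota> g"] keys keys_div_fun by blast
  have disj': "disjoint_div (B + div_fun \<iota> s) (?D + div_fun \<iota> g)"
    using disj keys_add[of ?D "div_fun \<iota> g"] unfolding disjoint_div_def by blast
  have nz: "?v \<noteq> 0" "eval_div \<iota> ?D ?u \<noteq> 0"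
    using fun_at_div_nonzero[OF g s disj(1)] section_eval_nonzero[OF s keys disj(2)] by auto
  have sec: "div_section \<iota> (bundle_of_div B) s = B + div_fun \<iota> s"
    using B_keys s by (rule div_section_bundle_of_div)
  have unit: "unit_on (Poly_Mapping.keys ?D \<union> Poly_Mapping.keys (div_fun \<iota> g)) ?u"
    using keys keys_div_fun[of g] disj
    by (intro unit_on_section[of _ _ B] frame_in_frames s) (auto simp: disjoint_div_def)
  have split: "eval_div \<iota> (?D + div_fun \<iota> g) ?u = eval_div \<iota> ?D ?u * eval_div \<iota> (div_fun \<iota> g) ?u"
    by (rule eval_div_add[OF unit])
  have rel: "relator g s \<in> carrier pairs"
    using relators_carrier relatorsI[OF g s disj(1)] by blast
  have base1: "base (x \<otimes>\<^bsub>pairs\<^esub> relator g s) = (?D + div_fun \<iota> g, B,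
      \<lambda>t. c * norm_section \<iota> (?D + div_fun \<iota> g) (bundle_of_div B) s t)"
    unfolding norm_section_eq[OF keys' s disj'] norm_elt_scale base_def
    using nz by (simp add: relator_def c_def split)
  have base2: "base x = (?D, B, \<lambda>t. c * (?v * norm_section \<iota> ?D (bundle_of_div B) s t))"
    unfolding norm_section_eq[OF keys s disj(2)] mult.assoc[symmetric] norm_elt_scale base_def
    using nz by (simp add: c_def)
  have "base (x \<otimes>\<^bsub>pairs\<^esub> relator g s) \<in> triples \<iota>"
    by (intro base_triple pairs.m_closed x rel)
  moreover have "base x \<in> triples \<iota>" by (rule base_triple[OF x])
  ultimately show ?thesis unfolding base1 base2
    using g s disj by (intro identified.change_left[where c = c and s = s]) (simp_all add: sec)
qed

text \<open>
  The identification needs \<open>s\<close> to be disjoint from \<open>D\<close>. This is circumvented by moving \<open>D\<close> away from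
  \<open>s\<close> with an auxiliary function \<open>g'\<close>, applying it there, and moving back.
\<close>

lemma base_relator:
  assumes x: "x \<in> carrier pairs" and r: "r \<in> relators"
  shows "equivclp (identified \<iota>) (base x) (base (x \<otimes>\<^bsub>pairs\<^esub> r))"
proof -
  obtain g s where gs: "r = relator g s" "g \<noteq> 0" "s \<noteq> 0" "disjoint_div (B + div_fun \<iota> s) (div_fun \<iota> g)"
    using r by (auto simp: relators_def)
  have rc: "r \<in> carrier pairs" using r relators_carrier by blast
  have Bs: "Poly_Mapping.keys (B + div_fun \<iota> s) \<subseteq> points \<iota>"
    using keys_add[of B "div_fun \<iota> s"] B_keys keys_div_fun by blast
  \<comment> \<open>On the support of B + (s) the divisor of g' is the negative of
    \<open>fst x\<close>, so \<open>fst x\<close> + (g') avoids this support and the move by g and s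
    is allowed there.\<close>
  obtain g' where g': "g' \<noteq> 0"
    "\<And>P. P \<in> Poly_Mapping.keys (B + div_fun \<iota> s) \<Longrightarrow> P g' = - Poly_Mapping.lookup (fst x) P"
    by (rule weak_approximation[OF finite_keys Bs, of "\<lambda>P. - Poly_Mapping.lookup (fst x) P"]) blast
  let ?S = "Poly_Mapping.keys (fst x) \<union> Poly_Mapping.keys (div_fun \<iota> g) \<union> Poly_Mapping.keys (div_fun \<iota> g')"
  have S: "finite ?S" "?S \<subseteq> points \<iota>" using x keys_div_fun by (auto simp: Div0_iff)
  \<comment> \<open>s' generates O(B) along the supports of \<open>fst x\<close>, (g) and (g'), so
    the move by g' may be made from \<open>fst x\<close> as well as from \<open>fst x\<close> +
    (g).\<close>
  obtain s' where s': "s' \<noteq> 0" "\<And>P. P \<in> ?S \<Longrightarrow> P s' = - Poly_Mapping.lookup B P"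
    by (rule weak_approximation[OF S, of "\<lambda>P. - Poly_Mapping.lookup B P"]) blast
  have "P \<notin> Poly_Mapping.keys (B + div_fun \<iota> s')" if "P \<in> ?S" for P
    using s'(2)[OF that] subsetD[OF S(2) that] by (simp add: in_keys_iff lookup_add lookup_div_fun)
  then have s'S: "?S \<inter> Poly_Mapping.keys (B + div_fun \<iota> s') = {}" by blast
  have d1: "disjoint_div (B + div_fun \<iota> s') (div_fun \<iota> g')" "disjoint_div (B + div_fun \<iota> s') (fst x)"
    using s'S by (auto simp: disjoint_div_def)
  have d2: "disjoint_div (B + div_fun \<iota> s') (fst (x \<otimes>\<^bsub>pairs\<^esub> r))"
    using s'S keys_add[of "fst x" "div_fun \<iota> g"] by (auto simp: disjoint_div_def gs relator_def)
  have d3: "disjoint_div (B + div_fun \<iota> s) (fst (x \<otimes>\<^bsub>pairs\<^esub> relator g' s'))"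
  proof -
    have "P \<notin> Poly_Mapping.keys (fst x + div_fun \<iota> g')" if "P \<in> Poly_Mapping.keys (B + div_fun \<iota> s)" for P
      using g'(2)[OF that] subsetD[OF Bs that] by (simp add: in_keys_iff lookup_add lookup_div_fun)
    then show ?thesis by (auto simp: disjoint_div_def relator_def)
  qed
  have r': "relator g' s' \<in> carrier pairs"
    using relators_carrier relatorsI[OF g'(1) s'(1) d1(1)] by blast
  have 1: "identified \<iota> (base (x \<otimes>\<^bsub>pairs\<^esub> relator g' s')) (base x)"
    by (rule base_move[OF x g'(1) s'(1) d1])
  have 2: "identified \<iota> (base ((x \<otimes>\<^bsub>pairs\<^esub> relator g' s') \<otimes>\<^bsub>pairs\<^esub> r)) (base (x \<otimes>\<^bsub>pairs\<^esub> relator g' s'))"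
    unfolding gs(1) by (rule base_move[OF pairs.m_closed[OF x r'] gs(2-4) d3])
  have 3: "identified \<iota> (base ((x \<otimes>\<^bsub>pairs\<^esub> r) \<otimes>\<^bsub>pairs\<^esub> relator g' s')) (base (x \<otimes>\<^bsub>pairs\<^esub> r))"
    by (rule base_move[OF pairs.m_closed[OF x rc] g'(1) s'(1) d1(1) d2])
  have swap: "(x \<otimes>\<^bsub>pairs\<^esub> r) \<otimes>\<^bsub>pairs\<^esub> relator g' s' = (x \<otimes>\<^bsub>pairs\<^esub> relator g' s') \<otimes>\<^bsub>pairs\<^esub> r"
    by (simp add: add_ac mult_ac)
  have "equivclp (identified \<iota>) (base x) (base (x \<otimes>\<^bsub>pairs\<^esub> relator g' s'))"
    using 1 by (intro equivclp_sym[OF r_into_equivclp])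
  also have "equivclp (identified \<iota>) \<dots> (base ((x \<otimes>\<^bsub>pairs\<^esub> relator g' s') \<otimes>\<^bsub>pairs\<^esub> r))"
    using 2 by (intro equivclp_sym[OF r_into_equivclp])
  also have "equivclp (identified \<iota>) \<dots> (base (x \<otimes>\<^bsub>pairs\<^esub> r))"
    using 3 unfolding swap by (rule r_into_equivclp)
  finally show ?thesis .
qed

lemma base_relation:
  assumes "k \<in> relations" and "x \<in> carrier pairs"
  shows "equivclp (identified \<iota>) (base x) (base (x \<otimes>\<^bsub>pairs\<^esub> k))"
  using assms unfolding relations_def
proof (induction arbitrary: x rule: generate.induct)
  case one
  then show ?case by simp
next
  case (incl h)
  then show ?case by (intro base_relator)
next
  case (inv h)
  then have h: "h \<in> carrier pairs" using relators_carrier by blast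
  \<comment> \<open>The case of h itself, started at x times the inverse of h, ends at x.\<close>
  have "equivclp (identified \<iota>) (base (x \<otimes>\<^bsub>pairs\<^esub> inv\<^bsub>pairs\<^esub> h)) (base ((x \<otimes>\<^bsub>pairs\<^esub> inv\<^bsub>pairs\<^esub> h) \<otimes>\<^bsub>pairs\<^esub> h))"
    using inv h by (intro base_relator pairs.m_closed pairs.inv_closed)
  moreover have "(x \<otimes>\<^bsub>pairs\<^esub> inv\<^bsub>pairs\<^esub> h) \<otimes>\<^bsub>pairs\<^esub> h = x"
    using pairs.inv_solve_right'[of x x "inv\<^bsub>pairs\<^esub> h"] inv h pairs.m_assoc[of x "inv\<^bsub>pairs\<^esub> h" h]
    by (metis pairs.inv_closed pairs.l_inv pairs.r_one)
  ultimately show ?case by (metis equivclp_sym)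
next
  case (eng h h')
  then have hh: "h \<in> carrier pairs" "h' \<in> carrier pairs"
    using relations_carrier unfolding relations_def by blast+
  have "equivclp (identified \<iota>) (base x) (base (x \<otimes>\<^bsub>pairs\<^esub> h))"
    using eng by blast
  also have "equivclp (identified \<iota>) \<dots> (base ((x \<otimes>\<^bsub>pairs\<^esub> h) \<otimes>\<^bsub>pairs\<^esub> h'))"
    using eng hh by (intro eng.IH pairs.m_closed)
  also have "(x \<otimes>\<^bsub>pairs\<^esub> h) \<otimes>\<^bsub>pairs\<^esub> h' = x \<otimes>\<^bsub>pairs\<^esub> (h \<otimes>\<^bsub>pairs\<^esub> h')"
    using eng hh by (intro pairs.m_assoc)
  finally show ?case .
qed

text \<open>The converse of invariance: identification (i) for f turns the triple into
  \<open>base\<close> of x times k, and \<open>base_relation\<close> removes k.\<close>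

lemma represents_equiv:
  assumes x: "x \<in> carrier pairs" and \<tau>: "\<tau> \<in> triples \<iota>" and r: "represents x \<tau>"
  shows "equivclp (identified \<iota>) (base x) \<tau>"
proof -
  obtain D E \<phi> where \<tau>_eq: "\<tau> = (D, E, \<phi>)" by (cases \<tau>)
  obtain f k where f: "f \<noteq> 0" "E = B + div_fun \<iota> f" "k \<in> relations"
    "(D, \<phi> (\<lambda>P. frame B P / f)) = x \<otimes>\<^bsub>pairs\<^esub> k"
    using r unfolding \<tau>_eq by (rule representsE)
  have D: "(D, B + div_fun \<iota> f, \<phi>) \<in> triples \<iota>" using \<tau> f \<tau>_eq by simp
  have sh: "(D, B, \<lambda>t. \<phi> (\<lambda>P. t P / f)) \<in> triples \<iota>" by (rule triple_shift[OF D f(1)])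
  have "(D, B, \<lambda>t. \<phi> (\<lambda>P. t P / f)) = base (D, \<phi> (\<lambda>P. frame B P / f))"
    using norm_line_eq_norm_elt[of "\<lambda>t. \<phi> (\<lambda>P. t P / f)" D B] sh by (simp add: base_def triples_iff)
  then have "identified \<iota> \<tau> (base (x \<otimes>\<^bsub>pairs\<^esub> k))"
    using identified.change_right[OF f(1) D sh] f \<tau>_eq by simp
  then have "equivclp (identified \<iota>) (base (x \<otimes>\<^bsub>pairs\<^esub> k)) \<tau>"
    by (intro equivclp_sym[OF r_into_equivclp])
  with base_relation[OF f(3) x] show ?thesis by (rule equivclp_trans)
qed

text \<open>Chains of identifications are traded for a predicate on a single triple:
  \<open>represents x\<close> survives every step of a chain, and every triple that satisfies it is
  reached.\<close>

lemma pair_class_eq: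
  assumes x: "x \<in> carrier pairs"
  shows "pair_class x = {\<tau> \<in> triples \<iota>. represents x \<tau>}"
proof -
  have "\<tau> \<in> triples \<iota> \<and> represents x \<tau>" if "equivclp (identified \<iota>) (base x) \<tau>" for \<tau>
    using that
  proof (induction rule: equivclp_induct)
    case base
    then show ?case using base_triple[OF x] base_represents[OF x] by blast
  next
    case (step y z)
    then show ?case using identified_triples identified_represents[OF _ x] by blast
  qed
  then show ?thesis
    using represents_equiv[OF x] by (auto simp: pair_class_def torsor_class_def)
qed

lemma torsor_class_cong:
  assumes "equivclp (identified \<iota>) \<tau> \<tau>'"
  shows "torsor_class \<iota> \<tau> = torsor_class \<iota> \<tau>'"
  unfolding torsor_class_def using assms by (blast intro: equivclp_trans equivclp_sym)

lemma torsor_class_represents: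
  assumes "x \<in> carrier pairs" "\<tau> \<in> triples \<iota>" "represents x \<tau>"
  shows "torsor_class \<iota> \<tau> = pair_class x"
  unfolding pair_class_def using torsor_class_cong[OF represents_equiv[OF assms]] ..

text \<open>Functions with equal divisors differ by a constant, which has norm \<open>1\<close> at divisors of degree \<open>0\<close>.\<close>

lemma coordinate_unique:
  assumes \<tau>: "(D, E, \<phi>) \<in> triples \<iota>" and f: "f \<noteq> 0" "E = B + div_fun \<iota> f"
    and f': "f' \<noteq> 0" "E = B + div_fun \<iota> f'"
  shows "\<phi> (\<lambda>P. frame B P / f) = \<phi> (\<lambda>P. frame B P / f')"
proof -
  have "div_fun \<iota> (f / f') = 0" using f f' by (simp add: div_fun_divide)
  then obtain c where c: "c \<noteq> 0" "f / f' = \<iota> c"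
    using unit_function_constant[of "f / f'"] f f' by auto
  have D: "D \<in> Div0 \<iota>" using \<tau> by (simp add: triples_iff)
  have "(\<lambda>P. frame B P / f) \<in> frames \<iota> (bundle_of_div E)" "(\<lambda>P. frame B P / f') \<in> frames \<iota> (bundle_of_div E)"
    using frames_shift[OF frame_in_frames, of _ B] f f' by metis+
  then have "\<phi> (\<lambda>P. frame B P / f) = \<phi> (\<lambda>P. frame B P / f') *
      eval_div \<iota> D (\<lambda>P. (frame B P / f') / (frame B P / f))"
    using \<tau> by (intro norm_lineD) (simp_all add: triples_iff)
  also have "eval_div \<iota> D (\<lambda>P. (frame B P / f') / (frame B P / f)) = eval_div \<iota> D (\<lambda>_. \<iota> c)"
    using D frame_props f f' c(2)[symmetric] by (intro eval_div_cong) (auto simp: Div0_iff)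
  also have "\<dots> = 1" by (rule eval_div_const[OF D c(1)])
  finally show ?thesis by simp
qed

text \<open>The two representations may bring E back to B by different functions f and f';
  \<open>coordinate_unique\<close> allows the second coordinate to be read with f as well.\<close>

lemma represents_mult:
  assumes 1: "(D, E, \<phi>) \<in> triples \<iota>" "represents x (D, E, \<phi>)"
    and 2: "(D', E, \<phi>') \<in> triples \<iota>" "represents x' (D', E, \<phi>')"
  shows "represents (x \<otimes>\<^bsub>pairs\<^esub> x') (D + D', E, \<lambda>t. \<phi> t * \<phi>' t)"
proof -
  obtain f k where f: "f \<noteq> 0" "E = B + div_fun \<iota> f" "k \<in> relations"
    "(D, \<phi> (\<lambda>P. frame B P / f)) = x \<otimes>\<^bsub>pairs\<^esub> k"
    using 1(2) by (rule representsE)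
  obtain f' k' where f': "f' \<noteq> 0" "E = B + div_fun \<iota> f'" "k' \<in> relations"
    "(D', \<phi>' (\<lambda>P. frame B P / f')) = x' \<otimes>\<^bsub>pairs\<^esub> k'"
    using 2(2) by (rule representsE)
  show ?thesis
  proof (rule representsI[of f _ "k \<otimes>\<^bsub>pairs\<^esub> k'"])
    show "k \<otimes>\<^bsub>pairs\<^esub> k' \<in> relations" by (rule relations_mult[OF f(3) f'(3)])
    show "(D + D', \<phi> (\<lambda>P. frame B P / f) * \<phi>' (\<lambda>P. frame B P / f))
        = x \<otimes>\<^bsub>pairs\<^esub> x' \<otimes>\<^bsub>pairs\<^esub> (k \<otimes>\<^bsub>pairs\<^esub> k')"
      using f(4) f'(4) coordinate_unique[OF 2(1) f(1,2) f'(1,2)] by (simp add: add_ac mult_ac)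
  qed (use f in auto)
qed

text \<open>\<open>left_mult\<close> is a union over all pairs of representatives with a common E.
  Each of them gives the same class, and there is at least one, because \<open>base x\<close> and
  \<open>base x'\<close> share the component B.\<close>

lemma left_mult_pair_class:
  assumes x: "x \<in> carrier pairs" and x': "x' \<in> carrier pairs"
  shows "left_mult \<iota> (pair_class x) (pair_class x') = pair_class (x \<otimes>\<^bsub>pairs\<^esub> x')"
proof -
  let ?C = "{torsor_class \<iota> (D + D', E, \<lambda>t. \<phi> t * \<phi>' t) | D D' E \<phi> \<phi>'.
     (D, E, \<phi>) \<in> pair_class x \<and> (D', E, \<phi>') \<in> pair_class x'}"
  have cls: "torsor_class \<iota> (D + D', E, \<lambda>t. \<phi> t * \<phi>' t) = pair_class (x \<otimes>\<^bsub>pairs\<^esub> x')"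
    if "(D, E, \<phi>) \<in> pair_class x" "(D', E, \<phi>') \<in> pair_class x'" for D D' E \<phi> \<phi>'
    using that unfolding pair_class_eq[OF x] pair_class_eq[OF x'] mem_Collect_eq
    by (intro torsor_class_represents pairs.m_closed x x' triple_mult represents_mult) blast+
  have "base x \<in> pair_class x" "base x' \<in> pair_class x'"
    using pair_class_eq x x' base_triple base_represents by blast+
  then have "\<exists>C. C \<in> ?C" unfolding base_def by blast
  then have "?C = {pair_class (x \<otimes>\<^bsub>pairs\<^esub> x')}" using cls by blast
  then show ?thesis unfolding left_mult_def by simp
qed

lemma represents_scale:
  assumes "represents x (D, E, \<phi>)"
  shows "represents (fst x, c * snd x) (D, E, \<lambda>t. c * \<phi> t)"
proof -
  obtain f k where f: "f \<noteq> 0" "E = B + div_fun \<iota> f" "k \<in> relations"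
    "(D, \<phi> (\<lambda>P. frame B P / f)) = x \<otimes>\<^bsub>pairs\<^esub> k"
    using assms by (rule representsE)
  then show ?thesis by (intro representsI[of f _ k]) auto
qed

lemma torsor_scale_pair_class:
  assumes x: "x \<in> carrier pairs" and c: "c \<noteq> 0"
  shows "torsor_scale c (pair_class x) = pair_class (fst x, c * snd x)"
proof -
  have sub: "torsor_scale d (pair_class z) \<subseteq> pair_class (fst z, d * snd z)"
    if z: "z \<in> carrier pairs" and d: "d \<noteq> 0" for z d
  proof -
    have dz: "(fst z, d * snd z) \<in> carrier pairs" using z d by simp
    show ?thesis
      unfolding torsor_scale_def pair_class_eq[OF z] pair_class_eq[OF dz]
      using triple_scale[OF _ d] represents_scale[of z _ _ _ d] by auto
  qed
  have cx: "(fst x, c * snd x) \<in> carrier pairs" using x c by simp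
  have "\<tau> \<in> torsor_scale c (pair_class x)" if \<tau>: "\<tau> \<in> pair_class (fst x, c * snd x)" for \<tau>
  proof -
    obtain D E \<phi> where \<tau>_eq: "\<tau> = (D, E, \<phi>)" by (cases \<tau>)
    \<comment> \<open>The reverse inclusion is the forward one for the inverse of c.\<close>
    have "(D, E, \<lambda>t. inverse c * \<phi> t) \<in> torsor_scale (inverse c) (pair_class (fst x, c * snd x))"
      unfolding torsor_scale_def using \<tau> \<tau>_eq by (force simp: image_iff)
    then have "(D, E, \<lambda>t. inverse c * \<phi> t) \<in> pair_class x"
      using sub[OF cx, of "inverse c"] c by (auto simp flip: mult.assoc)
    moreover have "\<tau> = (\<lambda>(D, E, \<phi>). (D, E, \<lambda>t. c * \<phi> t)) (D, E, \<lambda>t. inverse c * \<phi> t)"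
      using c by (simp add: \<tau>_eq mult.assoc[symmetric])
    ultimately show ?thesis unfolding torsor_scale_def by (rule rev_image_eqI)
  qed
  then show ?thesis using sub[OF x c] by blast
qed

text \<open>Over the zero divisor every evaluation is an empty product, so the norm of 1 has
  coordinate 1 in every frame, for each E in the class.\<close>

lemma left_one_eq: "left_one \<iota> (div_class \<iota> B) = pair_class (0, 1)"
proof -
  let ?C = "{torsor_class \<iota> (0, E, norm_section \<iota> 0 (bundle_of_div E) 1) | E. E \<in> div_class \<iota> B}"
  have "torsor_class \<iota> (0, E, norm_section \<iota> 0 (bundle_of_div E) 1) = pair_class (0, 1)"
    if E: "E \<in> div_class \<iota> B" for E
  proof -
    obtain f where f: "f \<noteq> 0" "E = B + div_fun \<iota> f" using E by (auto simp: div_class_eq)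
    have E0: "E \<in> Div0 \<iota>" using f B by (simp add: Div0_add div_fun_Div0)
    have eq: "norm_section \<iota> 0 (bundle_of_div E) 1 = norm_elt E 0 1"
      by (auto simp: norm_section_def norm_elt_def)
    have t: "(\<lambda>P. frame B P / f) \<in> frames \<iota> (bundle_of_div E)"
      using frames_shift[OF frame_in_frames f(1), of B] f by simp
    show ?thesis unfolding eq
    proof (intro torsor_class_represents norm_elt_triple Div0_zero E0 representsI[OF f relations_one])
      show "(0, norm_elt E 0 1 (\<lambda>P. frame B P / f)) = (0, 1) \<otimes>\<^bsub>pairs\<^esub> (0, 1)"
        using t by (simp add: norm_elt_def)
    qed (auto simp: Div0_zero)
  qed
  moreover have "B \<in> div_class \<iota> B" unfolding div_class_eq by (intro CollectI exI[of _ 1]) simp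
  ultimately have "?C = {pair_class (0, 1)}" by blast
  then show ?thesis unfolding left_one_def by simp
qed

lemma carrier_left_group: "carrier (left_group \<iota> (div_class \<iota> B)) = pair_class ` carrier pairs"
proof (intro equalityI subsetI)
  fix \<pi> assume \<pi>: "\<pi> \<in> carrier (left_group \<iota> (div_class \<iota> B))"
  obtain D E \<phi> where \<tau>: "\<pi> = torsor_class \<iota> (D, E, \<phi>)" "(D, E, \<phi>) \<in> triples \<iota>"
    "div_class \<iota> E = div_class \<iota> B"
  proof -
    obtain z where "\<pi> \<in> torsor_fibre \<iota> z (div_class \<iota> B)"
      using \<pi> by (auto simp: left_group_def)
    then show ?thesis using that unfolding torsor_fibre_def by blast
  qed
  obtain f where f: "f \<noteq> 0" "E = B + div_fun \<iota> f" using \<tau>(3) by (auto simp: div_class_eq_iff)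
  let ?x = "(D, \<phi> (\<lambda>P. frame B P / f))"
  have "(\<lambda>P. frame B P / f) \<in> frames \<iota> (bundle_of_div E)"
    using frames_shift[OF frame_in_frames f(1), of B] f by simp
  then have x: "?x \<in> carrier pairs" using \<tau>(2) triple_nonzero[OF \<tau>(2)] by (simp add: triples_iff)
  have "represents ?x (D, E, \<phi>)"
    by (rule representsI[OF f relations_one]) simp
  then have "\<pi> = pair_class ?x" unfolding \<tau>(1) by (intro torsor_class_represents x \<tau>(2))
  with x show "\<pi> \<in> pair_class ` carrier pairs" by blast
next
  fix \<pi> assume "\<pi> \<in> pair_class ` carrier pairs"
  then obtain x where x: "x \<in> carrier pairs" "\<pi> = pair_class x" by blast
  have "\<pi> \<in> torsor_fibre \<iota> (div_class \<iota> (fst x)) (div_class \<iota> B)"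
    using base_triple[OF x(1)] unfolding torsor_fibre_def x(2) pair_class_def base_def by blast
  then show "\<pi> \<in> carrier (left_group \<iota> (div_class \<iota> B))"
    using x(1) by (auto simp: left_group_def Jac_def)
qed

lemma pair_class_hom: "pair_class \<in> hom pairs (left_group \<iota> (div_class \<iota> B))"
proof (rule homI)
  show "pair_class (x \<otimes>\<^bsub>pairs\<^esub> y) = pair_class x \<otimes>\<^bsub>left_group \<iota> (div_class \<iota> B)\<^esub> pair_class y"
    if "x \<in> carrier pairs" "y \<in> carrier pairs" for x y
    using left_mult_pair_class[OF that] by (simp add: left_group_def)
qed (simp only: carrier_left_group image_eqI)

text \<open>The group axioms for \<open>left_mult\<close> are inherited from \<open>pairs\<close>,
  of which the left group is a homomorphic image.\<close>

lemma comm_group_left_group: "comm_group (left_group \<iota> (div_class \<iota> B))"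
proof -
  let ?G = "left_group \<iota> (div_class \<iota> B)"
  have "?G\<lparr>carrier := pair_class ` carrier pairs, one := pair_class \<one>\<^bsub>pairs\<^esub>\<rparr> = ?G"
    using carrier_left_group left_one_eq by (simp add: left_group_def)
  then show ?thesis using pairs.hom_imp_img_comm_group[OF pair_class_hom] by simp
qed

text \<open>Pairs with the same class differ by a relation, hence in the first component by a
  principal divisor.\<close>

lemma pair_class_div_class:
  assumes x: "x \<in> carrier pairs" "x' \<in> carrier pairs" and eq: "pair_class x = pair_class x'"
  shows "div_class \<iota> (fst x) = div_class \<iota> (fst x')"
proof -
  have "base x \<in> pair_class x'"
    using base_triple base_represents x unfolding eq[symmetric] by (simp add: pair_class_eq)
  then have "represents x' (base x)" using x by (simp add: pair_class_eq)
  then obtain k where k: "k \<in> relations" "fst x = fst x' + fst k"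
    unfolding base_def by (auto elim!: representsE)
  then show ?thesis using relations_principal[OF k(1)] by (auto simp: div_class_eq_iff)
qed

text \<open>The section 1 of O(B) has divisor B; since D avoids it, the norm of 1 along D is
  nonzero, and c is its coordinate in the fixed frame.\<close>

lemma pair_point_eq:
  assumes D: "D \<in> Div0 \<iota>" and disj: "disjoint_div D B"
  obtains c where "c \<noteq> 0" "pair_point \<iota> D B = pair_class (D, c)"
proof (rule that)
  have keys: "Poly_Mapping.keys D \<subseteq> points \<iota>" using D by (simp add: Div0_iff)
  have disj': "disjoint_div (B + div_fun \<iota> 1) D" using disj by (auto simp: disjoint_div_def)
  show "eval_div \<iota> D (\<lambda>P. 1 / frame B P) \<noteq> 0"
    by (rule section_eval_nonzero[OF _ keys disj']) simp
  show "pair_point \<iota> D B = pair_class (D, eval_div \<iota> D (\<lambda>P. 1 / frame B P))"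
    unfolding pair_point_def pair_class_def base_def
    by (simp add: norm_section_eq[OF keys _ disj'])
qed

end


section \<open>Iterated combinations\<close>

lemma comm_group_hom_finprod:
  assumes G: "comm_group G" and H: "comm_group H" and h: "h \<in> hom G H"
    and f: "f \<in> A \<rightarrow> carrier G"
  shows "h (finprod G f A) = finprod H (\<lambda>i. h (f i)) A"
proof -
  interpret G: comm_group G by (rule G)
  interpret H: comm_group H by (rule H)
  interpret group_hom G H h by unfold_locales (rule h)
  show ?thesis using f
  proof (induction A rule: infinite_finite_induct)
    case (insert a A)
    then show ?case by (simp add: Pi_iff G.finprod_insert H.finprod_insert)
  qed (simp_all add: G.finprod_infinite H.finprod_infinite)
qed

text \<open>One step of the chain: l and r stand for the scalar and the divisor reached so far, m
  and d for the new power, m' and r' for the scalar and the divisor after the inverted product. The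
  factor in front of r' is the next scalar.\<close>

lemma (in comm_group) inv_mult_rearrange:
  assumes "l \<in> carrier G" "r \<in> carrier G" "m \<in> carrier G" "d \<in> carrier G" "m' \<in> carrier G" "r' \<in> carrier G"
    and "inv (r \<otimes> d) = m' \<otimes> r'"
  shows "inv (l \<otimes> r) \<otimes> inv (m \<otimes> d) = (m' \<otimes> inv m \<otimes> inv l) \<otimes> r'"
proof -
  have "inv (l \<otimes> r) \<otimes> inv (m \<otimes> d) = (inv m \<otimes> inv l) \<otimes> inv (r \<otimes> d)"
    using assms(1-6) by (simp add: inv_mult m_ac)
  also have "\<dots> = (m' \<otimes> inv m \<otimes> inv l) \<otimes> r'"
    unfolding assms(7) using assms(1-6) by (simp add: m_ac)
  finally show ?thesis .
qed

text \<open>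
  Every step of the chain inverts, so the partial product up to \<open>j\<close> is reached with exponents of the
  sign \<open>(-1) ^ (s - j)\<close>.
\<close>

lemma (in comm_group) alternating_combination:
  fixes n :: "nat \<Rightarrow> int" and s :: nat
  assumes a: "\<And>i. i \<in> {1..s} \<Longrightarrow> a i \<in> carrier G" and r: "\<And>i. i \<in> {1..s} \<Longrightarrow> r i \<in> carrier G"
    and d: "\<And>i. i \<in> {2..s} \<Longrightarrow> d i \<in> carrier G" and l: "\<And>i. i \<in> {1..s} \<Longrightarrow> l i \<in> carrier G"
    and m: "\<And>i. i \<in> {2..s} \<Longrightarrow> m i \<in> carrier G" and m': "\<And>i. i \<in> {2..s} \<Longrightarrow> m' i \<in> carrier G"
    and start: "a 1 [^] ((-1) ^ (s - 1) * n 1) = l 1 \<otimes> r 1"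
    and powers: "\<And>i. i \<in> {2..s} \<Longrightarrow> a i [^] ((-1) ^ (s + 1 - i) * n i) = m i \<otimes> d i"
    and step: "\<And>i. i \<in> {2..s} \<Longrightarrow> inv (r (i - 1) \<otimes> d i) = m' i \<otimes> r i"
    and ratio: "\<And>i. i \<in> {2..s} \<Longrightarrow> l i = m' i \<otimes> inv (m i) \<otimes> inv (l (i - 1))"
    and s: "1 \<le> s"
  shows "(\<Otimes>i\<in>{1..s}. a i [^] n i) = l s \<otimes> r s"
proof -
  define p where "p = (\<lambda>j. \<Otimes>i\<in>{1..j}. a i [^] n i)"
  have p_closed: "p j \<in> carrier G" if "j \<le> s" for j
    unfolding p_def using a that by (intro finprod_closed) auto
  have "p j [^] ((-1) ^ (s - j) :: int) = l j \<otimes> r j" if "1 \<le> j" "j \<le> s" for j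
    using that
  proof (induction j rule: dec_induct)
    case base
    have "p 1 = a 1 [^] n 1" unfolding p_def using a[of 1] s by simp
    then show ?case using start a[of 1] s by (simp add: int_pow_pow mult.commute)
  next
    case (step j)
    let ?e = "(-1) ^ (s - Suc j) :: int" and ?i = "Suc j"
    have j: "Suc j \<in> {2..s}" "j \<in> {1..s}" "Suc j \<in> {1..s}" using step.hyps step.prems by auto
    have "s - j = Suc (s - Suc j)" using step.prems by simp
    then have e: "(-1) ^ (s - j) = - ?e" by simp
    have "{1..?i} = insert ?i {1..j}" by auto
    then have "p ?i = a ?i [^] n ?i \<otimes> p j"
      unfolding p_def using a step.prems by (simp add: finprod_insert Pi_iff)
    then have "p ?i = p j \<otimes> a ?i [^] n ?i"
      using p_closed[of j] a[OF j(3)] step.prems by (simp add: m_comm)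
    then have "p ?i [^] ?e = p j [^] ?e \<otimes> a ?i [^] (n ?i * ?e)"
      using p_closed[of j] a[OF j(3)] step.prems by (simp add: int_pow_distrib int_pow_pow)
    also have "p j [^] ?e = inv (l j \<otimes> r j)"
    proof -
      have "p j [^] (- ?e) = l j \<otimes> r j" using step.IH step.prems e by simp
      then have "inv (p j [^] ?e) = l j \<otimes> r j" using p_closed[of j] step.prems by (simp add: int_pow_neg)
      then show ?thesis using p_closed[of j] step.prems by (metis inv_inv int_pow_closed Suc_leD)
    qed
    also have "a ?i [^] (n ?i * ?e) = inv (m ?i \<otimes> d ?i)"
    proof -
      \<comment> \<open>For i = j + 1 the exponent s + 1 - i is s - j, so the given power carries
        the sign \<open>- ?e\<close>, opposite to the one wanted.\<close>
      have "a ?i [^] (- (n ?i * ?e)) = m ?i \<otimes> d ?i" using powers[OF j(1)] e by (simp add: mult.commute)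
      then have "inv (a ?i [^] (n ?i * ?e)) = m ?i \<otimes> d ?i" using a[OF j(3)] by (simp add: int_pow_neg)
      then show ?thesis using a[OF j(3)] by (metis inv_inv int_pow_closed)
    qed
    also have "inv (l j \<otimes> r j) \<otimes> inv (m ?i \<otimes> d ?i) = (m' ?i \<otimes> inv (m ?i) \<otimes> inv (l j)) \<otimes> r ?i"
      using assms(9)[OF j(1)] l[OF j(2)] r[OF j(2)] m[OF j(1)] d[OF j(1)] m'[OF j(1)] r[OF j(3)]
      by (intro inv_mult_rearrange) simp_all
    also have "m' ?i \<otimes> inv (m ?i) \<otimes> inv (l j) = l ?i" using ratio[OF j(1)] by simp
    finally show ?case .
  qed
  \<comment> \<open>At j = s the sign is (-1) ^ 0 = 1.\<close>
  from this[of s] show ?thesis using s p_closed[of s] by (simp add: p_def)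
qed

section \<open>Consequences in the torsor group and in J(K)\<close>

context torsor_base
begin

abbreviation "torsor_group \<equiv> left_group \<iota> (div_class \<iota> B)"

lemma pair_class_closed: "x \<in> carrier pairs \<Longrightarrow> pair_class x \<in> carrier torsor_group"
  by (simp only: carrier_left_group image_eqI)

lemma pair_class_pow: "x \<in> carrier pairs \<Longrightarrow> pair_class (x [^]\<^bsub>pairs\<^esub> (n::int)) = pair_class x [^]\<^bsub>torsor_group\<^esub> n"
  by (rule hom_int_pow[OF pair_class_hom])
    (use comm_group_pairs comm_group_left_group in \<open>auto simp: comm_group_def\<close>)

lemma torsor_scale_mult:
  assumes "x \<in> carrier pairs" "c \<noteq> 0"
  shows "torsor_scale c (pair_class x) = pair_class (0, c) \<otimes>\<^bsub>torsor_group\<^esub> pair_class x"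
  using Group.hom_mult[OF pair_class_hom, of "(0, c)" x] torsor_scale_pair_class[OF assms] assms
  by (simp add: Div0_zero)

text \<open>The product is lifted to \<open>pairs\<close>, which maps to both the torsor group and
  \<open>Jac\<close>. By \<open>pair_class_div_class\<close>, equal images in the torsor group have
  equal images in \<open>Jac\<close>.\<close>

lemma div_class_finprod:
  fixes n :: "nat \<Rightarrow> int"
  assumes x: "\<And>i. i \<in> A \<Longrightarrow> x i \<in> carrier pairs" and z: "z \<in> carrier pairs"
    and eq: "(\<Otimes>\<^bsub>torsor_group\<^esub>i\<in>A. pair_class (x i) [^]\<^bsub>torsor_group\<^esub> n i) = pair_class z"
  shows "(\<Otimes>\<^bsub>Jac \<iota>\<^esub>i\<in>A. div_class \<iota> (fst (x i)) [^]\<^bsub>Jac \<iota>\<^esub> n i) = div_class \<iota> (fst z)"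
proof -
  interpret T: comm_group torsor_group by (rule comm_group_left_group)
  interpret J: comm_group "Jac \<iota>" by (rule comm_group_Jac)
  let ?x = "\<lambda>i. x i [^]\<^bsub>pairs\<^esub> n i" and ?q = "\<lambda>x. div_class \<iota> (fst x)"
  have q: "?q \<in> hom pairs (Jac \<iota>)"
  proof (rule homI)
    show "?q x \<in> carrier (Jac \<iota>)" if "x \<in> carrier pairs" for x
      using hom_in_carrier[OF div_class_hom, of "fst x"] that by simp
    show "?q (x \<otimes>\<^bsub>pairs\<^esub> y) = ?q x \<otimes>\<^bsub>Jac \<iota>\<^esub> ?q y" if "x \<in> carrier pairs" "y \<in> carrier pairs" for x y
      using Group.hom_mult[OF div_class_hom, of "fst x" "fst y"] that by simp
  qed
  have xc: "?x \<in> A \<rightarrow> carrier pairs" using x by (blast intro: pairs.int_pow_closed)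
  have "pair_class (\<Otimes>\<^bsub>pairs\<^esub>i\<in>A. ?x i) = (\<Otimes>\<^bsub>torsor_group\<^esub>i\<in>A. pair_class (?x i))"
    by (rule comm_group_hom_finprod[OF comm_group_pairs comm_group_left_group pair_class_hom xc])
  also have "\<dots> = (\<Otimes>\<^bsub>torsor_group\<^esub>i\<in>A. pair_class (x i) [^]\<^bsub>torsor_group\<^esub> n i)"
    by (rule T.finprod_cong') (use x in \<open>auto simp: pair_class_pow pair_class_closed simp del: pairs_simps(1)\<close>)
  finally have "pair_class (\<Otimes>\<^bsub>pairs\<^esub>i\<in>A. ?x i) = pair_class z" using eq by simp
  then have "?q (\<Otimes>\<^bsub>pairs\<^esub>i\<in>A. ?x i) = ?q z"
    by (intro pair_class_div_class pairs.finprod_closed xc z)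
  moreover have "?q (\<Otimes>\<^bsub>pairs\<^esub>i\<in>A. ?x i) = (\<Otimes>\<^bsub>Jac \<iota>\<^esub>i\<in>A. ?q (?x i))"
    by (rule comm_group_hom_finprod[OF comm_group_pairs comm_group_Jac q xc])
  moreover have "(\<Otimes>\<^bsub>Jac \<iota>\<^esub>i\<in>A. ?q (?x i)) = (\<Otimes>\<^bsub>Jac \<iota>\<^esub>i\<in>A. ?q (x i) [^]\<^bsub>Jac \<iota>\<^esub> n i)"
  proof (rule J.finprod_cong')
    have pow: "?q (?x i) = ?q (x i) [^]\<^bsub>Jac \<iota>\<^esub> n i" if "i \<in> A" for i
      by (rule hom_int_pow[OF q x[OF that]]) (rule pairs.is_group, rule J.is_group)
    have closed: "?q (x i) \<in> carrier (Jac \<iota>)" if "i \<in> A" for i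
      using hom_in_carrier[OF q x[OF that]] .
    show "(\<lambda>i. ?q (x i) [^]\<^bsub>Jac \<iota>\<^esub> n i) \<in> A \<rightarrow> carrier (Jac \<iota>)" using closed by auto
    show "?q (?x i) = ?q (x i) [^]\<^bsub>Jac \<iota>\<^esub> n i" if "i \<in> A" for i by (rule pow[OF that])
  qed simp
  ultimately show ?thesis by simp
qed

end


theorem mainTheorem9:
  fixes \<iota> :: "'k::field \<Rightarrow> 'f::field"
    and L :: "'f lbundle" and \<delta> :: int and d\<^sub>0 e\<^sub>0 :: 'f
    and s :: nat and D \<Delta> R :: "nat \<Rightarrow> 'f divisor" and E D\<^sub>0 E\<^sub>0 :: "'f divisor"
    and n :: "nat \<Rightarrow> int" and lam mu mu' :: "nat \<Rightarrow> 'k"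
    and y :: "'f divisor set"
  assumes "curve \<iota>"
    and "\<exists>P\<in>points \<iota>. point_degree \<iota> P = 1"
    and "line_bundle \<iota> L" and "has_degree \<iota> L \<delta>" and "\<delta> \<ge> 2 * int (genus \<iota>) + 1"
    and "d\<^sub>0 \<in> global_sections \<iota> L" and "d\<^sub>0 \<noteq> 0"
    and "e\<^sub>0 \<in> global_sections \<iota> L" and "e\<^sub>0 \<noteq> 0"
    and "D\<^sub>0 = div_section \<iota> L d\<^sub>0" and "E\<^sub>0 = div_section \<iota> L e\<^sub>0"
    and "disjoint_div D\<^sub>0 E\<^sub>0"
    and "s \<ge> 1"
    and "\<forall>i\<in>{1..s}. effective \<iota> \<delta> (D i)"
    and "effective \<iota> \<delta> E"
    and "\<forall>i\<in>{2..s}. effective \<iota> \<delta> (\<Delta> i)"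
    and "\<forall>i\<in>{1..s}. effective \<iota> \<delta> (R i)"
    and "disjoint_div D\<^sub>0 E"
    and "\<forall>i\<in>{1..s}. disjoint_div (D i) E \<and> disjoint_div (D i) E\<^sub>0"
    and "\<forall>i\<in>{2..s}. disjoint_div (\<Delta> i) E \<and> disjoint_div (\<Delta> i) E\<^sub>0"
    and "\<forall>i\<in>{1..s}. disjoint_div (R i) E \<and> disjoint_div (R i) E\<^sub>0"
    and "lam 1 \<noteq> 0" and "\<forall>i\<in>{2..s}. mu i \<noteq> 0 \<and> mu' i \<noteq> 0"
    and "y = div_class \<iota> (E - E\<^sub>0)"
    and "bracket \<iota> D\<^sub>0 E\<^sub>0 (D 1) E [^]\<^bsub>left_group \<iota> y\<^esub> ((-1) ^ (s - 1) * n 1)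
           = torsor_scale (lam 1) (bracket \<iota> D\<^sub>0 E\<^sub>0 (R 1) E)"
    and "\<forall>i\<in>{2..s}. bracket \<iota> D\<^sub>0 E\<^sub>0 (D i) E [^]\<^bsub>left_group \<iota> y\<^esub> ((-1) ^ (s + 1 - i) * n i)
           = torsor_scale (mu i) (bracket \<iota> D\<^sub>0 E\<^sub>0 (\<Delta> i) E)"
    and "\<forall>i\<in>{2..s}.
           (bracket \<iota> D\<^sub>0 E\<^sub>0 (R (i - 1)) E \<otimes>\<^bsub>left_group \<iota> y\<^esub> bracket \<iota> D\<^sub>0 E\<^sub>0 (\<Delta> i) E)
             [^]\<^bsub>left_group \<iota> y\<^esub> (-1 :: int)
           = torsor_scale (mu' i) (bracket \<iota> D\<^sub>0 E\<^sub>0 (R i) E)"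
    and "\<forall>i\<in>{2..s}. lam i = mu' i / (mu i * lam (i - 1))"
  shows "bundle_class \<iota> (twist (dual_bundle L) (R s))
           = (\<Otimes>\<^bsub>Jac \<iota>\<^esub>i\<in>{1..s}. bundle_class \<iota> (twist (dual_bundle L) (D i)) [^]\<^bsub>Jac \<iota>\<^esub> n i) \<and>
         (\<Otimes>\<^bsub>left_group \<iota> y\<^esub>i\<in>{1..s}. bracket \<iota> D\<^sub>0 E\<^sub>0 (D i) E [^]\<^bsub>left_group \<iota> y\<^esub> n i)
           = torsor_scale (lam s) (bracket \<iota> D\<^sub>0 E\<^sub>0 (R s) E)"
proof -
  have hom: "field_hom \<iota>" and ff: "function_field \<iota>" using assms(1) by (auto simp: curve_def)
  interpret C: function_field_curve \<iota>
    by (intro function_field_curve.intro function_field_curve_axioms.intro hom ff)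
  \<comment> \<open>The third of these facts discharges \<open>principal_degree\<close> in the
    interpretation below.\<close>
  note deg = C.degree_div_section[OF assms(3,4)]
  interpret C: curve_with_point \<iota>
    by unfold_locales (fact deg(3), fact assms(2))
  have D0: "Poly_Mapping.keys D\<^sub>0 \<subseteq> points \<iota>" "degree_div \<iota> D\<^sub>0 = \<delta>"
    and E0: "Poly_Mapping.keys E\<^sub>0 \<subseteq> points \<iota>" "degree_div \<iota> E\<^sub>0 = \<delta>"
    using deg(1,2)[OF assms(7)] deg(1,2)[OF assms(9)] assms(10,11) by auto
  define B where "B = E - E\<^sub>0"
  interpret C: torsor_base \<iota> B
    by unfold_locales (unfold B_def, rule C.effective_diff_Div0[OF assms(15) E0])
  have y: "y = div_class \<iota> B" using assms(24) by (simp add: B_def)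
  interpret T: comm_group C.torsor_group by (rule C.comm_group_left_group)
  \<comment> \<open>Each admissible divisor F gets one pair over F - \<open>D\<^sub>0\<close> whose
    class is the bracket of F and E; the hypotheses can then be stated for classes of pairs.\<close>
  have "\<exists>x. effective \<iota> \<delta> F \<and> disjoint_div F E \<and> disjoint_div F E\<^sub>0 \<longrightarrow>
      x \<in> carrier C.pairs \<and> fst x = F - D\<^sub>0 \<and> bracket \<iota> D\<^sub>0 E\<^sub>0 F E = C.pair_class x" for F
  proof (cases "effective \<iota> \<delta> F \<and> disjoint_div F E \<and> disjoint_div F E\<^sub>0")
    case True
    then have F: "F - D\<^sub>0 \<in> Div0 \<iota>" using C.effective_diff_Div0[OF _ D0] by blast
    have "disjoint_div (F - D\<^sub>0) B"
      using True assms(12,18) keys_diff[of F D\<^sub>0] keys_diff[of E E\<^sub>0]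
      unfolding disjoint_div_def B_def by blast
    then obtain c where "c \<noteq> 0" "pair_point \<iota> (F - D\<^sub>0) B = C.pair_class (F - D\<^sub>0, c)"
      by (rule C.pair_point_eq[OF F])
    then show ?thesis using F by (intro exI[of _ "(F - D\<^sub>0, c)"]) (simp add: bracket_def B_def)
  qed blast
  then obtain x where x: "\<And>F. effective \<iota> \<delta> F \<Longrightarrow> disjoint_div F E \<and> disjoint_div F E\<^sub>0 \<Longrightarrow>
      x F \<in> carrier C.pairs \<and> fst (x F) = F - D\<^sub>0 \<and> bracket \<iota> D\<^sub>0 E\<^sub>0 F E = C.pair_class (x F)"
    by metis
  note xD = x[OF bspec[OF assms(14)] bspec[OF assms(19)]]
    and xd = x[OF bspec[OF assms(16)] bspec[OF assms(20)]]
    and xR = x[OF bspec[OF assms(17)] bspec[OF assms(21)]]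
  have Dc: "x (D i) \<in> carrier C.pairs" and Df: "fst (x (D i)) = D i - D\<^sub>0"
    and Db: "bracket \<iota> D\<^sub>0 E\<^sub>0 (D i) E = C.pair_class (x (D i))" if "i \<in> {1..s}" for i
    using xD[OF that that] by blast+
  have dc: "x (\<Delta> i) \<in> carrier C.pairs"
    and db: "bracket \<iota> D\<^sub>0 E\<^sub>0 (\<Delta> i) E = C.pair_class (x (\<Delta> i))" if "i \<in> {2..s}" for i
    using xd[OF that that] by blast+
  have Rc: "x (R i) \<in> carrier C.pairs" and Rf: "fst (x (R i)) = R i - D\<^sub>0"
    and Rb: "bracket \<iota> D\<^sub>0 E\<^sub>0 (R i) E = C.pair_class (x (R i))" if "i \<in> {1..s}" for i
    using xR[OF that that] by blast+
  have lam: "lam i \<noteq> 0" if "1 \<le> i" "i \<le> s" for i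
    using that
  proof (induction i rule: dec_induct)
    case (step i)
    then show ?case using bspec[OF assms(23), of "Suc i"] bspec[OF assms(28), of "Suc i"] by simp
  qed (use assms(22) in simp)
  \<comment> \<open>The scalars as elements of the torsor group lying over 0 in J(K), so that all
    hypotheses become identities in one commutative group.\<close>
  let ?z = "\<lambda>c. C.pair_class (0, c)"
  have z: "?z c \<in> carrier C.torsor_group" if "c \<noteq> 0" for c
    using that by (intro C.pair_class_closed) (simp add: C.Div0_zero)
  have z_mult: "?z (b * c) = ?z b \<otimes>\<^bsub>C.torsor_group\<^esub> ?z c" if "b \<noteq> 0" "c \<noteq> 0" for b c
    using Group.hom_mult[OF C.pair_class_hom, of "(0, b)" "(0, c)"] that by (simp add: C.Div0_zero)
  have z_one: "?z 1 = \<one>\<^bsub>C.torsor_group\<^esub>"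
    using hom_one[OF C.pair_class_hom C.pairs.is_group T.is_group] by simp
  have z_inverse: "?z (inverse c) = inv\<^bsub>C.torsor_group\<^esub> ?z c" if "c \<noteq> 0" for c
    using z_mult[of "inverse c" c] that z z_one by (intro T.inv_equality[symmetric]) auto
  have scale: "torsor_scale c (C.pair_class u) = ?z c \<otimes>\<^bsub>C.torsor_group\<^esub> C.pair_class u"
    if "c \<noteq> 0" "u \<in> carrier C.pairs" for c u
    by (rule C.torsor_scale_mult[OF that(2,1)])
  have main: "(\<Otimes>\<^bsub>C.torsor_group\<^esub>i\<in>{1..s}. C.pair_class (x (D i)) [^]\<^bsub>C.torsor_group\<^esub> n i)
      = ?z (lam s) \<otimes>\<^bsub>C.torsor_group\<^esub> C.pair_class (x (R s))"
  proof (rule T.alternating_combination[where d = "\<lambda>i. C.pair_class (x (\<Delta> i))" and l = "\<lambda>i. ?z (lam i)"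
        and m = "\<lambda>i. ?z (mu i)" and m' = "\<lambda>i. ?z (mu' i)" and r = "\<lambda>i. C.pair_class (x (R i))"])
    have one: "1 \<in> {1..s}" using assms(13) by simp
    show "C.pair_class (x (D 1)) [^]\<^bsub>C.torsor_group\<^esub> ((- 1) ^ (s - 1) * n 1)
        = ?z (lam 1) \<otimes>\<^bsub>C.torsor_group\<^esub> C.pair_class (x (R 1))"
      using assms(25) unfolding y Db[OF one] Rb[OF one] scale[OF assms(22) Rc[OF one]] .
    show "C.pair_class (x (D i)) \<in> carrier C.torsor_group" if "i \<in> {1..s}" for i
      by (rule C.pair_class_closed[OF Dc[OF that]])
    show "C.pair_class (x (R i)) \<in> carrier C.torsor_group" if "i \<in> {1..s}" for i
      by (rule C.pair_class_closed[OF Rc[OF that]])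
    show "?z (lam i) \<in> carrier C.torsor_group" if "i \<in> {1..s}" for i
      using that by (intro z lam) auto
    fix i assume i: "i \<in> {2..s}"
    then have i': "i \<in> {1..s}" "i - 1 \<in> {1..s}" by auto
    have nz: "mu i \<noteq> 0" "mu' i \<noteq> 0" using bspec[OF assms(23) i] by auto
    show "C.pair_class (x (\<Delta> i)) \<in> carrier C.torsor_group" by (rule C.pair_class_closed[OF dc[OF i]])
    show "?z (mu i) \<in> carrier C.torsor_group" "?z (mu' i) \<in> carrier C.torsor_group"
      by (rule z, rule nz)+
    show "C.pair_class (x (D i)) [^]\<^bsub>C.torsor_group\<^esub> ((- 1) ^ (s + 1 - i) * n i)
        = ?z (mu i) \<otimes>\<^bsub>C.torsor_group\<^esub> C.pair_class (x (\<Delta> i))"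
      using bspec[OF assms(26) i] unfolding y Db[OF i'(1)] db[OF i] scale[OF nz(1) dc[OF i]] .
    have closed: "C.pair_class (x (R (i - 1))) \<otimes>\<^bsub>C.torsor_group\<^esub> C.pair_class (x (\<Delta> i)) \<in> carrier C.torsor_group"
      by (intro T.m_closed C.pair_class_closed Rc dc i i')
    have "(C.pair_class (x (R (i - 1))) \<otimes>\<^bsub>C.torsor_group\<^esub> C.pair_class (x (\<Delta> i))) [^]\<^bsub>C.torsor_group\<^esub> (-1 :: int)
        = ?z (mu' i) \<otimes>\<^bsub>C.torsor_group\<^esub> C.pair_class (x (R i))"
      using bspec[OF assms(27) i] unfolding y Rb[OF i'(1)] Rb[OF i'(2)] db[OF i] scale[OF nz(2) Rc[OF i'(1)]] .
    then show "inv\<^bsub>C.torsor_group\<^esub> (C.pair_class (x (R (i - 1))) \<otimes>\<^bsub>C.torsor_group\<^esub> C.pair_class (x (\<Delta> i)))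
        = ?z (mu' i) \<otimes>\<^bsub>C.torsor_group\<^esub> C.pair_class (x (R i))"
      using T.int_pow_neg[OF closed, of 1] T.int_pow_1[OF closed] by simp
    have l: "lam (i - 1) \<noteq> 0" using i'(2) by (intro lam) auto
    have inz: "inverse (mu i) \<noteq> 0" "inverse (lam (i - 1)) \<noteq> 0" "mu' i * inverse (mu i) \<noteq> 0"
      using nz l by auto
    have lam_i: "lam i = mu' i * inverse (mu i) * inverse (lam (i - 1))"
      using bspec[OF assms(28) i] by (simp add: divide_inverse)
    show "?z (lam i) = ?z (mu' i) \<otimes>\<^bsub>C.torsor_group\<^esub> inv\<^bsub>C.torsor_group\<^esub> ?z (mu i)
        \<otimes>\<^bsub>C.torsor_group\<^esub> inv\<^bsub>C.torsor_group\<^esub> ?z (lam (i - 1))"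
      unfolding lam_i z_mult[OF inz(3,2)] z_mult[OF nz(2) inz(1)] z_inverse[OF nz(1)] z_inverse[OF l] ..
  qed (rule assms(13))
  have s: "s \<in> {1..s}" using assms(13) by simp
  have lam_s: "lam s \<noteq> 0" using assms(13) by (intro lam) auto
  \<comment> \<open>The scalar is absorbed into the pair of \<open>R s\<close>; the first component,
    and with it the class in J(K), stays the same.\<close>
  have xs: "(fst (x (R s)), lam s * snd (x (R s))) \<in> carrier C.pairs"
    using Rc[OF s] lam_s by simp
  have scaled: "?z (lam s) \<otimes>\<^bsub>C.torsor_group\<^esub> C.pair_class (x (R s))
      = C.pair_class (fst (x (R s)), lam s * snd (x (R s)))"
    using scale[OF lam_s Rc[OF s]] C.torsor_scale_pair_class[OF Rc[OF s] lam_s] by simp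
  have keys: "Poly_Mapping.keys F \<subseteq> points \<iota>" if "effective \<iota> \<delta> F" for F
    using that by (simp add: effective_def C.carrier_Div_iff)
  have cls: "bundle_class \<iota> (twist (dual_bundle L) F) = div_class \<iota> (F - D\<^sub>0)" if "effective \<iota> \<delta> F" for F
    using C.bundle_class_twist_dual[OF assms(3,7) keys[OF that]] assms(10) by simp
  have "(\<Otimes>\<^bsub>Jac \<iota>\<^esub>i\<in>{1..s}. div_class \<iota> (fst (x (D i))) [^]\<^bsub>Jac \<iota>\<^esub> n i) = div_class \<iota> (fst (x (R s)))"
    using C.div_class_finprod[OF Dc xs main[unfolded scaled]] unfolding fst_conv .
  moreover have "(\<Otimes>\<^bsub>Jac \<iota>\<^esub>i\<in>{1..s}. div_class \<iota> (fst (x (D i))) [^]\<^bsub>Jac \<iota>\<^esub> n i)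
      = (\<Otimes>\<^bsub>Jac \<iota>\<^esub>i\<in>{1..s}. bundle_class \<iota> (twist (dual_bundle L) (D i)) [^]\<^bsub>Jac \<iota>\<^esub> n i)"
  proof -
    interpret J: comm_group "Jac \<iota>" by (rule C.comm_group_Jac)
    show ?thesis
    proof (rule J.finprod_cong')
      have closed: "div_class \<iota> (D i - D\<^sub>0) \<in> carrier (Jac \<iota>)" if "i \<in> {1..s}" for i
        using C.effective_diff_Div0[OF bspec[OF assms(14) that] D0] by (simp add: Jac_def)
      show "(\<lambda>i. bundle_class \<iota> (twist (dual_bundle L) (D i)) [^]\<^bsub>Jac \<iota>\<^esub> n i) \<in> {1..s} \<rightarrow> carrier (Jac \<iota>)"
      proof
        fix i assume i: "i \<in> {1..s}"
        show "bundle_class \<iota> (twist (dual_bundle L) (D i)) [^]\<^bsub>Jac \<iota>\<^esub> n i \<in> carrier (Jac \<iota>)"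
          unfolding cls[OF bspec[OF assms(14) i]] by (rule J.int_pow_closed[OF closed[OF i]])
      qed
      show "div_class \<iota> (fst (x (D i))) [^]\<^bsub>Jac \<iota>\<^esub> n i
          = bundle_class \<iota> (twist (dual_bundle L) (D i)) [^]\<^bsub>Jac \<iota>\<^esub> n i" if "i \<in> {1..s}" for i
        unfolding Df[OF that] cls[OF bspec[OF assms(14) that]] ..
    qed simp
  qed
  ultimately have part1: "bundle_class \<iota> (twist (dual_bundle L) (R s))
      = (\<Otimes>\<^bsub>Jac \<iota>\<^esub>i\<in>{1..s}. bundle_class \<iota> (twist (dual_bundle L) (D i)) [^]\<^bsub>Jac \<iota>\<^esub> n i)"
    using cls[OF bspec[OF assms(17) s]] Rf[OF s] by simp
  have "(\<Otimes>\<^bsub>C.torsor_group\<^esub>i\<in>{1..s}. bracket \<iota> D\<^sub>0 E\<^sub>0 (D i) E [^]\<^bsub>C.torsor_group\<^esub> n i)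
      = (\<Otimes>\<^bsub>C.torsor_group\<^esub>i\<in>{1..s}. C.pair_class (x (D i)) [^]\<^bsub>C.torsor_group\<^esub> n i)"
  proof (rule T.finprod_cong')
    show "(\<lambda>i. C.pair_class (x (D i)) [^]\<^bsub>C.torsor_group\<^esub> n i) \<in> {1..s} \<rightarrow> carrier C.torsor_group"
      by (intro Pi_I T.int_pow_closed C.pair_class_closed Dc)
    show "bracket \<iota> D\<^sub>0 E\<^sub>0 (D i) E [^]\<^bsub>C.torsor_group\<^esub> n i = C.pair_class (x (D i)) [^]\<^bsub>C.torsor_group\<^esub> n i"
      if "i \<in> {1..s}" for i unfolding Db[OF that] ..
  qed simp
  also have "\<dots> = torsor_scale (lam s) (bracket \<iota> D\<^sub>0 E\<^sub>0 (R s) E)"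
    unfolding main Rb[OF s] by (rule scale[OF lam_s Rc[OF s], symmetric])
  finally show ?thesis using part1 unfolding y by blast
qed

end
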